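(* Let $Y$ be a bicategory, let $G$ be its underlying omega graph, and consider the diagram $\mathbf X$ given by: $X_1=Y$; $X_2=L(G)$, the bicategory freely generated by $G$; $\rho^X:X_1\to X_2$ the inclusion of generators (the unit $G\to U L(G)$); $\lambda^X:X_2\to X_1$ the counit $L U(Y)\to Y$; $X_3$ the strict omega category freely generated by $G$; and $\kappa^X:X_2\to X_3$ the canonical omega magma morphism from the free bicategory to the free strict $2$-category on the same omega graph $G$. Then (with a suitable bridge relation $R^X$ on $X_2$) $\mathbf X$ is a weak $2$-category, and the coherence data for $Y$ is constructed from the images of the bridge-cells of $X_2$ under $\lambda^X$.
   Context: A globular set $X$ is a sequence of sets $X_i$ ($i\ge 0$; elements are called $i$-cells) with functions $dom_{i-1}^i,cod_{i-1}^i:X_i\to X_{i-1}$ ($i>0$) satisfying $dom_{i-1}^i dom_i^{i+1}=dom_{i-1}^i cod_i^{i+1}$ and $cod_{i-1}^i dom_i^{i+1}=cod_{i-1}^i cod_i^{i+1}$. For $i<j$, $dom_i^j,cod_i^j:X_j\to X_i$ are the iterated composites. An omega graph is a globular set with functions $id_i^{i-1}:X_{i-1}\to X_i$ ($i>0$) with $dom_{i-1}^i id_i^{i-1}x=x=cod_{i-1}^i id_i^{i-1}x$; $id_j^i$ denotes the iterated composite $X_i\to X_j$. Cells in the image of $id_i^{i-1}$ are identity cells; an omega graph is $n$-skeletal if every cell of dimension $>n$ is an identity cell. An omega magma is an omega graph with, for all $0\le i<j$, a partial binary operation $a\circ_i^j b$ on $j$-cells, defined exactly when $cod_i^j a=dom_i^j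 b$, such that: if $i+1=j$, then $dom_i^j(a\circ_i^j b)=dom_i^j a$ and $cod_i^j(a\circ_i^j b)=cod_i^j b$; if $i+1<j$, then $dom_{j-1}^j(a\circ_i^j b)=dom_{j-1}^ja\circ_i^{j-1}dom_{j-1}^jb$ and likewise for $cod_{j-1}^j$. Morphisms of globular sets, omega graphs and omega magmas preserve all the respective structure. A strict omega category is an omega magma in which (whenever the composites are defined) $(a\circ_i^jb)\circ_i^jc=a\circ_i^j(b\circ_i^jc)$; $(a\circ_j^kb)\circ_i^k(c\circ_j^kd)=(a\circ_i^kc)\circ_j^k(b\circ_i^kd)$ for $i<j<k$; $a=id_j^i(dom_i^ja)\circ_i^ja=a\circ_i^jid_j^i(cod_i^ja)$; and $id_{j+1}^j(a)\circ_i^{j+1}id_{j+1}^j(b)=id_{j+1}^j(a\circ_i^jb)$ for $i<j$. Two $i$-cells $a,b$ are parallel, $a\parallel b$, if they have the same $dom_{i-1}^i$ and the same $cod_{i-1}^i$; any two $0$-cells are parallel. A bridge relation $R$ on an omega graph (or omega magma) $X$ is a sequence $R_i\subseteq X_i\times X_i\times X_{i+1}$ ($i\ge0$) such that: $(a,b,c)\in R_i$ implies $a\parallel b$, $dom_i^{i+1}c=a$, $cod_i^{i+1}c=b$; $(a,a,id_{i+1}^ia)\in R_i$ for all $a\in X_i$; $(a,b,c),(a,b,d)\in R_i$ implies $c=d$. A cell $c$ occurring in a triple $(a,b,c)\in R_i$ is called a bridge-cell. The diagonal bridge relation $R^\Delta$ consists of all triples $(a,a,id_{i+1}^ia)$.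 A bridge morphism $F:(X,R^X)\to(Y,R^Y)$ is an omega magma morphism with $(a,b,c)\in R_i^X\Rightarrow(Fa,Fb,Fc)\in R_i^Y$. A categorical Penon morphism is a bridge morphism $F:(X,R^X)\to(Y,R^Y)$ such that $Y$ is a strict omega category, $R^Y=R^\Delta$; $(a,b,c)\in R_i^X$ implies $Fa=Fb$ and $Fc=id_{i+1}^i(Fa)$; and if $a,b\in X_i$, $a\parallel b$, $Fa=Fb$, then there is $c$ with $(a,b,c)\in R_i^X$. A weak omega category $\mathbf X$ consists of omega magmas $X_1$ (the underlying magma) and $X_2$, an omega magma morphism $\lambda^X:X_2\to X_1$, a morphism $\rho^X:X_1\to X_2$ of omega graphs with $\lambda^X\circ\rho^X=1$ (as omega graph morphisms), a bridge relation $R^X$ on $X_2$, a strict omega category $X_3$, and a categorical Penon morphism $\kappa^X:(X_2,R^X)\to(X_3,R^\Delta)$. A weak $2$-category is a weak omega category $\mathbf X$ with $X_1$ $2$-skeletal. A bicategory is regarded as a $2$-skeletal omega magma ($\circ_0^1$ and $\circ_0^2$ horizontal composition, $\circ_1^2$ vertical composition, all cells above dimension $2$ identities) together with coherence data (associators and left and right unit isomorphisms). $U$ is the forgetful functor from bicategories and strong (= strict, preserving all structure on the nose) homomorphisms to omega graphs, which forgets composition and coherence data, and $L$ is its left adjoint; $G=U(Y)$. The free strict omega category on an omega graph is given by the left adjoint of the forgetful functor from strict omega categories to omega graphs; as $G$ is $2$-skeletal, the one on $G$ is $2$-skeletal, i.e. a strict $2$-category, and $\kappa^X$ is the strong homomorphism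 that is the identity on the generators $G$ (equivalently, the quotient by the omega magma congruence generated by the relations holding in every strict $2$-category). *)

theory Defs
  imports Main
begin

text \<open>
  The sets \<open>X\<^sub>i\<close> of \<open>i\<close>-cells are carrier sets \<open>cells X i\<close> in one type; the same element may be a cell
  in several dimensions, so every operation and every morphism carries the dimension as an argument.
  Partial operations are total functions of HOL that are only constrained where they are defined.
\<close>

section \<open>Globular sets, omega graphs, omega magmas\<close>

text \<open>
  \<open>dm X i\<close> and \<open>cd X i\<close> are the maps from \<open>(i + 1)\<close>-cells to \<open>i\<close>-cells, \<open>idc X i\<close> is the map from
  \<open>i\<close>-cells to \<open>(i + 1)\<close>-cells, and \<open>cmp X i j a b\<close> is the composite of the \<open>j\<close>-cells \<open>a\<close>, \<open>b\<close> along an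
  \<open>i\<close>-cell, in diagrammatic order.
\<close>

record 'a globular_set =
  cells :: "nat \<Rightarrow> 'a set"
  dm :: "nat \<Rightarrow> 'a \<Rightarrow> 'a"
  cd :: "nat \<Rightarrow> 'a \<Rightarrow> 'a"

record 'a omega_graph = "'a globular_set" +
  idc :: "nat \<Rightarrow> 'a \<Rightarrow> 'a"

record 'a omega_magma = "'a omega_graph" +
  cmp :: "nat \<Rightarrow> nat \<Rightarrow> 'a \<Rightarrow> 'a \<Rightarrow> 'a"

locale globular_set =
  fixes X :: "('a, 'm) globular_set_scheme"
  assumes dm_cells: "x \<in> cells X (Suc i) \<Longrightarrow> dm X i x \<in> cells X i"
    and cd_cells: "x \<in> cells X (Suc i) \<Longrightarrow> cd X i x \<in> cells X i"
    and dm_dm: "x \<in> cells X (Suc (Suc i)) \<Longrightarrow> dm X i (dm X (Suc i) x) = dm X i (cd X (Suc i) x)"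
    and cd_dm: "x \<in> cells X (Suc (Suc i)) \<Longrightarrow> cd X i (dm X (Suc i) x) = cd X i (cd X (Suc i) x)"

text \<open>The iterated maps between dimensions \<open>i \<le> j\<close>; for \<open>i = j\<close> they are the identity.\<close>

primrec dom_it :: "('a, 'm) globular_set_scheme \<Rightarrow> nat \<Rightarrow> nat \<Rightarrow> 'a \<Rightarrow> 'a" where
  "dom_it X i 0 x = x"
| "dom_it X i (Suc j) x = (if i < Suc j then dom_it X i j (dm X j x) else x)"

primrec cod_it :: "('a, 'm) globular_set_scheme \<Rightarrow> nat \<Rightarrow> nat \<Rightarrow> 'a \<Rightarrow> 'a" where
  "cod_it X i 0 x = x"
| "cod_it X i (Suc j) x = (if i < Suc j then cod_it X i j (cd X j x) else x)"

primrec id_it :: "('a, 'm) omega_graph_scheme \<Rightarrow> nat \<Rightarrow> nat \<Rightarrow> 'a \<Rightarrow> 'a" where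
  "id_it X i 0 x = x"
| "id_it X i (Suc j) x = (if i < Suc j then idc X j (id_it X i j x) else x)"

locale omega_graph = globular_set X
  for X :: "('a, 'm) omega_graph_scheme" +
  assumes idc_cells: "x \<in> cells X i \<Longrightarrow> idc X i x \<in> cells X (Suc i)"
    and dm_idc: "x \<in> cells X i \<Longrightarrow> dm X i (idc X i x) = x"
    and cd_idc: "x \<in> cells X i \<Longrightarrow> cd X i (idc X i x) = x"

definition skeletal :: "nat \<Rightarrow> ('a, 'm) omega_graph_scheme \<Rightarrow> bool" where
  "skeletal n X \<longleftrightarrow> (\<forall>m\<ge>n. \<forall>x\<in>cells X (Suc m). \<exists>y\<in>cells X m. x = idc X m y)"

definition composable :: "('a, 'm) globular_set_scheme \<Rightarrow> nat \<Rightarrow> nat \<Rightarrow> 'a \<Rightarrow> 'a \<Rightarrow> bool" where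
  "composable X i j a b \<longleftrightarrow>
     i < j \<and> a \<in> cells X j \<and> b \<in> cells X j \<and> cod_it X i j a = dom_it X i j b"

locale omega_magma = omega_graph X
  for X :: "('a, 'm) omega_magma_scheme" +
  assumes cmp_cells: "composable X i j a b \<Longrightarrow> cmp X i j a b \<in> cells X j"
    and dm_cmp_top: "composable X i (Suc i) a b \<Longrightarrow> dm X i (cmp X i (Suc i) a b) = dm X i a"
    and cd_cmp_top: "composable X i (Suc i) a b \<Longrightarrow> cd X i (cmp X i (Suc i) a b) = cd X i b"
    and dm_cmp: "\<lbrakk>i < j; composable X i (Suc j) a b\<rbrakk> \<Longrightarrow>
      dm X j (cmp X i (Suc j) a b) = cmp X i j (dm X j a) (dm X j b)"
    and cd_cmp: "\<lbrakk>i < j; composable X i (Suc j) a b\<rbrakk> \<Longrightarrow>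
      cd X j (cmp X i (Suc j) a b) = cmp X i j (cd X j a) (cd X j b)"

locale omega_graph_morphism = dom: omega_graph X + cod: omega_graph Y
  for X :: "('a, 'm) omega_graph_scheme" and Y :: "('b, 'n) omega_graph_scheme" +
  fixes F :: "nat \<Rightarrow> 'a \<Rightarrow> 'b"
  assumes map_cells: "x \<in> cells X i \<Longrightarrow> F i x \<in> cells Y i"
    and map_dm: "x \<in> cells X (Suc i) \<Longrightarrow> F i (dm X i x) = dm Y i (F (Suc i) x)"
    and map_cd: "x \<in> cells X (Suc i) \<Longrightarrow> F i (cd X i x) = cd Y i (F (Suc i) x)"
    and map_idc: "x \<in> cells X i \<Longrightarrow> F (Suc i) (idc X i x) = idc Y i (F i x)"

locale omega_magma_morphism = dom: omega_magma X + cod: omega_magma Y + omega_graph_morphism X Y F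
  for X :: "('a, 'm) omega_magma_scheme" and Y :: "('b, 'n) omega_magma_scheme"
    and F :: "nat \<Rightarrow> 'a \<Rightarrow> 'b" +
  assumes map_cmp: "composable X i j a b \<Longrightarrow> F j (cmp X i j a b) = cmp Y i j (F j a) (F j b)"

locale strict_omega_category = omega_magma X
  for X :: "('a, 'm) omega_magma_scheme" +
  assumes cmp_assoc: "\<lbrakk>composable X i j a b; composable X i j b c\<rbrakk> \<Longrightarrow>
      cmp X i j (cmp X i j a b) c = cmp X i j a (cmp X i j b c)"
    and interchange: "\<lbrakk>i < j; j < k; composable X j k a b; composable X j k c d;
        composable X i k a c; composable X i k b d\<rbrakk> \<Longrightarrow>
      cmp X i k (cmp X j k a b) (cmp X j k c d) = cmp X j k (cmp X i k a c) (cmp X i k b d)"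
    and cmp_id_left: "\<lbrakk>i < j; a \<in> cells X j\<rbrakk> \<Longrightarrow> cmp X i j (id_it X i j (dom_it X i j a)) a = a"
    and cmp_id_right: "\<lbrakk>i < j; a \<in> cells X j\<rbrakk> \<Longrightarrow> cmp X i j a (id_it X i j (cod_it X i j a)) = a"
    and cmp_idc: "composable X i j a b \<Longrightarrow>
      cmp X i (Suc j) (idc X j a) (idc X j b) = idc X j (cmp X i j a b)"


section \<open>Bridge relations, Penon morphisms, weak omega categories\<close>

definition parallel :: "('a, 'm) globular_set_scheme \<Rightarrow> nat \<Rightarrow> 'a \<Rightarrow> 'a \<Rightarrow> bool" where
  "parallel X i a b \<longleftrightarrow> a \<in> cells X i \<and> b \<in> cells X i \<and>
     (\<forall>j. i = Suc j \<longrightarrow> dm X j a = dm X j b \<and> cd X j a = cd X j b)"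

locale bridge_relation = omega_graph X
  for X :: "('a, 'm) omega_graph_scheme" +
  fixes R :: "nat \<Rightarrow> ('a \<times> 'a \<times> 'a) set"
  assumes bridge_cells: "R i \<subseteq> cells X i \<times> cells X i \<times> cells X (Suc i)"
    and bridge_parallel: "(a, b, c) \<in> R i \<Longrightarrow> parallel X i a b"
    and bridge_dm: "(a, b, c) \<in> R i \<Longrightarrow> dm X i c = a"
    and bridge_cd: "(a, b, c) \<in> R i \<Longrightarrow> cd X i c = b"
    and bridge_refl: "a \<in> cells X i \<Longrightarrow> (a, a, idc X i a) \<in> R i"
    and bridge_unique: "\<lbrakk>(a, b, c) \<in> R i; (a, b, d) \<in> R i\<rbrakk> \<Longrightarrow> c = d"

definition diagonal_bridge :: "('a, 'm) omega_graph_scheme \<Rightarrow> nat \<Rightarrow> ('a \<times> 'a \<times> 'a) set" where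
  "diagonal_bridge X i = {(a, a, idc X i a) | a. a \<in> cells X i}"

locale bridge_morphism =
  dom: bridge_relation X RX + cod: bridge_relation Y RY + omega_magma_morphism X Y F
  for X :: "('a, 'm) omega_magma_scheme" and RX :: "nat \<Rightarrow> ('a \<times> 'a \<times> 'a) set"
    and Y :: "('b, 'n) omega_magma_scheme" and RY :: "nat \<Rightarrow> ('b \<times> 'b \<times> 'b) set"
    and F :: "nat \<Rightarrow> 'a \<Rightarrow> 'b" +
  assumes map_bridge: "(a, b, c) \<in> RX i \<Longrightarrow> (F i a, F i b, F (Suc i) c) \<in> RY i"

locale categorical_penon_morphism = bridge_morphism X RX Y RY F + strict_omega_category Y
  for X :: "('a, 'm) omega_magma_scheme" and RX :: "nat \<Rightarrow> ('a \<times> 'a \<times> 'a) set"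
    and Y :: "('b, 'n) omega_magma_scheme" and RY :: "nat \<Rightarrow> ('b \<times> 'b \<times> 'b) set"
    and F :: "nat \<Rightarrow> 'a \<Rightarrow> 'b" +
  assumes diagonal: "RY = diagonal_bridge Y"
    and bridge_eq: "(a, b, c) \<in> RX i \<Longrightarrow> F i a = F i b"
    and bridge_id: "(a, b, c) \<in> RX i \<Longrightarrow> F (Suc i) c = idc Y i (F i a)"
    and bridge_ex: "\<lbrakk>parallel X i a b; F i a = F i b\<rbrakk> \<Longrightarrow> \<exists>c. (a, b, c) \<in> RX i"

record ('a, 'b, 'c) weak_omega_data =
  und :: "'a omega_magma"
  mid :: "'b omega_magma"
  str :: "'c omega_magma"
  lam :: "nat \<Rightarrow> 'b \<Rightarrow> 'a"
  rho :: "nat \<Rightarrow> 'a \<Rightarrow> 'b"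
  bridge :: "nat \<Rightarrow> ('b \<times> 'b \<times> 'b) set"
  kap :: "nat \<Rightarrow> 'b \<Rightarrow> 'c"

definition weak_omega_category :: "('a, 'b, 'c) weak_omega_data \<Rightarrow> bool" where
  "weak_omega_category W \<longleftrightarrow>
     omega_magma (und W) \<and> omega_magma (mid W) \<and>
     omega_magma_morphism (mid W) (und W) (lam W) \<and>
     omega_graph_morphism (und W) (mid W) (rho W) \<and>
     (\<forall>i. \<forall>x\<in>cells (und W) i. lam W i (rho W i x) = x) \<and>
     bridge_relation (mid W) (bridge W) \<and>
     strict_omega_category (str W) \<and>
     categorical_penon_morphism (mid W) (bridge W) (str W) (diagonal_bridge (str W)) (kap W)"

definition weak_2_category :: "('a, 'b, 'c) weak_omega_data \<Rightarrow> bool" where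
  "weak_2_category W \<longleftrightarrow> weak_omega_category W \<and> skeletal 2 (und W)"


section \<open>Bicategories\<close>

text \<open>
  A 2-skeletal omega magma is determined by its cells and operations in dimensions at most 2:
  above dimension 2 every composite is an identity cell, hence determined by its domain. So the axioms only concern
  dimensions at most 2.
\<close>

record 'a bicat = "'a omega_magma" +
  associator :: "'a \<Rightarrow> 'a \<Rightarrow> 'a \<Rightarrow> 'a"
  lunitor :: "'a \<Rightarrow> 'a"
  runitor :: "'a \<Rightarrow> 'a"

definition inverse_2cells :: "('a, 'm) omega_magma_scheme \<Rightarrow> 'a \<Rightarrow> 'a \<Rightarrow> bool" where
  "inverse_2cells X c d \<longleftrightarrow> c \<in> cells X 2 \<and> d \<in> cells X 2 \<and>
     dm X 1 d = cd X 1 c \<and> cd X 1 d = dm X 1 c \<and>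
     cmp X 1 2 c d = idc X 1 (dm X 1 c) \<and> cmp X 1 2 d c = idc X 1 (cd X 1 c)"

locale bicategory = omega_magma Y
  for Y :: "('a, 'm) bicat_scheme" +
  assumes two_skeletal: "skeletal 2 Y"
    \<comment> \<open>the categories of 1-cells and 2-cells between two 0-cells\<close>
    and v_assoc: "\<lbrakk>composable Y 1 2 a b; composable Y 1 2 b c\<rbrakk> \<Longrightarrow>
      cmp Y 1 2 (cmp Y 1 2 a b) c = cmp Y 1 2 a (cmp Y 1 2 b c)"
    and v_id_left: "a \<in> cells Y 2 \<Longrightarrow> cmp Y 1 2 (idc Y 1 (dm Y 1 a)) a = a"
    and v_id_right: "a \<in> cells Y 2 \<Longrightarrow> cmp Y 1 2 a (idc Y 1 (cd Y 1 a)) = a"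
    \<comment> \<open>functoriality of horizontal composition\<close>
    and h_interchange: "\<lbrakk>composable Y 1 2 a b; composable Y 1 2 c d;
        composable Y 0 2 a c; composable Y 0 2 b d\<rbrakk> \<Longrightarrow>
      cmp Y 0 2 (cmp Y 1 2 a b) (cmp Y 1 2 c d) = cmp Y 1 2 (cmp Y 0 2 a c) (cmp Y 0 2 b d)"
    and h_id: "composable Y 0 1 f g \<Longrightarrow>
      cmp Y 0 2 (idc Y 1 f) (idc Y 1 g) = idc Y 1 (cmp Y 0 1 f g)"
    \<comment> \<open>associators\<close>
    and associator_cell: "\<lbrakk>composable Y 0 1 f g; composable Y 0 1 g h\<rbrakk> \<Longrightarrow>
      associator Y f g h \<in> cells Y 2"
    and associator_dm: "\<lbrakk>composable Y 0 1 f g; composable Y 0 1 g h\<rbrakk> \<Longrightarrow>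
      dm Y 1 (associator Y f g h) = cmp Y 0 1 (cmp Y 0 1 f g) h"
    and associator_cd: "\<lbrakk>composable Y 0 1 f g; composable Y 0 1 g h\<rbrakk> \<Longrightarrow>
      cd Y 1 (associator Y f g h) = cmp Y 0 1 f (cmp Y 0 1 g h)"
    and associator_iso: "\<lbrakk>composable Y 0 1 f g; composable Y 0 1 g h\<rbrakk> \<Longrightarrow>
      \<exists>d. inverse_2cells Y (associator Y f g h) d"
    and associator_natural: "\<lbrakk>composable Y 0 2 a b; composable Y 0 2 b c\<rbrakk> \<Longrightarrow>
      cmp Y 1 2 (cmp Y 0 2 (cmp Y 0 2 a b) c) (associator Y (cd Y 1 a) (cd Y 1 b) (cd Y 1 c)) =
      cmp Y 1 2 (associator Y (dm Y 1 a) (dm Y 1 b) (dm Y 1 c)) (cmp Y 0 2 a (cmp Y 0 2 b c))"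
    \<comment> \<open>left and right unit isomorphisms\<close>
    and lunitor_cell: "f \<in> cells Y 1 \<Longrightarrow> lunitor Y f \<in> cells Y 2"
    and lunitor_dm: "f \<in> cells Y 1 \<Longrightarrow> dm Y 1 (lunitor Y f) = cmp Y 0 1 (idc Y 0 (dm Y 0 f)) f"
    and lunitor_cd: "f \<in> cells Y 1 \<Longrightarrow> cd Y 1 (lunitor Y f) = f"
    and lunitor_iso: "f \<in> cells Y 1 \<Longrightarrow> \<exists>d. inverse_2cells Y (lunitor Y f) d"
    and lunitor_natural: "a \<in> cells Y 2 \<Longrightarrow>
      cmp Y 1 2 (cmp Y 0 2 (id_it Y 0 2 (dom_it Y 0 2 a)) a) (lunitor Y (cd Y 1 a)) =
      cmp Y 1 2 (lunitor Y (dm Y 1 a)) a"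
    and runitor_cell: "f \<in> cells Y 1 \<Longrightarrow> runitor Y f \<in> cells Y 2"
    and runitor_dm: "f \<in> cells Y 1 \<Longrightarrow> dm Y 1 (runitor Y f) = cmp Y 0 1 f (idc Y 0 (cd Y 0 f))"
    and runitor_cd: "f \<in> cells Y 1 \<Longrightarrow> cd Y 1 (runitor Y f) = f"
    and runitor_iso: "f \<in> cells Y 1 \<Longrightarrow> \<exists>d. inverse_2cells Y (runitor Y f) d"
    and runitor_natural: "a \<in> cells Y 2 \<Longrightarrow>
      cmp Y 1 2 (cmp Y 0 2 a (id_it Y 0 2 (cod_it Y 0 2 a))) (runitor Y (cd Y 1 a)) =
      cmp Y 1 2 (runitor Y (dm Y 1 a)) a"
    \<comment> \<open>coherence axioms\<close>
    and pentagon: "\<lbrakk>composable Y 0 1 f g; composable Y 0 1 g h; composable Y 0 1 h k\<rbrakk> \<Longrightarrow>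
      cmp Y 1 2 (associator Y (cmp Y 0 1 f g) h k) (associator Y f g (cmp Y 0 1 h k)) =
      cmp Y 1 2
        (cmp Y 1 2 (cmp Y 0 2 (associator Y f g h) (idc Y 1 k)) (associator Y f (cmp Y 0 1 g h) k))
        (cmp Y 0 2 (idc Y 1 f) (associator Y g h k))"
    and triangle: "composable Y 0 1 f g \<Longrightarrow>
      cmp Y 1 2 (associator Y f (idc Y 0 (cd Y 0 f)) g) (cmp Y 0 2 (idc Y 1 f) (lunitor Y g)) =
      cmp Y 0 2 (runitor Y f) (idc Y 1 g)"

locale strong_homomorphism = dom: bicategory X + cod: bicategory Y + omega_magma_morphism X Y F
  for X :: "('a, 'm) bicat_scheme" and Y :: "('b, 'n) bicat_scheme" and F :: "nat \<Rightarrow> 'a \<Rightarrow> 'b" +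
  assumes map_associator: "\<lbrakk>composable X 0 1 f g; composable X 0 1 g h\<rbrakk> \<Longrightarrow>
      F 2 (associator X f g h) = associator Y (F 1 f) (F 1 g) (F 1 h)"
    and map_lunitor: "f \<in> cells X 1 \<Longrightarrow> F 2 (lunitor X f) = lunitor Y (F 1 f)"
    and map_runitor: "f \<in> cells X 1 \<Longrightarrow> F 2 (runitor X f) = runitor Y (F 1 f)"

definition graph_of_bicat :: "'a bicat \<Rightarrow> 'a omega_graph" where
  "graph_of_bicat Y = omega_graph.truncate Y"

definition magma_of_bicat :: "'a bicat \<Rightarrow> 'a omega_magma" where
  "magma_of_bicat Y = omega_magma.truncate Y"

definition graph_of_magma :: "'a omega_magma \<Rightarrow> 'a omega_graph" where
  "graph_of_magma X = omega_graph.truncate X"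

text \<open>A strict 2-category, regarded as a bicategory whose coherence data are identities.\<close>

definition bicat_of_strict :: "'a omega_magma \<Rightarrow> 'a bicat" where
  "bicat_of_strict C = \<lparr>cells = cells C, dm = dm C, cd = cd C, idc = idc C, cmp = cmp C,
     associator = (\<lambda>f g h. idc C 1 (cmp C 0 1 (cmp C 0 1 f g) h)),
     lunitor = (\<lambda>f. idc C 1 f), runitor = (\<lambda>f. idc C 1 f)\<rparr>"


section \<open>Free bicategories and free strict omega categories\<close>

text \<open>
  The value of a left adjoint at \<open>G\<close>, together with the unit, is a universal arrow from \<open>G\<close> to the
  forgetful functor. The quantified object \<open>Z\<close> of the universal property ranges over the structures
  with cells in \<open>'u\<close>, so \<open>'u\<close> plays the role of the universe of sets. If \<open>'u\<close> is infinite, free objects on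
  graphs with cells in \<open>'u\<close> have at most as many cells as \<open>'u\<close>, so that they are the same ones as those
  for any larger universe. Since maps are total functions, uniqueness is equality on cells.
\<close>

definition extends ::
  "('g, 'm) globular_set_scheme \<Rightarrow> (nat \<Rightarrow> 'g \<Rightarrow> 'a) \<Rightarrow> (nat \<Rightarrow> 'g \<Rightarrow> 'b) \<Rightarrow> (nat \<Rightarrow> 'a \<Rightarrow> 'b) \<Rightarrow> bool"
  where "extends G \<eta> F H \<longleftrightarrow> (\<forall>i. \<forall>x\<in>cells G i. H i (\<eta> i x) = F i x)"

definition free_bicategory ::
  "'g omega_graph \<Rightarrow> 'u bicat \<Rightarrow> (nat \<Rightarrow> 'g \<Rightarrow> 'u) \<Rightarrow> bool" where
  "free_bicategory G X \<eta> \<longleftrightarrow>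
     bicategory X \<and> omega_graph_morphism G (graph_of_bicat X) \<eta> \<and>
     (\<forall>(Z :: 'u bicat) F. bicategory Z \<and> omega_graph_morphism G (graph_of_bicat Z) F \<longrightarrow>
        (\<exists>H. strong_homomorphism X Z H \<and> extends G \<eta> F H \<and>
          (\<forall>H'. strong_homomorphism X Z H' \<and> extends G \<eta> F H' \<longrightarrow>
             (\<forall>i. \<forall>x\<in>cells X i. H' i x = H i x))))"

definition free_strict_omega_category ::
  "'g omega_graph \<Rightarrow> 'u omega_magma \<Rightarrow> (nat \<Rightarrow> 'g \<Rightarrow> 'u) \<Rightarrow> bool" where
  "free_strict_omega_category G X \<eta> \<longleftrightarrow>
     strict_omega_category X \<and> omega_graph_morphism G (graph_of_magma X) \<eta> \<and>
     (\<forall>(Z :: 'u omega_magma) F.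
        strict_omega_category Z \<and> omega_graph_morphism G (graph_of_magma Z) F \<longrightarrow>
        (\<exists>H. omega_magma_morphism X Z H \<and> extends G \<eta> F H \<and>
          (\<forall>H'. omega_magma_morphism X Z H' \<and> extends G \<eta> F H' \<longrightarrow>
             (\<forall>i. \<forall>x\<in>cells X i. H' i x = H i x))))"

text \<open>
  The adjoint transpose of \<open>F : G \<rightarrow> U Z\<close>; by the universal property it exists and its values on the cells
  of the free bicategory \<open>X\<close> do not depend on the choice.
\<close>

definition transpose ::
  "'g omega_graph \<Rightarrow> 'u bicat \<Rightarrow> (nat \<Rightarrow> 'g \<Rightarrow> 'u) \<Rightarrow> 'z bicat \<Rightarrow> (nat \<Rightarrow> 'g \<Rightarrow> 'z) \<Rightarrow> nat \<Rightarrow> 'u \<Rightarrow> 'z"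
  where "transpose G X \<eta> Z F = (SOME H. strong_homomorphism X Z H \<and> extends G \<eta> F H)"


section \<open>The diagram of a bicategory\<close>

text \<open>
  \<open>FB\<close> with unit \<open>\<rho>\<close> is the free bicategory and \<open>FS\<close> with unit \<open>\<eta>\<close> the free strict omega category on the
  graph of \<open>Y\<close>. The counit is the transpose of the identity of the graph.
\<close>

definition bicat_diagram ::
  "'u bicat \<Rightarrow> 'u bicat \<Rightarrow> (nat \<Rightarrow> 'u \<Rightarrow> 'u) \<Rightarrow> 'u omega_magma \<Rightarrow> (nat \<Rightarrow> 'u \<Rightarrow> 'u) \<Rightarrow>
   (nat \<Rightarrow> ('u \<times> 'u \<times> 'u) set) \<Rightarrow> ('u, 'u, 'u) weak_omega_data" where
  "bicat_diagram Y FB \<rho> FS \<eta> R =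
     \<lparr>und = magma_of_bicat Y, mid = magma_of_bicat FB, str = FS,
      lam = transpose (graph_of_bicat Y) FB \<rho> Y (\<lambda>i x. x), rho = \<rho>, bridge = R,
      kap = transpose (graph_of_bicat Y) FB \<rho> (bicat_of_strict FS) \<eta>\<rparr>"

definition bridge_image_iso ::
  "'a bicat \<Rightarrow> ('a, 'b, 'c) weak_omega_data \<Rightarrow> 'b \<Rightarrow> 'b \<Rightarrow> 'a \<Rightarrow> bool" where
  "bridge_image_iso Y W p q e \<longleftrightarrow>
     (\<exists>c. (p, q, c) \<in> bridge W 1 \<and> lam W 2 c = e) \<and>
     (\<exists>c'. (q, p, c') \<in> bridge W 1 \<and> inverse_2cells Y e (lam W 2 c'))"

definition coherence_from_bridges :: "'a bicat \<Rightarrow> ('a, 'b, 'c) weak_omega_data \<Rightarrow> bool" where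
  "coherence_from_bridges Y W \<longleftrightarrow>
     (\<forall>f g h. composable Y 0 1 f g \<and> composable Y 0 1 g h \<longrightarrow>
        bridge_image_iso Y W
          (cmp (mid W) 0 1 (cmp (mid W) 0 1 (rho W 1 f) (rho W 1 g)) (rho W 1 h))
          (cmp (mid W) 0 1 (rho W 1 f) (cmp (mid W) 0 1 (rho W 1 g) (rho W 1 h)))
          (associator Y f g h)) \<and>
     (\<forall>f\<in>cells Y 1.
        bridge_image_iso Y W
          (cmp (mid W) 0 1 (idc (mid W) 0 (dm (mid W) 0 (rho W 1 f))) (rho W 1 f)) (rho W 1 f)
          (lunitor Y f)) \<and>
     (\<forall>f\<in>cells Y 1.
        bridge_image_iso Y W
          (cmp (mid W) 0 1 (rho W 1 f) (idc (mid W) 0 (cd (mid W) 0 (rho W 1 f)))) (rho W 1 f)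
          (runitor Y f))"

end

theory Submission
  imports Defs
begin

text \<open>
  The bridge-cells between 1-cells \<open>p\<close>, \<open>q\<close> of the free bicategory are the 2-cells \<open>p \<rightarrow> q\<close> that \<open>\<kappa>\<close> maps
  to an identity; in all other dimensions bridge-cells are identities. What has to be proved is coherence:
  \<open>\<kappa>\<close> is injective on 0-cells, faithful on 2-cells, and 1-cells with the same image are connected by
  such a 2-cell.

  The strictification of a bicategory \<open>B\<close> has the paths of 1-cells of \<open>B\<close> as 1-cells and the 2-cells of \<open>B\<close>
  between their composites as 2-cells; it is strict by the pentagon and by Kelly's coherence conditions
  for the units. To compare \<open>B\<close> with it without analysing the 1-cells of a free bicategory, one
  introduces the bicategory of 1-cells \<open>p\<close> marked by a path \<open>u\<close> and a coherent isomorphism from \<open>p\<close> to the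
  composite of \<open>u\<close>. The generators of a free \<open>B\<close> lift to it, hence all of \<open>B\<close> does, and conjugation
  with the isomorphisms is a strict map from there to the strictification. The composite from \<open>B\<close> to
  the strictification is faithful, and by freeness of the strict omega category it factors through \<open>\<kappa>\<close>.
\<close>

section \<open>Encodings\<close>

text \<open>The universal properties range over structures with cells in \<open>'u\<close>. The two
  targets, made of words and tuples, therefore have to be coded inside \<open>'u\<close>; injective
  codes of pairs and lists exist because \<open>'u\<close> is infinite. Universal arrows compare
  strict maps only, whereas evaluation of words preserves composition just up to isomorphism. The
  marks absorb these isomorphisms: both the map into the marked bicategory and the map from there to
  words are strict. The marks are confined to a class \<open>J\<close>, later the invertible 2-cells
  that \<kappa> collapses. Two 1-cells with the same image get the same word, and one mark followed
  by the inverse of the other is then the required 2-cell. So a single construction yields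
  connectedness as well as faithfulness.\<close>

lemma infinite_inj_pair:
  assumes "infinite (UNIV :: 'u set)"
  obtains p :: "'u \<times> 'u \<Rightarrow> 'u" where "inj p"
proof -
  have "\<exists>p. bij_betw p ((UNIV :: 'u set) \<times> (UNIV :: 'u set)) (UNIV :: 'u set)"
    by (rule iffD2[OF card_of_ordIso card_of_Times_same_infinite[OF assms]])
  then show ?thesis
    using that by (auto simp: bij_betw_def UNIV_Times_UNIV)
qed

lemma infinite_inj_list:
  assumes "infinite (UNIV :: 'u set)"
  obtains e :: "'u list \<Rightarrow> 'u" where "inj e"
proof -
  obtain p :: "'u \<times> 'u \<Rightarrow> 'u" where p: "inj p"
    using infinite_inj_pair[OF assms] .
  obtain n :: "nat \<Rightarrow> 'u" where n: "inj n"
    using infinite_countable_subset[OF assms] by blast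
  define f where "f = (\<lambda>xs. foldr (\<lambda>x y. p (x, y)) xs (n 0))"
  have "xs = ys" if "length xs = length ys" "f xs = f ys" for xs ys
    using that by (induction xs ys rule: list_induct2) (auto simp: f_def dest: injD[OF p])
  \<comment> \<open>The fold alone may identify lists of different lengths, since \<open>n 0\<close>
    may itself be a coded pair; so the length is coded as well.\<close>
  then have "inj (\<lambda>xs. p (n (length xs), f xs))"
    by (intro injI) (metis injD[OF n] injD[OF p] prod.inject)
  then show ?thesis
    using that by blast
qed


section \<open>Iterated maps and composability\<close>

lemma dom_it_same [simp]: "dom_it X i i x = x"
  by (cases i) auto

lemma cod_it_same [simp]: "cod_it X i i x = x"
  by (cases i) auto

lemma id_it_same [simp]: "id_it X i i x = x"
  by (cases i) auto

lemma dom_it_cong: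
  assumes "dm X = dm X'" shows "dom_it X i j x = dom_it X' i j x"
  by (induction j arbitrary: x) (simp_all add: assms)

lemma cod_it_cong:
  assumes "cd X = cd X'" shows "cod_it X i j x = cod_it X' i j x"
  by (induction j arbitrary: x) (simp_all add: assms)

lemma id_it_cong:
  assumes "idc X = idc X'" shows "id_it X i j x = id_it X' i j x"
  by (induction j) (simp_all add: assms)

lemma composable_cong:
  assumes "cells X = cells X'" "dm X = dm X'" "cd X = cd X'"
  shows "composable X i j a b \<longleftrightarrow> composable X' i j a b"
  unfolding composable_def dom_it_cong[OF assms(2)] cod_it_cong[OF assms(3)] assms(1) ..

lemma composable_Suc: "composable X i (Suc i) a b \<longleftrightarrow>
    a \<in> cells X (Suc i) \<and> b \<in> cells X (Suc i) \<and> cd X i a = dm X i b"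
  by (auto simp: composable_def)

lemma composable_low:
  "composable X 0 1 a b \<longleftrightarrow> a \<in> cells X 1 \<and> b \<in> cells X 1 \<and> cd X 0 a = dm X 0 b"
  "composable X 1 2 a b \<longleftrightarrow> a \<in> cells X 2 \<and> b \<in> cells X 2 \<and> cd X 1 a = dm X 1 b"
  "composable X 0 2 a b \<longleftrightarrow>
    a \<in> cells X 2 \<and> b \<in> cells X 2 \<and> cd X 0 (cd X 1 a) = dm X 0 (dm X 1 b)"
  by (auto simp: composable_def numeral_2_eq_2)

text \<open>A bicategory, its magma and its graph are records of different types with common fields.
  Facts are carried between them along equality of these fields; the analogues for graphs and
  morphisms below serve the same purpose.\<close>

lemma omega_magma_cong:
  assumes "omega_magma X" "cells X = cells X'" "dm X = dm X'" "cd X = cd X'" "idc X = idc X'"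
    "cmp X = cmp X'"
  shows "omega_magma X'"
proof -
  interpret omega_magma X by fact
  note c = composable_cong[OF assms(2-4), symmetric] assms(2-6)[symmetric]
  show ?thesis
    by unfold_locales (simp_all add: c dm_cells cd_cells dm_dm cd_dm idc_cells dm_idc cd_idc
        cmp_cells dm_cmp_top cd_cmp_top dm_cmp cd_cmp)
qed

context globular_set
begin

lemma cod_it_dm_cd:
  assumes "x \<in> cells X (Suc n)" "i < n"
  shows "cod_it X i n (dm X n x) = cod_it X i n (cd X n x)"
  using assms by (cases n) (auto simp: cd_dm)

text \<open>Composability constrains the codomain side of \<open>a\<close>. Below dimension
  \<open>n\<close> this agrees with the codomain of its domain, by \<open>cod_it_dm_cd\<close>, so
  inductions on the dimension can follow domains only.\<close>

lemma composable_dm: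
  assumes "composable X i (Suc n) a b" "i < n"
  shows "composable X i n (dm X n a) (dm X n b)"
  using assms cod_it_dm_cd[of a n i] unfolding composable_def by (auto simp: dm_cells)

end

context omega_graph
begin

lemma skeletal_idc_dm:
  assumes "skeletal n X" "n \<le> m" "x \<in> cells X (Suc m)"
  shows "idc X m (dm X m x) = x"
  using assms unfolding skeletal_def by (metis dm_idc)

lemma skeletal_cd_dm:
  assumes "skeletal n X" "n \<le> m" "x \<in> cells X (Suc m)"
  shows "cd X m x = dm X m x"
  using assms unfolding skeletal_def by (metis dm_idc cd_idc)

end

context omega_graph_morphism
begin

lemma map_dom_it: "x \<in> cells X j \<Longrightarrow> i \<le> j \<Longrightarrow> F i (dom_it X i j x) = dom_it Y i j (F j x)"
  by (induction j arbitrary: x) (auto simp: le_Suc_eq map_dm dom.dm_cells)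

lemma map_cod_it: "x \<in> cells X j \<Longrightarrow> i \<le> j \<Longrightarrow> F i (cod_it X i j x) = cod_it Y i j (F j x)"
  by (induction j arbitrary: x) (auto simp: le_Suc_eq map_cd dom.cd_cells)

lemma map_composable: "composable X i j a b \<Longrightarrow> composable Y i j (F j a) (F j b)"
  unfolding composable_def by (metis map_cells map_dom_it map_cod_it less_imp_le)

end

lemma omega_graph_cong:
  assumes "omega_graph X" "cells X = cells X'" "dm X = dm X'" "cd X = cd X'" "idc X = idc X'"
  shows "omega_graph X'"
proof -
  interpret omega_graph X by fact
  show ?thesis
    by unfold_locales (simp_all add: assms(2-5)[symmetric] dm_cells cd_cells dm_dm cd_dm idc_cells
        dm_idc cd_idc)
qed

lemma omega_graph_morphism_cong:
  assumes "omega_graph_morphism X Y F"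
    and "cells X = cells X'" "dm X = dm X'" "cd X = cd X'" "idc X = idc X'"
    and "cells Y = cells Y'" "dm Y = dm Y'" "cd Y = cd Y'" "idc Y = idc Y'"
  shows "omega_graph_morphism X' Y' F"
proof -
  interpret omega_graph_morphism X Y F by fact
  show ?thesis
    unfolding omega_graph_morphism_def omega_graph_morphism_axioms_def
    using omega_graph_cong[OF dom.omega_graph_axioms assms(2-5)]
      omega_graph_cong[OF cod.omega_graph_axioms assms(6-9)]
    by (simp add: assms(2-9)[symmetric] map_cells map_dm map_cd map_idc)
qed

lemma omega_magma_morphism_cong:
  assumes "omega_magma_morphism X Y F"
    and X: "cells X = cells X'" "dm X = dm X'" "cd X = cd X'" "idc X = idc X'" "cmp X = cmp X'"
    and Y: "cells Y = cells Y'" "dm Y = dm Y'" "cd Y = cd Y'" "idc Y = idc Y'" "cmp Y = cmp Y'"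
  shows "omega_magma_morphism X' Y' F"
proof -
  interpret omega_magma_morphism X Y F by fact
  show ?thesis
    unfolding omega_magma_morphism_def omega_magma_morphism_axioms_def
    using omega_magma_cong[OF dom.omega_magma_axioms X] omega_magma_cong[OF cod.omega_magma_axioms Y]
      omega_graph_morphism_cong[OF omega_graph_morphism_axioms X(1-4) Y(1-4)]
    by (simp add: composable_cong[OF X(1-3), symmetric] X(5)[symmetric] Y(5)[symmetric] map_cmp)
qed

section \<open>Composites of morphisms\<close>

lemma omega_graph_morphism_comp:
  assumes "omega_graph_morphism X Y F" "omega_graph_morphism Y Z G"
  shows "omega_graph_morphism X Z (\<lambda>i x. G i (F i x))"
proof -
  interpret F: omega_graph_morphism X Y F by fact
  interpret G: omega_graph_morphism Y Z G by fact
  show ?thesis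
    by unfold_locales (simp_all add: F.map_cells F.map_dm F.map_cd F.map_idc G.map_cells G.map_dm
        G.map_cd G.map_idc)
qed

lemma omega_magma_morphism_comp:
  assumes "omega_magma_morphism X Y F" "omega_magma_morphism Y Z G"
  shows "omega_magma_morphism X Z (\<lambda>i x. G i (F i x))"
proof -
  interpret F: omega_magma_morphism X Y F by fact
  interpret G: omega_magma_morphism Y Z G by fact
  interpret omega_graph_morphism X Z "\<lambda>i x. G i (F i x)"
    using omega_graph_morphism_comp F.omega_graph_morphism_axioms G.omega_graph_morphism_axioms .
  show ?thesis
    by unfold_locales (simp_all add: F.map_cmp G.map_cmp F.map_composable)
qed

lemma strong_homomorphism_comp:
  assumes "strong_homomorphism X Y F" "strong_homomorphism Y Z G"
  shows "strong_homomorphism X Z (\<lambda>i x. G i (F i x))"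
proof -
  interpret F: strong_homomorphism X Y F by fact
  interpret G: strong_homomorphism Y Z G by fact
  interpret omega_magma_morphism X Z "\<lambda>i x. G i (F i x)"
    using omega_magma_morphism_comp F.omega_magma_morphism_axioms G.omega_magma_morphism_axioms .
  show ?thesis
    by unfold_locales (simp_all add: F.map_associator F.map_lunitor F.map_runitor
        G.map_associator G.map_lunitor G.map_runitor F.map_cells F.map_composable)
qed

lemma strong_homomorphism_id:
  assumes "bicategory X" shows "strong_homomorphism X X (\<lambda>i x. x)"
proof -
  interpret bicategory X by fact
  show ?thesis by unfold_locales simp_all
qed

text \<open>
  A cell above dimension 2 of a 2-skeletal structure is the identity of its domain, so a map that is
  given in dimensions up to 2 determines a map in all dimensions.
\<close>

primrec extend2 ::
  "('a, 'm) globular_set_scheme \<Rightarrow> ('b, 'n) omega_graph_scheme \<Rightarrow> (nat \<Rightarrow> 'a \<Rightarrow> 'b) \<Rightarrow> nat \<Rightarrow> 'a \<Rightarrow> 'b"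
  where
    "extend2 X Y F 0 x = F 0 x"
  | "extend2 X Y F (Suc n) x =
      (if n < 2 then F (Suc n) x else idc Y n (extend2 X Y F n (dm X n x)))"

lemma extend2_low: "i \<le> 2 \<Longrightarrow> extend2 X Y F i = F i"
  using less_Suc_eq_le by (cases i) auto

lemma extend2_low' [simp]:
  "extend2 X Y F 0 = F 0" "extend2 X Y F (Suc 0) = F 1" "extend2 X Y F 2 = F 2"
  by (rule ext, simp add: numeral_2_eq_2)+

lemma omega_graph_morphism_extend2:
  assumes "omega_graph X" "omega_graph Y" "skeletal 2 X"
    and cells: "\<And>i x. i \<le> 2 \<Longrightarrow> x \<in> cells X i \<Longrightarrow> F i x \<in> cells Y i"
    and dm: "\<And>i x. i < 2 \<Longrightarrow> x \<in> cells X (Suc i) \<Longrightarrow> F i (dm X i x) = dm Y i (F (Suc i) x)"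
    and cd: "\<And>i x. i < 2 \<Longrightarrow> x \<in> cells X (Suc i) \<Longrightarrow> F i (cd X i x) = cd Y i (F (Suc i) x)"
    and idc: "\<And>i x. i < 2 \<Longrightarrow> x \<in> cells X i \<Longrightarrow> F (Suc i) (idc X i x) = idc Y i (F i x)"
  shows "omega_graph_morphism X Y (extend2 X Y F)"
proof -
  interpret X: omega_graph X by fact
  interpret Y: omega_graph Y by fact
  have c: "extend2 X Y F i x \<in> cells Y i" if "x \<in> cells X i" for i x
    using that by (induction i arbitrary: x) (auto simp: cells X.dm_cells Y.idc_cells)
  show ?thesis
  proof
    fix x i assume x: "x \<in> cells X (Suc i)"
    show "extend2 X Y F i (dm X i x) = dm Y i (extend2 X Y F (Suc i) x)"
      using x dm[of i x] c[of "dm X i x" i]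
      by (simp add: X.dm_cells Y.dm_idc extend2_low)
    show "extend2 X Y F i (cd X i x) = cd Y i (extend2 X Y F (Suc i) x)"
      using x cd[of i x] c[of "dm X i x" i] X.skeletal_cd_dm[OF \<open>skeletal 2 X\<close>, of i x]
      by (simp add: X.dm_cells Y.cd_idc extend2_low)
  next
    fix x i assume x: "x \<in> cells X i"
    then show "extend2 X Y F (Suc i) (idc X i x) = idc Y i (extend2 X Y F i x)"
      using idc[of i x] by (simp add: X.dm_idc extend2_low)
  qed (simp add: c)
qed

text \<open>Above dimension 2 both sides of the equation for composites are identity cells, the
  right one because \<open>Y\<close> is 2-skeletal. Hence they agree once their domains do, and the
  domain of a composite is the domain of the first factor or the composite of the domains, which is
  the induction hypothesis.\<close>

lemma omega_magma_morphism_extend2: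
  assumes "omega_magma X" "omega_magma Y" "skeletal 2 X" "skeletal 2 Y"
    and cells: "\<And>i x. i \<le> 2 \<Longrightarrow> x \<in> cells X i \<Longrightarrow> F i x \<in> cells Y i"
    and dm: "\<And>i x. i < 2 \<Longrightarrow> x \<in> cells X (Suc i) \<Longrightarrow> F i (dm X i x) = dm Y i (F (Suc i) x)"
    and cd: "\<And>i x. i < 2 \<Longrightarrow> x \<in> cells X (Suc i) \<Longrightarrow> F i (cd X i x) = cd Y i (F (Suc i) x)"
    and idc: "\<And>i x. i < 2 \<Longrightarrow> x \<in> cells X i \<Longrightarrow> F (Suc i) (idc X i x) = idc Y i (F i x)"
    and cmp: "\<And>i j a b. j \<le> 2 \<Longrightarrow> composable X i j a b \<Longrightarrow>
      F j (cmp X i j a b) = cmp Y i j (F j a) (F j b)"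
  shows "omega_magma_morphism X Y (extend2 X Y F)"
proof -
  interpret X: omega_magma X by fact
  interpret Y: omega_magma Y by fact
  interpret F: omega_graph_morphism X Y "extend2 X Y F"
    by (rule omega_graph_morphism_extend2[OF X.omega_graph_axioms Y.omega_graph_axioms assms(3)
          cells dm cd idc])
  show ?thesis
  proof
    fix i j a b assume "composable X i j a b"
    then show "extend2 X Y F j (cmp X i j a b) = cmp Y i j (extend2 X Y F j a) (extend2 X Y F j b)"
    proof (induction j arbitrary: a b)
      case 0
      then show ?case by (simp add: composable_def)
    next
      case (Suc n)
      show ?case
      proof (cases "n < 2")
        case True
        then show ?thesis
          using cmp[OF _ Suc.prems] extend2_low[of "Suc n" X Y F] by simp
      next
        case False
        let ?F = "extend2 X Y F"
        let ?r = "cmp Y i (Suc n) (?F (Suc n) a) (?F (Suc n) b)"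
        have comp: "composable Y i (Suc n) (?F (Suc n) a) (?F (Suc n) b)"
          using F.map_composable Suc.prems .
        have a: "a \<in> cells X (Suc n)" "b \<in> cells X (Suc n)" "i \<le> n"
          using Suc.prems by (auto simp: composable_def)
        have "?F n (dm X n (cmp X i (Suc n) a b)) = dm Y n ?r"
        proof (cases "i = n")
          case True
          then show ?thesis
            using Suc.prems comp F.map_dm[OF a(1)] by (simp add: X.dm_cmp_top Y.dm_cmp_top)
        next
          case False
          with a have "i < n" by simp
          then show ?thesis
            using Suc.prems comp Suc.IH[OF X.composable_dm[OF Suc.prems]] F.map_dm[OF a(1)]
              F.map_dm[OF a(2)] by (simp add: X.dm_cmp Y.dm_cmp)
        qed
        then have "?F (Suc n) (cmp X i (Suc n) a b) = idc Y n (dm Y n ?r)"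
          using False by simp
        also have "\<dots> = ?r"
          using Y.skeletal_idc_dm[OF \<open>skeletal 2 Y\<close>] Y.cmp_cells[OF comp] False by simp
        finally show ?thesis .
      qed
    qed
  qed
qed

lemma less_2_cases: "(i::nat) < 2 \<longleftrightarrow> i = 0 \<or> i = 1"
  by auto

lemma strong_homomorphism_extend2:
  assumes "bicategory X" "bicategory Y"
    and cells: "\<And>x. x \<in> cells X 0 \<Longrightarrow> F 0 x \<in> cells Y 0" "\<And>x. x \<in> cells X 1 \<Longrightarrow> F 1 x \<in> cells Y 1"
      "\<And>x. x \<in> cells X 2 \<Longrightarrow> F 2 x \<in> cells Y 2"
    and dm: "\<And>x. x \<in> cells X 1 \<Longrightarrow> F 0 (dm X 0 x) = dm Y 0 (F 1 x)"
      "\<And>x. x \<in> cells X 2 \<Longrightarrow> F 1 (dm X 1 x) = dm Y 1 (F 2 x)"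
    and cd: "\<And>x. x \<in> cells X 1 \<Longrightarrow> F 0 (cd X 0 x) = cd Y 0 (F 1 x)"
      "\<And>x. x \<in> cells X 2 \<Longrightarrow> F 1 (cd X 1 x) = cd Y 1 (F 2 x)"
    and idc: "\<And>x. x \<in> cells X 0 \<Longrightarrow> F 1 (idc X 0 x) = idc Y 0 (F 0 x)"
      "\<And>x. x \<in> cells X 1 \<Longrightarrow> F 2 (idc X 1 x) = idc Y 1 (F 1 x)"
    and cmp: "\<And>a b. composable X 0 1 a b \<Longrightarrow> F 1 (cmp X 0 1 a b) = cmp Y 0 1 (F 1 a) (F 1 b)"
      "\<And>a b. composable X 0 2 a b \<Longrightarrow> F 2 (cmp X 0 2 a b) = cmp Y 0 2 (F 2 a) (F 2 b)"
      "\<And>a b. composable X 1 2 a b \<Longrightarrow> F 2 (cmp X 1 2 a b) = cmp Y 1 2 (F 2 a) (F 2 b)"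
    and associator: "\<And>f g h. \<lbrakk>composable X 0 1 f g; composable X 0 1 g h\<rbrakk> \<Longrightarrow>
      F 2 (associator X f g h) = associator Y (F 1 f) (F 1 g) (F 1 h)"
    and lunitor: "\<And>f. f \<in> cells X 1 \<Longrightarrow> F 2 (lunitor X f) = lunitor Y (F 1 f)"
    and runitor: "\<And>f. f \<in> cells X 1 \<Longrightarrow> F 2 (runitor X f) = runitor Y (F 1 f)"
  shows "strong_homomorphism X Y (extend2 X Y F)"
proof -
  interpret X: bicategory X by fact
  interpret Y: bicategory Y by fact
  have le2: "i \<le> 2 \<longleftrightarrow> i = 0 \<or> i = 1 \<or> i = 2" for i :: nat by auto
  interpret F: omega_magma_morphism X Y "extend2 X Y F"
  proof (rule omega_magma_morphism_extend2)
    fix i j a b assume "j \<le> 2" "composable X i j a b"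
    moreover have "i < j" using \<open>composable X i j a b\<close> by (simp add: composable_def)
    ultimately consider "i = 0" "j = 1" | "i = 0" "j = 2" | "i = 1" "j = 2"
      unfolding le2 by linarith
    then show "F j (cmp X i j a b) = cmp Y i j (F j a) (F j b)"
      using cmp \<open>composable X i j a b\<close> by cases auto
  qed (use cells dm cd idc X.omega_magma_axioms Y.omega_magma_axioms X.two_skeletal Y.two_skeletal
      in \<open>auto simp: less_2_cases le2 simp flip: numeral_2_eq_2\<close>)
  show ?thesis
    by unfold_locales (simp_all add: associator lunitor runitor)
qed


text \<open>From here on \<open>Suc 0\<close> is rewritten to \<open>1\<close>, so that dimension
  arguments match the literals in the bicategory axioms.\<close>

declare One_nat_def [simp del] One_nat_def [symmetric, simp]

lemma it_low [simp]:
  "dom_it X 0 1 x = dm X 0 x" "dom_it X 1 2 x = dm X 1 x" "dom_it X 0 2 x = dm X 0 (dm X 1 x)"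
  "cod_it X 0 1 x = cd X 0 x" "cod_it X 1 2 x = cd X 1 x" "cod_it X 0 2 x = cd X 0 (cd X 1 x)"
  "id_it Y 0 1 y = idc Y 0 y" "id_it Y 1 2 y = idc Y 1 y" "id_it Y 0 2 y = idc Y 1 (idc Y 0 y)"
  by (simp_all add: numeral_2_eq_2 One_nat_def del: One_nat_def [symmetric])

section \<open>Strict omega categories\<close>

lemma sel_graph_of_bicat [simp]:
  "cells (graph_of_bicat Y) = cells Y" "dm (graph_of_bicat Y) = dm Y"
  "cd (graph_of_bicat Y) = cd Y" "idc (graph_of_bicat Y) = idc Y"
  by (simp_all add: graph_of_bicat_def omega_graph.defs)

lemma sel_graph_of_magma [simp]:
  "cells (graph_of_magma Y) = cells Y" "dm (graph_of_magma Y) = dm Y"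
  "cd (graph_of_magma Y) = cd Y" "idc (graph_of_magma Y) = idc Y"
  by (simp_all add: graph_of_magma_def omega_graph.defs)

lemma sel_magma_of_bicat [simp]:
  "cells (magma_of_bicat Y) = cells Y" "dm (magma_of_bicat Y) = dm Y"
  "cd (magma_of_bicat Y) = cd Y" "idc (magma_of_bicat Y) = idc Y" "cmp (magma_of_bicat Y) = cmp Y"
  by (simp_all add: magma_of_bicat_def omega_magma.defs)

lemma sel_bicat_of_strict [simp]:
  "cells (bicat_of_strict Y) = cells Y" "dm (bicat_of_strict Y) = dm Y"
  "cd (bicat_of_strict Y) = cd Y" "idc (bicat_of_strict Y) = idc Y"
  "cmp (bicat_of_strict Y) = cmp Y"
  "associator (bicat_of_strict Y) = (\<lambda>f g h. idc Y 1 (cmp Y 0 1 (cmp Y 0 1 f g) h))"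
  "lunitor (bicat_of_strict Y) = idc Y 1" "runitor (bicat_of_strict Y) = idc Y 1"
  by (simp_all add: bicat_of_strict_def)

lemma composable_reduct [simp]:
  "composable (graph_of_bicat Y) = composable Y"
  "composable (graph_of_magma M) = composable M"
  "composable (magma_of_bicat Y) = composable Y"
  "composable (bicat_of_strict M) = composable M"
  by (intro ext composable_cong; simp)+

lemma skeletal_reduct [simp]:
  "skeletal n (graph_of_bicat Y) = skeletal n Y"
  "skeletal n (magma_of_bicat Y) = skeletal n Y"
  "skeletal n (bicat_of_strict M) = skeletal n M"
  by (simp_all add: skeletal_def)

lemma omega_magma_magma_of_bicat:
  assumes "bicategory Y" shows "omega_magma (magma_of_bicat Y)"
proof -
  interpret bicategory Y by fact
  show ?thesis by (rule omega_magma_cong[OF omega_magma_axioms]) simp_all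
qed

context strict_omega_category
begin

lemma idc_cmp_01:
  assumes "f \<in> cells X 1" "g \<in> cells X 1" "cd X 0 f = dm X 0 g"
  shows "cmp X 0 2 (idc X 1 f) (idc X 1 g) = idc X 1 (cmp X 0 1 f g)"
  using cmp_idc[of 0 1 f g] assms by (simp add: composable_low)

lemma idc_cmp_12:
  assumes "f \<in> cells X 1"
  shows "cmp X 1 2 (idc X 1 f) (idc X 1 f) = idc X 1 f"
  using cmp_id_left[of 1 2 "idc X 1 f"] idc_cells[OF assms] dm_idc[OF assms]
  by simp

end

text \<open>The strict laws are restated as rewrite rules with explicit boundary conditions. Since
  all coherence data are identities, the two sides of each naturality or coherence axiom then reduce
  to the same cell.\<close>

lemma bicategory_bicat_of_strict:
  fixes X :: "'a omega_magma"
  assumes "strict_omega_category X" "skeletal 2 X"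
  shows "bicategory (bicat_of_strict X)"
proof -
  interpret strict_omega_category X by fact
  let ?B = "bicat_of_strict X"
  interpret B: omega_magma ?B
    by (rule omega_magma_cong[OF omega_magma_axioms]) simp_all
  have [simp]: "cmp X 0 1 f g \<in> cells X 1" "dm X 0 (cmp X 0 1 f g) = dm X 0 f"
    "cd X 0 (cmp X 0 1 f g) = cd X 0 g"
    if "f \<in> cells X 1" "g \<in> cells X 1" "cd X 0 f = dm X 0 g" for f g
    using that cmp_cells[of 0 1 f g] dm_cmp_top[of 0 f g] cd_cmp_top[of 0 f g]
    by (simp_all add: composable_low)
  have [simp]: "dm X 0 x \<in> cells X 0" "cd X 0 x \<in> cells X 0" if "x \<in> cells X 1" for x
    using that dm_cells[of x 0] cd_cells[of x 0] by simp_all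
  have [simp]: "dm X 1 x \<in> cells X 1" "cd X 1 x \<in> cells X 1"
    "cd X 0 (dm X 1 x) = cd X 0 (cd X 1 x)" "dm X 0 (dm X 1 x) = dm X 0 (cd X 1 x)"
    if "x \<in> cells X 2" for x
    using that dm_cells[of x 1] cd_cells[of x 1] dm_dm[of x 0] cd_dm[of x 0]
    by simp_all
  have [simp]: "idc X 0 x \<in> cells X 1" "dm X 0 (idc X 0 x) = x" "cd X 0 (idc X 0 x) = x"
    if "x \<in> cells X 0" for x
    using that idc_cells[of x 0] dm_idc cd_idc by auto
  have [simp]: "idc X 1 x \<in> cells X 2" "dm X 1 (idc X 1 x) = x" "cd X 1 (idc X 1 x) = x"
    if "x \<in> cells X 1" for x
    using that idc_cells[of x 1] dm_idc cd_idc by auto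
  have [simp]: "cmp X 0 2 a b \<in> cells X 2" "dm X 1 (cmp X 0 2 a b) = cmp X 0 1 (dm X 1 a) (dm X 1 b)"
    "cd X 1 (cmp X 0 2 a b) = cmp X 0 1 (cd X 1 a) (cd X 1 b)"
    if "a \<in> cells X 2" "b \<in> cells X 2" "cd X 0 (cd X 1 a) = dm X 0 (cd X 1 b)" for a b
    using that cmp_cells[of 0 2 a b] dm_cmp[of 0 1 a b] cd_cmp[of 0 1 a b]
    by (simp_all add: composable_low)
  have [simp]: "cmp X 1 2 (idc X 1 (dm X 1 a)) a = a" "cmp X 1 2 a (idc X 1 (cd X 1 a)) = a"
    if "a \<in> cells X 2" for a
    using that cmp_id_left[of 1 2 a] cmp_id_right[of 1 2 a] by simp_all
  have [simp]: "cmp X 0 1 (idc X 0 (dm X 0 a)) a = a" "cmp X 0 1 a (idc X 0 (cd X 0 a)) = a"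
    if "a \<in> cells X 1" for a
    using that cmp_id_left[of 0 1 a] cmp_id_right[of 0 1 a] by (simp_all)
  have assoc [simp]: "cmp X 0 1 (cmp X 0 1 f g) h = cmp X 0 1 f (cmp X 0 1 g h)"
    if "f \<in> cells X 1" "g \<in> cells X 1" "h \<in> cells X 1" "cd X 0 f = dm X 0 g" "cd X 0 g = dm X 0 h"
    for f g h
    using that cmp_assoc[of 0 1 f g h] by (simp add: composable_low)
  have [simp]: "cmp X 0 2 (cmp X 0 2 f g) h = cmp X 0 2 f (cmp X 0 2 g h)"
    if "f \<in> cells X 2" "g \<in> cells X 2" "h \<in> cells X 2"
      "cd X 0 (cd X 1 f) = dm X 0 (cd X 1 g)" "cd X 0 (cd X 1 g) = dm X 0 (cd X 1 h)"
    for f g h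
    using that cmp_assoc[of 0 2 f g h] by (simp add: composable_low)
  have u: "cmp X 0 2 (idc X 1 (idc X 0 (dm X 0 (cd X 1 a)))) a = a"
    "cmp X 0 2 a (idc X 1 (idc X 0 (cd X 0 (cd X 1 a)))) = a"
    if "a \<in> cells X 2" for a
    using that cmp_id_left[of 0 2 a] cmp_id_right[of 0 2 a] by simp_all
  have v: "cmp X 1 2 a (idc X 1 f) = a" "cmp X 1 2 (idc X 1 g) a = a"
    if "a \<in> cells X 2" "f = cd X 1 a" "g = dm X 1 a" for a f g
    using that by auto
  have i: "\<exists>d. inverse_2cells ?B (idc X 1 f) d" if "f \<in> cells X 1" for f
    using that by (auto simp: inverse_2cells_def idc_cmp_12 intro!: exI[of _ "idc X 1 f"])
  show ?thesis
  proof
    show "skeletal 2 ?B" using assms by simp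
  next
    fix a b c assume "composable ?B 1 2 a b" "composable ?B 1 2 b c"
    then show "cmp ?B 1 2 (cmp ?B 1 2 a b) c = cmp ?B 1 2 a (cmp ?B 1 2 b c)"
      using cmp_assoc[of 1 2 a b c] by simp
  next
    fix a b c d assume "composable ?B 1 2 a b" "composable ?B 1 2 c d"
      "composable ?B 0 2 a c" "composable ?B 0 2 b d"
    then show "cmp ?B 0 2 (cmp ?B 1 2 a b) (cmp ?B 1 2 c d) =
        cmp ?B 1 2 (cmp ?B 0 2 a c) (cmp ?B 0 2 b d)"
      using interchange[of 0 1 2 a b c d] by simp
  qed (simp_all add: composable_low[where X = X] u v i idc_cmp_01 idc_cmp_12)
qed

lemma strong_homomorphism_bicat_of_strict:
  assumes "omega_magma_morphism X Y F" "strict_omega_category X" "strict_omega_category Y"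
    "skeletal 2 X" "skeletal 2 Y"
  shows "strong_homomorphism (bicat_of_strict X) (bicat_of_strict Y) F"
proof -
  interpret F: omega_magma_morphism X Y F by fact
  interpret X: bicategory "bicat_of_strict X"
    using assms bicategory_bicat_of_strict by blast
  interpret Y: bicategory "bicat_of_strict Y"
    using assms bicategory_bicat_of_strict by blast
  interpret F': omega_magma_morphism "bicat_of_strict X" "bicat_of_strict Y" F
    by (rule omega_magma_morphism_cong[OF assms(1)]) simp_all
  have [simp]: "F 2 (idc X 1 f) = idc Y 1 (F 1 f)" if "f \<in> cells X 1" for f
    using F.map_idc[OF that] by simp
  have [simp]: "F 1 (cmp X 0 1 f g) = cmp Y 0 1 (F 1 f) (F 1 g)" "cmp X 0 1 f g \<in> cells X 1"
    "cd X 0 (cmp X 0 1 f g) = cd X 0 g"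
    if "f \<in> cells X 1" "g \<in> cells X 1" "cd X 0 f = dm X 0 g" for f g
    using that F.map_cmp[of 0 1 f g] F.dom.cmp_cells[of 0 1 f g] F.dom.cd_cmp_top[of 0 f g]
    by (simp_all add: composable_low)
  show ?thesis
  proof (intro strong_homomorphism.intro strong_homomorphism_axioms.intro)
    fix f g h
    assume "composable (bicat_of_strict X) 0 1 f g" "composable (bicat_of_strict X) 0 1 g h"
    then show "F 2 (associator (bicat_of_strict X) f g h) =
        associator (bicat_of_strict Y) (F 1 f) (F 1 g) (F 1 h)"
      by (simp add: composable_low)
  qed (simp_all add: X.bicategory_axioms Y.bicategory_axioms F'.omega_magma_morphism_axioms)
qed

text \<open>The axioms are equations between cells, so a closed subset inherits them. The inclusion
  serves to turn a map into the subset into an endomorphism of \<open>X\<close>.\<close>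

lemma strict_omega_category_subset:
  assumes "strict_omega_category X"
    and sub: "\<And>i. S i \<subseteq> cells X i"
    and dm: "\<And>i x. x \<in> S (Suc i) \<Longrightarrow> dm X i x \<in> S i"
    and cd: "\<And>i x. x \<in> S (Suc i) \<Longrightarrow> cd X i x \<in> S i"
    and idc: "\<And>i x. x \<in> S i \<Longrightarrow> idc X i x \<in> S (Suc i)"
    and cmp: "\<And>i j a b. \<lbrakk>a \<in> S j; b \<in> S j; composable X i j a b\<rbrakk> \<Longrightarrow> cmp X i j a b \<in> S j"
  shows "strict_omega_category (X\<lparr>cells := S\<rparr>)"
    and "omega_magma_morphism (X\<lparr>cells := S\<rparr>) X (\<lambda>i x. x)"
proof -
  interpret strict_omega_category X by fact
  let ?S = "X\<lparr>cells := S\<rparr>"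
  have it: "dom_it ?S i j x = dom_it X i j x" "cod_it ?S i j x = cod_it X i j x"
    "id_it ?S i j x = id_it X i j x" for i j x
    by (rule dom_it_cong cod_it_cong id_it_cong, simp)+
  have c: "composable ?S i j a b \<longleftrightarrow> a \<in> S j \<and> b \<in> S j \<and> composable X i j a b" for i j a b
    using sub by (auto simp: composable_def it)
  have s: "x \<in> S i \<Longrightarrow> x \<in> cells X i" for i x
    using sub by blast
  show S: "strict_omega_category ?S"
  proof
    fix i j k a b c d
    assume "i < j" "j < k" "composable ?S j k a b" "composable ?S j k c d"
      "composable ?S i k a c" "composable ?S i k b d"
    then show "cmp ?S i k (cmp ?S j k a b) (cmp ?S j k c d) =
        cmp ?S j k (cmp ?S i k a c) (cmp ?S i k b d)"
      using interchange[of i j k a b c d] by (simp add: c)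
  qed (simp_all add: s c it dm cd idc cmp dm_dm cd_dm dm_idc cd_idc dm_cmp_top cd_cmp_top dm_cmp
        cd_cmp cmp_assoc cmp_id_left cmp_id_right cmp_idc)
  interpret S: strict_omega_category ?S by fact
  show "omega_magma_morphism ?S X (\<lambda>i x. x)"
    by unfold_locales (simp_all add: s)
qed

text \<open>
  The cells that are iterated identities of 2-cells form a sub omega category which contains the
  generators, so by the uniqueness part of the universal property they are all cells.
\<close>

lemma free_strict_omega_category_skeletal:
  fixes X :: "'u omega_magma"
  assumes free: "free_strict_omega_category G X \<eta>" and G: "skeletal 2 G"
  shows "skeletal 2 X"
proof -
  interpret strict_omega_category X
    using free by (simp add: free_strict_omega_category_def)
  interpret \<eta>: omega_graph_morphism G "graph_of_magma X" \<eta>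
    using free by (simp add: free_strict_omega_category_def)
  define S where "S = rec_nat (cells X 0) (\<lambda>n s. if n < 2 then cells X (Suc n) else idc X n ` s)"
  have S_low: "S i = cells X i" if "i \<le> 2" for i
    using that by (cases i) (auto simp: S_def)
  have S_Suc: "S (Suc n) = idc X n ` S n" if "2 \<le> n" for n
    using that by (simp add: S_def)
  have sub: "S i \<subseteq> cells X i" for i
    by (induction i) (auto simp: S_def idc_cells)
  have idc: "idc X i x \<in> S (Suc i)" if "x \<in> S i" for i x
    using that S_Suc[of i] S_low[of "Suc i"] subsetD[OF sub, of x i] idc_cells[of x i]
    by (cases "2 \<le> i") simp_all
  have high: "\<exists>y. y \<in> S n \<and> x = idc X n y \<and> y \<in> cells X n" if "2 \<le> n" "x \<in> S (Suc n)" for n x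
    using that S_Suc sub by blast
  have dc: "dm X i x \<in> S i \<and> cd X i x \<in> S i" if "x \<in> S (Suc i)" for i x
  proof (cases "2 \<le> i")
    case True
    then show ?thesis using high[OF True that] dm_idc cd_idc by auto
  next
    case False
    then show ?thesis using that S_low[of i] S_low[of "Suc i"] dm_cells cd_cells by auto
  qed
  have cmp: "cmp X i j a b \<in> S j" if "a \<in> S j" "b \<in> S j" "composable X i j a b" for i j a b
    using that
  proof (induction j arbitrary: a b)
    case 0
    then show ?case by (simp add: composable_def)
  next
    case (Suc n)
    show ?case
    proof (cases "2 \<le> n")
      case True
      obtain a' b' where a': "a' \<in> S n" "a = idc X n a'" "a' \<in> cells X n"
        and b': "b' \<in> S n" "b = idc X n b'" "b' \<in> cells X n"
        using high[OF True] Suc.prems by metis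
      show ?thesis
      proof (cases "i = n")
        case True
        \<comment> \<open>Composability along the dimension just below forces both cells to be
          identities of the same cell, so the unit law computes the composite.\<close>
        then have "a' = b'"
          using Suc.prems a' b' by (simp add: composable_Suc dm_idc cd_idc)
        then have "cmp X i (Suc n) a b = a"
          using cmp_id_left[of n "Suc n" a] a' b' True by (simp add: dm_idc idc_cells)
        then show ?thesis using Suc.prems by simp
      next
        case False
        then have "i < n" using Suc.prems by (simp add: composable_def)
        then have c: "composable X i n a' b'"
          using composable_dm[OF Suc.prems(3)] a' b' by (simp add: dm_idc)
        have "cmp X i (Suc n) a b = idc X n (cmp X i n a' b')"
          using cmp_idc[OF c] a' b' by simp
        then show ?thesis using idc Suc.IH[OF a'(1) b'(1) c] by simp
      qed
    next
      case False
      then show ?thesis using cmp_cells Suc.prems(3) S_low[of "Suc n"] by simp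
    qed
  qed
  let ?S = "X\<lparr>cells := S\<rparr>"
  note subcat = strict_omega_category_subset[OF strict_omega_category_axioms sub conjunct1[OF dc]
      conjunct2[OF dc] idc cmp]
  interpret S: strict_omega_category ?S by (rule subcat)
  have \<eta>S: "\<eta> i x \<in> S i" if "x \<in> cells G i" for i x
    using that
  proof (induction i arbitrary: x)
    case 0
    then show ?case using \<eta>.map_cells S_low[of 0] by fastforce
  next
    case (Suc n)
    show ?case
    proof (cases "2 \<le> n")
      case True
      then obtain y where "y \<in> cells G n" "x = idc G n y"
        using G Suc.prems by (auto simp: skeletal_def)
      then show ?thesis using Suc.IH idc \<eta>.map_idc by simp
    next
      case False
      then show ?thesis using S_low[of "Suc n"] \<eta>.map_cells[OF Suc.prems] by simp
    qed
  qed
  have "omega_graph_morphism G (graph_of_magma ?S) \<eta>"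
  proof -
    have "omega_graph (graph_of_magma ?S)"
      by (rule omega_graph_cong[OF S.omega_graph_axioms]) simp_all
    then show ?thesis
      using \<eta>.dom.omega_graph_axioms \<eta>.map_dm \<eta>.map_cd \<eta>.map_idc \<eta>S
      by (simp add: omega_graph_morphism_def omega_graph_morphism_axioms_def)
  qed
  \<comment> \<open>Followed by the inclusion, \<open>H\<close> is an endomorphism of
    \<open>X\<close> that extends \<eta>, and so is the identity. Hence \<open>H\<close> fixes every
    cell, while its values lie in \<open>S\<close>.\<close>
  then obtain H where H: "omega_magma_morphism X ?S H" "extends G \<eta> \<eta> H"
    using free subcat(1) unfolding free_strict_omega_category_def by blast
  have "omega_magma_morphism X X H"
    using omega_magma_morphism_comp[OF H(1) subcat(2)] by simp
  moreover have "omega_magma_morphism X X (\<lambda>i x. x)"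
    by unfold_locales simp_all
  moreover have "extends G \<eta> \<eta> (\<lambda>i x. x)"
    by (simp add: extends_def)
  moreover have "omega_graph_morphism G (graph_of_magma X) \<eta>" ..
  ultimately have "H i x = x" if "x \<in> cells X i" for i x
    using free H(2) strict_omega_category_axioms that
    unfolding free_strict_omega_category_def by metis
  moreover have "H i x \<in> S i" if "x \<in> cells X i" for i x
  proof -
    interpret H: omega_magma_morphism X ?S H by fact
    show ?thesis using H.map_cells[OF that] by simp
  qed
  ultimately have "cells X i \<subseteq> S i" for i
    by (metis subsetI)
  then show ?thesis
    unfolding skeletal_def using S_Suc sub by blast
qed


section \<open>Calculus in a bicategory\<close>

context bicategory
begin

abbreviation ar_comp (infixr \<open>\<otimes>\<close> 75) where "f \<otimes> g \<equiv> cmp Y 0 1 f g"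
abbreviation h_comp (infixr \<open>\<star>\<close> 70) where "a \<star> b \<equiv> cmp Y 0 2 a b"
abbreviation v_comp (infixr \<open>\<odot>\<close> 65) where "a \<odot> b \<equiv> cmp Y 1 2 a b"
abbreviation "C0 \<equiv> cells Y 0"
abbreviation "C1 \<equiv> cells Y 1"
abbreviation "C2 \<equiv> cells Y 2"
abbreviation "dm0 \<equiv> dm Y 0"
abbreviation "cd0 \<equiv> cd Y 0"
abbreviation "dm1 \<equiv> dm Y 1"
abbreviation "cd1 \<equiv> cd Y 1"
abbreviation "I0 \<equiv> idc Y 0"
abbreviation "I1 \<equiv> idc Y 1"
abbreviation "\<alpha> \<equiv> associator Y"
abbreviation "\<l> \<equiv> lunitor Y"
abbreviation "\<r> \<equiv> runitor Y"

lemma ar_simps [simp]: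
  "f \<in> C1 \<Longrightarrow> dm0 f \<in> C0" "f \<in> C1 \<Longrightarrow> cd0 f \<in> C0"
  "x \<in> C0 \<Longrightarrow> I0 x \<in> C1" "x \<in> C0 \<Longrightarrow> dm0 (I0 x) = x" "x \<in> C0 \<Longrightarrow> cd0 (I0 x) = x"
  "\<lbrakk>f \<in> C1; g \<in> C1; cd0 f = dm0 g\<rbrakk> \<Longrightarrow> f \<otimes> g \<in> C1"
  "\<lbrakk>f \<in> C1; g \<in> C1; cd0 f = dm0 g\<rbrakk> \<Longrightarrow> dm0 (f \<otimes> g) = dm0 f"
  "\<lbrakk>f \<in> C1; g \<in> C1; cd0 f = dm0 g\<rbrakk> \<Longrightarrow> cd0 (f \<otimes> g) = cd0 g"
  using dm_cells[of f 0] cd_cells[of f 0] idc_cells[of x 0] dm_idc[of x 0] cd_idc[of x 0]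
    cmp_cells[of 0 1 f g] dm_cmp_top[of 0 f g] cd_cmp_top[of 0 f g] by (simp_all add: composable_low)

text \<open>The globular identities are oriented towards \<open>dm1\<close>. This gives the end
  objects of a 2-cell a single normal form, in which the side conditions below are stated.\<close>

lemma cell_simps [simp]:
  "a \<in> C2 \<Longrightarrow> dm1 a \<in> C1" "a \<in> C2 \<Longrightarrow> cd1 a \<in> C1"
  "a \<in> C2 \<Longrightarrow> dm0 (cd1 a) = dm0 (dm1 a)" "a \<in> C2 \<Longrightarrow> cd0 (cd1 a) = cd0 (dm1 a)"
  "f \<in> C1 \<Longrightarrow> I1 f \<in> C2" "f \<in> C1 \<Longrightarrow> dm1 (I1 f) = f" "f \<in> C1 \<Longrightarrow> cd1 (I1 f) = f"
  using dm_cells[of a 1] cd_cells[of a 1] dm_dm[of a 0] cd_dm[of a 0] idc_cells[of f 1]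
    dm_idc[of f 1] cd_idc[of f 1] by simp_all

lemma v_simps [simp]:
  assumes "a \<in> C2" "b \<in> C2" "cd1 a = dm1 b"
  shows "a \<odot> b \<in> C2" "dm1 (a \<odot> b) = dm1 a" "cd1 (a \<odot> b) = cd1 b"
  using assms cmp_cells[of 1 2 a b] dm_cmp_top[of 1 a b] cd_cmp_top[of 1 a b]
  by (simp_all add: composable_low)

lemma h_simps [simp]:
  assumes "a \<in> C2" "b \<in> C2" "cd0 (dm1 a) = dm0 (dm1 b)"
  shows "a \<star> b \<in> C2" "dm1 (a \<star> b) = dm1 a \<otimes> dm1 b" "cd1 (a \<star> b) = cd1 a \<otimes> cd1 b"
  using assms cmp_cells[of 0 2 a b] dm_cmp[of 0 1 a b] cd_cmp[of 0 1 a b]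
  by (simp_all add: composable_low)

lemma v_unit [simp]:
  "\<lbrakk>a \<in> C2; dm1 a = f\<rbrakk> \<Longrightarrow> I1 f \<odot> a = a" "\<lbrakk>a \<in> C2; cd1 a = f\<rbrakk> \<Longrightarrow> a \<odot> I1 f = a"
  using v_id_left v_id_right by auto

lemma v_assoc' [simp]:
  "\<lbrakk>a \<in> C2; b \<in> C2; c \<in> C2; cd1 a = dm1 b; cd1 b = dm1 c\<rbrakk> \<Longrightarrow> (a \<odot> b) \<odot> c = a \<odot> b \<odot> c"
  using v_assoc by (simp add: composable_low)

lemma h_id' [simp]:
  "\<lbrakk>f \<in> C1; g \<in> C1; cd0 f = dm0 g\<rbrakk> \<Longrightarrow> I1 f \<star> I1 g = I1 (f \<otimes> g)"
  using h_id by (simp add: composable_low)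

lemma interchange:
  assumes "a \<in> C2" "b \<in> C2" "c \<in> C2" "d \<in> C2" "cd1 a = dm1 b" "cd1 c = dm1 d"
    "cd0 (dm1 a) = dm0 (dm1 c)"
  shows "(a \<odot> b) \<star> (c \<odot> d) = (a \<star> c) \<odot> (b \<star> d)"
proof -
  have "cd0 (dm1 b) = cd0 (dm1 a)" "dm0 (dm1 d) = dm0 (dm1 c)"
    using cell_simps(4)[OF assms(1)] cell_simps(3)[OF assms(3)] assms(5,6) by simp_all
  then show ?thesis
    using assms h_interchange[of a b c d] by (simp add: composable_low)
qed

lemma whisker_left:
  assumes "f \<in> C1" "a \<in> C2" "b \<in> C2" "cd1 a = dm1 b" "cd0 f = dm0 (dm1 a)"
  shows "I1 f \<star> (a \<odot> b) = (I1 f \<star> a) \<odot> (I1 f \<star> b)"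
  using assms interchange[of "I1 f" "I1 f" a b] by simp

lemma whisker_right:
  assumes "f \<in> C1" "a \<in> C2" "b \<in> C2" "cd1 a = dm1 b" "cd0 (dm1 a) = dm0 f"
  shows "(a \<odot> b) \<star> I1 f = (a \<star> I1 f) \<odot> (b \<star> I1 f)"
  using assms interchange[of a b "I1 f" "I1 f"] by simp

lemma assoc_simps [simp]:
  assumes "f \<in> C1" "g \<in> C1" "h \<in> C1" "cd0 f = dm0 g" "cd0 g = dm0 h"
  shows "\<alpha> f g h \<in> C2" "dm1 (\<alpha> f g h) = (f \<otimes> g) \<otimes> h" "cd1 (\<alpha> f g h) = f \<otimes> g \<otimes> h"
  using assms associator_cell associator_dm associator_cd by (simp_all add: composable_low)

lemma unitor_simps [simp]:
  assumes "f \<in> C1"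
  shows "\<l> f \<in> C2" "dm1 (\<l> f) = I0 (dm0 f) \<otimes> f" "cd1 (\<l> f) = f"
    "\<r> f \<in> C2" "dm1 (\<r> f) = f \<otimes> I0 (cd0 f)" "cd1 (\<r> f) = f"
  using assms lunitor_cell lunitor_dm lunitor_cd runitor_cell runitor_dm runitor_cd by simp_all

lemma assoc_nat:
  assumes "a \<in> C2" "b \<in> C2" "c \<in> C2" "cd0 (dm1 a) = dm0 (dm1 b)" "cd0 (dm1 b) = dm0 (dm1 c)"
  shows "((a \<star> b) \<star> c) \<odot> \<alpha> (cd1 a) (cd1 b) (cd1 c) = \<alpha> (dm1 a) (dm1 b) (dm1 c) \<odot> (a \<star> b \<star> c)"
  using assms associator_natural[of a b c] by (simp add: composable_low)

lemma lunitor_nat: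
  assumes "a \<in> C2"
  shows "(I1 (I0 (dm0 (dm1 a))) \<star> a) \<odot> \<l> (cd1 a) = \<l> (dm1 a) \<odot> a"
  using assms lunitor_natural[of a] by simp

lemma runitor_nat:
  assumes "a \<in> C2"
  shows "(a \<star> I1 (I0 (cd0 (dm1 a)))) \<odot> \<r> (cd1 a) = \<r> (dm1 a) \<odot> a"
  using assms runitor_natural[of a] by simp

lemma pentagon':
  assumes "f \<in> C1" "g \<in> C1" "h \<in> C1" "k \<in> C1" "cd0 f = dm0 g" "cd0 g = dm0 h" "cd0 h = dm0 k"
  shows "\<alpha> (f \<otimes> g) h k \<odot> \<alpha> f g (h \<otimes> k) =
    (\<alpha> f g h \<star> I1 k) \<odot> \<alpha> f (g \<otimes> h) k \<odot> (I1 f \<star> \<alpha> g h k)"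
  using assms pentagon[of f g h k] by (simp add: composable_low)

lemma triangle':
  assumes "f \<in> C1" "g \<in> C1" "cd0 f = dm0 g"
  shows "\<alpha> f (I0 (dm0 g)) g \<odot> (I1 f \<star> \<l> g) = \<r> f \<star> I1 g"
  using assms triangle[of f g] by (simp add: composable_low)


subsection \<open>Invertible 2-cells\<close>

definition iso :: "'a \<Rightarrow> bool" where "iso c \<longleftrightarrow> (\<exists>d. inverse_2cells Y c d)"

text \<open>The choice is harmless: by \<open>inverse_unique\<close> there is at most one
  inverse.\<close>

definition inv2 :: "'a \<Rightarrow> 'a" where "inv2 c = (SOME d. inverse_2cells Y c d)"

lemma inverse_inv2: "iso c \<Longrightarrow> inverse_2cells Y c (inv2 c)"
  unfolding iso_def inv2_def by (rule someI_ex)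

lemma iso_cell [simp]: "iso c \<Longrightarrow> c \<in> C2"
  using inverse_inv2 by (simp add: inverse_2cells_def)

lemma inv2_simps [simp]:
  assumes "iso c"
  shows "inv2 c \<in> C2" "dm1 (inv2 c) = cd1 c" "cd1 (inv2 c) = dm1 c"
    "c \<odot> inv2 c = I1 (dm1 c)" "inv2 c \<odot> c = I1 (cd1 c)"
  using inverse_inv2[OF assms] by (simp_all add: inverse_2cells_def)

lemma inverse_2cells_sym: "inverse_2cells Y c d \<Longrightarrow> inverse_2cells Y d c"
  by (auto simp: inverse_2cells_def)

lemma iso_inv2 [simp]: "iso c \<Longrightarrow> iso (inv2 c)"
  using inverse_inv2 inverse_2cells_sym iso_def by blast

text \<open>Stated with a tail \<open>a\<close>, because \<open>v_assoc'\<close> brackets composites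
  to the right and thereby separates \<open>c\<close> from its inverse.\<close>

lemma inv2_cancel [simp]:
  assumes "iso c" "a \<in> C2"
  shows "dm1 a = cd1 c \<Longrightarrow> inv2 c \<odot> c \<odot> a = a" "dm1 a = dm1 c \<Longrightarrow> c \<odot> inv2 c \<odot> a = a"
proof -
  show "inv2 c \<odot> c \<odot> a = a" if "dm1 a = cd1 c"
    using v_assoc'[of "inv2 c" c a] assms that by (simp del: v_assoc')
  show "c \<odot> inv2 c \<odot> a = a" if "dm1 a = dm1 c"
    using v_assoc'[of c "inv2 c" a] assms that by (simp del: v_assoc')
qed

lemma cancel_left:
  assumes "iso c" "a \<in> C2" "b \<in> C2" "dm1 a = cd1 c" "dm1 b = cd1 c" "c \<odot> a = c \<odot> b"
  shows "a = b"
  using assms inv2_cancel(1) by metis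

lemma cancel_right:
  assumes "iso c" "a \<in> C2" "b \<in> C2" "cd1 a = dm1 c" "cd1 b = dm1 c" "a \<odot> c = b \<odot> c"
  shows "a = b"
proof -
  have "a = (a \<odot> c) \<odot> inv2 c" using assms(1-5) by simp
  also have "\<dots> = b" using assms by simp
  finally show ?thesis .
qed

lemma inverse_unique:
  assumes "inverse_2cells Y c d" shows "d = inv2 c"
proof -
  have c: "iso c" using assms iso_def by blast
  show ?thesis
    by (rule cancel_left[OF c]) (use assms c in \<open>auto simp: inverse_2cells_def\<close>)
qed

lemma inverse_v:
  assumes "iso a" "iso b" "cd1 a = dm1 b"
  shows "inverse_2cells Y (a \<odot> b) (inv2 b \<odot> inv2 a)"
  using assms by (simp add: inverse_2cells_def)

lemma inverse_h:
  assumes "iso a" "iso b" "cd0 (dm1 a) = dm0 (dm1 b)"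
  shows "inverse_2cells Y (a \<star> b) (inv2 a \<star> inv2 b)"
proof -
  have "cd0 (cd1 a) = dm0 (cd1 b)" using assms by simp
  then show ?thesis
    using assms by (simp add: inverse_2cells_def flip: interchange)
qed

lemma inverse_I1: "f \<in> C1 \<Longrightarrow> inverse_2cells Y (I1 f) (I1 f)"
  by (simp add: inverse_2cells_def)

lemma iso_intros [simp]:
  "f \<in> C1 \<Longrightarrow> iso (I1 f)"
  "\<lbrakk>iso a; iso b; cd1 a = dm1 b\<rbrakk> \<Longrightarrow> iso (a \<odot> b)"
  "\<lbrakk>iso a; iso b; cd0 (dm1 a) = dm0 (dm1 b)\<rbrakk> \<Longrightarrow> iso (a \<star> b)"
  "\<lbrakk>f \<in> C1; g \<in> C1; h \<in> C1; cd0 f = dm0 g; cd0 g = dm0 h\<rbrakk> \<Longrightarrow> iso (\<alpha> f g h)"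
  "f \<in> C1 \<Longrightarrow> iso (\<l> f)" "f \<in> C1 \<Longrightarrow> iso (\<r> f)"
proof -
  show "f \<in> C1 \<Longrightarrow> iso (I1 f)"
    using inverse_I1 iso_def by blast
  show "\<lbrakk>iso a; iso b; cd1 a = dm1 b\<rbrakk> \<Longrightarrow> iso (a \<odot> b)"
    using inverse_v iso_def by blast
  show "\<lbrakk>iso a; iso b; cd0 (dm1 a) = dm0 (dm1 b)\<rbrakk> \<Longrightarrow> iso (a \<star> b)"
    using inverse_h iso_def by blast
  show "\<lbrakk>f \<in> C1; g \<in> C1; h \<in> C1; cd0 f = dm0 g; cd0 g = dm0 h\<rbrakk> \<Longrightarrow> iso (\<alpha> f g h)"
    using associator_iso by (simp add: iso_def composable_low)
  show "f \<in> C1 \<Longrightarrow> iso (\<l> f)" "f \<in> C1 \<Longrightarrow> iso (\<r> f)"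
    using lunitor_iso runitor_iso by (simp_all add: iso_def)
qed

lemma inv2_v: "\<lbrakk>iso a; iso b; cd1 a = dm1 b\<rbrakk> \<Longrightarrow> inv2 (a \<odot> b) = inv2 b \<odot> inv2 a"
  using inverse_unique inverse_v by metis

lemma inv2_h: "\<lbrakk>iso a; iso b; cd0 (dm1 a) = dm0 (dm1 b)\<rbrakk> \<Longrightarrow> inv2 (a \<star> b) = inv2 a \<star> inv2 b"
  using inverse_unique inverse_h by metis

subsection \<open>Kelly's coherence conditions for the units\<close>

text \<open>Naturality of \<l> expresses whiskering with an identity 1-cell as conjugation by
  unitors, which is injective. So an equation may be proved after such a whiskering.\<close>

lemma lunitor_I_left:
  assumes "a \<in> C2" "b \<in> C2" "dm1 a = dm1 b" "cd1 a = cd1 b"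
    "I1 (I0 (dm0 (dm1 a))) \<star> a = I1 (I0 (dm0 (dm1 a))) \<star> b"
  shows "a = b"
proof (rule cancel_left)
  show "\<l> (dm1 a) \<odot> a = \<l> (dm1 a) \<odot> b"
    using lunitor_nat[of a] lunitor_nat[of b] assms by simp
qed (use assms in auto)

lemma runitor_I_right:
  assumes "a \<in> C2" "b \<in> C2" "dm1 a = dm1 b" "cd1 a = cd1 b"
    "a \<star> I1 (I0 (cd0 (dm1 a))) = b \<star> I1 (I0 (cd0 (dm1 a)))"
  shows "a = b"
proof (rule cancel_left)
  show "\<r> (dm1 a) \<odot> a = \<r> (dm1 a) \<odot> b"
    using runitor_nat[of a] runitor_nat[of b] assms by simp
qed (use assms in auto)

text \<open>Both sides are compared after whiskering with the identity at the source of
  \<open>f\<close>. The pentagon with two identities in front, the triangle used twice and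
  naturality of \<alpha> then turn one side into the other.\<close>

lemma lunitor_comp:
  assumes f: "f \<in> C1" and g: "g \<in> C1" and fg: "cd0 f = dm0 g"
  shows "\<alpha> (I0 (dm0 f)) f g \<odot> \<l> (f \<otimes> g) = \<l> f \<star> I1 g"
proof (rule lunitor_I_left)
  let ?I = "I0 (dm0 f)"
  \<comment> \<open>The first two factors of the long side of the pentagon for \<open>?I\<close>,
    \<open>?I\<close>, \<open>f\<close>, \<open>g\<close>. They are invertible, hence cancelled at
    the end.\<close>
  let ?X = "(\<alpha> ?I ?I f \<star> I1 g) \<odot> \<alpha> ?I (?I \<otimes> f) g"
  note s = f g fg
  have "I1 ?I \<star> (\<alpha> ?I f g \<odot> \<l> (f \<otimes> g)) = I1 ?I \<star> (\<l> f \<star> I1 g)"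
  proof (rule cancel_left[of ?X])
    have "?X \<odot> (I1 ?I \<star> (\<alpha> ?I f g \<odot> \<l> (f \<otimes> g))) =
        (\<alpha> (?I \<otimes> ?I) f g \<odot> \<alpha> ?I ?I (f \<otimes> g)) \<odot> (I1 ?I \<star> \<l> (f \<otimes> g))"
      using s pentagon'[of ?I ?I f g] by (simp add: whisker_left)
    also have "\<dots> = \<alpha> (?I \<otimes> ?I) f g \<odot> (\<r> ?I \<star> (I1 f \<star> I1 g))"
      using s triangle'[of ?I "f \<otimes> g"] by simp
    also have "\<dots> = ((\<r> ?I \<star> I1 f) \<star> I1 g) \<odot> \<alpha> ?I f g"
      using s assoc_nat[of "\<r> ?I" "I1 f" "I1 g"] by (simp del: h_id')
    also have "\<dots> = (\<alpha> ?I ?I f \<star> I1 g) \<odot> ((I1 ?I \<star> \<l> f) \<star> I1 g) \<odot> \<alpha> ?I f g"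
      using s triangle'[of ?I f, symmetric] by (simp add: whisker_right)
    also have "\<dots> = ?X \<odot> (I1 ?I \<star> (\<l> f \<star> I1 g))"
      using s assoc_nat[of "I1 ?I" "\<l> f" "I1 g"] by simp
    finally show "?X \<odot> (I1 ?I \<star> (\<alpha> ?I f g \<odot> \<l> (f \<otimes> g))) = ?X \<odot> (I1 ?I \<star> (\<l> f \<star> I1 g))" .
  qed (use s in simp_all)
  then show "I1 (I0 (dm0 (dm1 (\<alpha> ?I f g \<odot> \<l> (f \<otimes> g))))) \<star> (\<alpha> ?I f g \<odot> \<l> (f \<otimes> g)) =
      I1 (I0 (dm0 (dm1 (\<alpha> ?I f g \<odot> \<l> (f \<otimes> g))))) \<star> (\<l> f \<star> I1 g)"
    using s by simp
qed (use assms in simp_all)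

text \<open>The mirror image of the previous argument, with the pentagon for \<open>f\<close>,
  \<open>g\<close> and two identities behind them; this time an associator is cancelled on the
  right.\<close>

lemma runitor_comp:
  assumes f: "f \<in> C1" and g: "g \<in> C1" and fg: "cd0 f = dm0 g"
  shows "\<alpha> f g (I0 (cd0 g)) \<odot> (I1 f \<star> \<r> g) = \<r> (f \<otimes> g)"
proof (rule runitor_I_right)
  let ?I = "I0 (cd0 g)"
  let ?L = "\<alpha> f g ?I \<odot> (I1 f \<star> \<r> g)"
  note s = f g fg
  have "?L \<star> I1 ?I = \<r> (f \<otimes> g) \<star> I1 ?I"
  proof (rule cancel_right[of "\<alpha> f g ?I"])
    have "(?L \<star> I1 ?I) \<odot> \<alpha> f g ?I =
        (\<alpha> f g ?I \<star> I1 ?I) \<odot> \<alpha> f (g \<otimes> ?I) ?I \<odot> (I1 f \<star> (\<r> g \<star> I1 ?I))"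
      using s assoc_nat[of "I1 f" "\<r> g" "I1 ?I"] by (simp add: whisker_right)
    also have "\<dots> = ((\<alpha> f g ?I \<star> I1 ?I) \<odot> \<alpha> f (g \<otimes> ?I) ?I \<odot> (I1 f \<star> \<alpha> g ?I ?I)) \<odot>
        (I1 f \<star> (I1 g \<star> \<l> ?I))"
      using s triangle'[of g ?I, symmetric] by (simp add: whisker_left)
    also have "\<dots> = \<alpha> (f \<otimes> g) ?I ?I \<odot> \<alpha> f g (?I \<otimes> ?I) \<odot> (I1 f \<star> (I1 g \<star> \<l> ?I))"
      using s pentagon'[of f g ?I ?I, symmetric] by simp
    also have "\<dots> = \<alpha> (f \<otimes> g) ?I ?I \<odot> (I1 (f \<otimes> g) \<star> \<l> ?I) \<odot> \<alpha> f g ?I"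
      using s assoc_nat[of "I1 f" "I1 g" "\<l> ?I"] by simp
    also have "\<dots> = (\<alpha> (f \<otimes> g) ?I ?I \<odot> (I1 (f \<otimes> g) \<star> \<l> ?I)) \<odot> \<alpha> f g ?I"
      using s by simp
    also have "\<dots> = (\<r> (f \<otimes> g) \<star> I1 ?I) \<odot> \<alpha> f g ?I"
      using s triangle'[of "f \<otimes> g" ?I] by simp
    finally show "(?L \<star> I1 ?I) \<odot> \<alpha> f g ?I = (\<r> (f \<otimes> g) \<star> I1 ?I) \<odot> \<alpha> f g ?I" .
  qed (use s in simp_all)
  then show "?L \<star> I1 (I0 (cd0 (dm1 ?L))) = \<r> (f \<otimes> g) \<star> I1 (I0 (cd0 (dm1 ?L)))"
    using s by simp
qed (use assms in simp_all)

lemma lunitor_eq_runitor: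
  assumes x: "x \<in> C0" shows "\<l> (I0 x) = \<r> (I0 x)"
proof (rule runitor_I_right)
  let ?I = "I0 x"
  \<comment> \<open>Naturality of \<l> at the 2-cell \<open>\<l> ?I\<close> itself, from which the
    invertible \<open>\<l> ?I\<close> is cancelled.\<close>
  have "\<l> (?I \<otimes> ?I) = I1 ?I \<star> \<l> ?I"
    by (rule cancel_right[of "\<l> ?I"]) (use x lunitor_nat[of "\<l> ?I"] in simp_all)
  then have "\<l> ?I \<star> I1 ?I = \<r> ?I \<star> I1 ?I"
    using lunitor_comp[of ?I ?I] triangle'[of ?I ?I] x by simp
  then show "\<l> ?I \<star> I1 (I0 (cd0 (dm1 (\<l> ?I)))) = \<r> ?I \<star> I1 (I0 (cd0 (dm1 (\<l> ?I))))"
    using x by simp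
qed (use x in simp_all)


section \<open>Words of 1-cells\<close>

primrec path :: "'a \<Rightarrow> 'a list \<Rightarrow> 'a \<Rightarrow> bool" where
  "path x [] y \<longleftrightarrow> x \<in> C0 \<and> x = y"
| "path x (f # us) y \<longleftrightarrow> f \<in> C1 \<and> dm0 f = x \<and> path (cd0 f) us y"

text \<open>Products are bracketed to the right and end in an identity even for one letter, so that
  the recursion is uniform; a single \<open>f\<close> has the value \<open>f \<otimes> I0 y\<close>.
  The target \<open>y\<close> is passed along because the empty list does not determine it.\<close>

primrec ev :: "'a \<Rightarrow> 'a list \<Rightarrow> 'a" where
  "ev y [] = I0 y"
| "ev y (f # us) = f \<otimes> ev y us"

text \<open>
  \<open>ev_comp y z vs us\<close> is the canonical isomorphism from \<open>ev y us \<otimes> ev z vs\<close> to \<open>ev z (us @ vs)\<close>.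
\<close>

primrec ev_comp :: "'a \<Rightarrow> 'a \<Rightarrow> 'a list \<Rightarrow> 'a list \<Rightarrow> 'a" where
  "ev_comp y z vs [] = \<l> (ev z vs)"
| "ev_comp y z vs (f # us) = \<alpha> f (ev y us) (ev z vs) \<odot> (I1 f \<star> ev_comp y z vs us)"

lemma path_ends: "path x us y \<Longrightarrow> x \<in> C0 \<and> y \<in> C0"
  by (induction us arbitrary: x) auto

lemma path_append: "path x us y \<Longrightarrow> path y vs z \<Longrightarrow> path x (us @ vs) z"
  by (induction us arbitrary: x) auto

lemma ev_simps:
  assumes "path x us y"
  shows "ev y us \<in> C1" "dm0 (ev y us) = x" "cd0 (ev y us) = y"
proof -
  have "ev y us \<in> C1 \<and> dm0 (ev y us) = x \<and> cd0 (ev y us) = y"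
    using assms by (induction us arbitrary: x) auto
  then show "ev y us \<in> C1" "dm0 (ev y us) = x" "cd0 (ev y us) = y" by auto
qed

lemma ev_comp_simps:
  assumes "path x us y" "path y vs z"
  shows "iso (ev_comp y z vs us)" "dm1 (ev_comp y z vs us) = ev y us \<otimes> ev z vs"
    "cd1 (ev_comp y z vs us) = ev z (us @ vs)"
proof -
  note v = ev_simps[OF assms(2)]
  have "iso (ev_comp y z vs us) \<and> dm1 (ev_comp y z vs us) = ev y us \<otimes> ev z vs \<and>
    cd1 (ev_comp y z vs us) = ev z (us @ vs)"
    using assms(1)
  proof (induction us arbitrary: x)
    case Nil
    then show ?case using v by simp
  next
    case (Cons f us)
    then have f: "f \<in> C1" "path (cd0 f) us y" by auto
    show ?case
      using f v ev_simps[OF f(2)] Cons.IH[OF f(2)] by simp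
  qed
  then show "iso (ev_comp y z vs us)" "dm1 (ev_comp y z vs us) = ev y us \<otimes> ev z vs"
    "cd1 (ev_comp y z vs us) = ev z (us @ vs)" by auto
qed

text \<open>This becomes the right unit law of the strictification. The base case is the equality of
  the two unitors at an identity 1-cell, the induction step is \<open>runitor_comp\<close>.\<close>

lemma ev_comp_Nil_right:
  assumes "path x us y"
  shows "ev_comp y y [] us = \<r> (ev y us)"
  using assms
proof (induction us arbitrary: x)
  case Nil
  then show ?case using lunitor_eq_runitor by auto
next
  case (Cons f us)
  then have f: "f \<in> C1" "path (cd0 f) us y" by auto
  show ?case
    using Cons.IH[OF f(2)] f(1) ev_simps[OF f(2)] runitor_comp[of f "ev y us"] by simp
qed

text \<open>The coherence behind associativity of horizontal composition of 2-cells between words.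
  For the empty word it is \<open>lunitor_comp\<close> with naturality of \<l>; each further letter
  costs one pentagon and naturality of \<alpha>.\<close>

lemma ev_comp_assoc:
  assumes "path w us x" "path x vs y" "path y ts z"
  shows "(ev_comp x y vs us \<star> I1 (ev z ts)) \<odot> ev_comp y z ts (us @ vs) =
    \<alpha> (ev x us) (ev y vs) (ev z ts) \<odot> (I1 (ev x us) \<star> ev_comp y z ts vs) \<odot> ev_comp x z (vs @ ts) us"
  using assms(1)
proof (induction us arbitrary: w)
  note s = ev_simps[OF assms(2)] ev_simps[OF assms(3)] ev_comp_simps[OF assms(2,3)]
    ev_simps[OF path_append[OF assms(2,3)]]
  case Nil
  then have [simp]: "x \<in> C0" by auto
  show ?case
    using s lunitor_comp[of "ev y vs" "ev z ts", symmetric]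
      lunitor_nat[of "ev_comp y z ts vs", symmetric] by simp
next
  note s = ev_simps[OF assms(2)] ev_simps[OF assms(3)] ev_comp_simps[OF assms(2,3)]
    ev_simps[OF path_append[OF assms(2,3)]]
  case (Cons f us)
  then have f: "f \<in> C1" and us: "path (cd0 f) us x" by auto
  note s = s f ev_simps[OF us] ev_comp_simps[OF us assms(2)]
    ev_comp_simps[OF us path_append[OF assms(2,3)]]
    ev_simps[OF path_append[OF us assms(2)]] ev_simps[OF path_append[OF us path_append[OF assms(2,3)]]]
    ev_comp_simps[OF path_append[OF us assms(2)] assms(3)]
  let ?u = "ev x us" and ?v = "ev y vs" and ?t = "ev z ts" and ?uv = "ev y (us @ vs)"
  let ?m = "ev_comp x y vs us" and ?n = "ev_comp y z ts vs" and ?k = "ev_comp x z (vs @ ts) us"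
  let ?j = "ev_comp y z ts (us @ vs)"
  have "((\<alpha> f ?u ?v \<odot> (I1 f \<star> ?m)) \<star> I1 ?t) \<odot> \<alpha> f ?uv ?t \<odot> (I1 f \<star> ?j) =
      (\<alpha> f ?u ?v \<star> I1 ?t) \<odot> (((I1 f \<star> ?m) \<star> I1 ?t) \<odot> \<alpha> f ?uv ?t) \<odot> (I1 f \<star> ?j)"
    using s by (simp add: whisker_right)
  also have "((I1 f \<star> ?m) \<star> I1 ?t) \<odot> \<alpha> f ?uv ?t = \<alpha> f (?u \<otimes> ?v) ?t \<odot> (I1 f \<star> (?m \<star> I1 ?t))"
    using s assoc_nat[of "I1 f" ?m "I1 ?t"] by simp
  also have "(\<alpha> f ?u ?v \<star> I1 ?t) \<odot> (\<alpha> f (?u \<otimes> ?v) ?t \<odot> (I1 f \<star> (?m \<star> I1 ?t))) \<odot> (I1 f \<star> ?j) =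
      (\<alpha> f ?u ?v \<star> I1 ?t) \<odot> \<alpha> f (?u \<otimes> ?v) ?t \<odot> (I1 f \<star> ((?m \<star> I1 ?t) \<odot> ?j))"
    using s by (simp add: whisker_left)
  also have "(?m \<star> I1 ?t) \<odot> ?j = \<alpha> ?u ?v ?t \<odot> (I1 ?u \<star> ?n) \<odot> ?k"
    by (rule Cons.IH[OF us])
  also have "(\<alpha> f ?u ?v \<star> I1 ?t) \<odot> \<alpha> f (?u \<otimes> ?v) ?t \<odot> (I1 f \<star> (\<alpha> ?u ?v ?t \<odot> (I1 ?u \<star> ?n) \<odot> ?k)) =
      ((\<alpha> f ?u ?v \<star> I1 ?t) \<odot> \<alpha> f (?u \<otimes> ?v) ?t \<odot> (I1 f \<star> \<alpha> ?u ?v ?t)) \<odot>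
        (I1 f \<star> (I1 ?u \<star> ?n)) \<odot> (I1 f \<star> ?k)"
    using s by (simp add: whisker_left)
  \<comment> \<open>The three associators collected so far are the long side of a pentagon. Of the
    two that replace them, the first is the one required for the word \<open>f # us\<close>, and the
    second is moved past \<open>?n\<close> by naturality.\<close>
  also have "\<dots> = (\<alpha> (f \<otimes> ?u) ?v ?t \<odot> \<alpha> f ?u (?v \<otimes> ?t)) \<odot> (I1 f \<star> (I1 ?u \<star> ?n)) \<odot> (I1 f \<star> ?k)"
    using s pentagon'[of f ?u ?v ?t] by simp
  also have "\<dots> = \<alpha> (f \<otimes> ?u) ?v ?t \<odot> (\<alpha> f ?u (?v \<otimes> ?t) \<odot> (I1 f \<star> (I1 ?u \<star> ?n))) \<odot> (I1 f \<star> ?k)"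
    using s by simp
  also have "\<alpha> f ?u (?v \<otimes> ?t) \<odot> (I1 f \<star> (I1 ?u \<star> ?n)) =
      (I1 (f \<otimes> ?u) \<star> ?n) \<odot> \<alpha> f ?u (ev z (vs @ ts))"
    using s assoc_nat[of "I1 f" "I1 ?u" ?n] by simp
  finally show ?case
    using s by simp
qed

end


section \<open>Omega magmas without proper cells above dimension 2\<close>

text \<open>
  A 2-cell is a triple of its domain, its codomain and a label, encoded by \<open>pr\<close>; the cells above
  dimension 2 are the 2-cells themselves.
\<close>

locale two_dim =
  fixes ob :: "'u set" and arw :: "'w set" and src tgt :: "'w \<Rightarrow> 'u"
    and one :: "'u \<Rightarrow> 'w" and seq :: "'w \<Rightarrow> 'w \<Rightarrow> 'w"
    and hom :: "'w \<Rightarrow> 'w \<Rightarrow> 'u set" and vid :: "'w \<Rightarrow> 'u" and vc :: "'u \<Rightarrow> 'u \<Rightarrow> 'u"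
    and hc :: "'w \<Rightarrow> 'w \<Rightarrow> 'w \<Rightarrow> 'w \<Rightarrow> 'u \<Rightarrow> 'u \<Rightarrow> 'u"
    and c1 :: "'w \<Rightarrow> 'u" and pr :: "'u \<times> 'u \<Rightarrow> 'u"
  assumes src_ob [simp]: "u \<in> arw \<Longrightarrow> src u \<in> ob"
    and tgt_ob [simp]: "u \<in> arw \<Longrightarrow> tgt u \<in> ob"
    and one_arw [simp]: "x \<in> ob \<Longrightarrow> one x \<in> arw"
    and src_one [simp]: "x \<in> ob \<Longrightarrow> src (one x) = x"
    and tgt_one [simp]: "x \<in> ob \<Longrightarrow> tgt (one x) = x"
    and seq_arw [simp]: "\<lbrakk>u \<in> arw; v \<in> arw; tgt u = src v\<rbrakk> \<Longrightarrow> seq u v \<in> arw"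
    and src_seq [simp]: "\<lbrakk>u \<in> arw; v \<in> arw; tgt u = src v\<rbrakk> \<Longrightarrow> src (seq u v) = src u"
    and tgt_seq [simp]: "\<lbrakk>u \<in> arw; v \<in> arw; tgt u = src v\<rbrakk> \<Longrightarrow> tgt (seq u v) = tgt v"
    and hom_src: "\<lbrakk>u \<in> arw; v \<in> arw; t \<in> hom u v\<rbrakk> \<Longrightarrow> src v = src u"
    and hom_tgt: "\<lbrakk>u \<in> arw; v \<in> arw; t \<in> hom u v\<rbrakk> \<Longrightarrow> tgt v = tgt u"
    and vid_hom [simp]: "u \<in> arw \<Longrightarrow> vid u \<in> hom u u"
    and vc_hom [simp]: "\<lbrakk>u \<in> arw; v \<in> arw; w \<in> arw; s \<in> hom u v; t \<in> hom v w\<rbrakk> \<Longrightarrow> vc s t \<in> hom u w"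
    and hc_hom [simp]: "\<lbrakk>u \<in> arw; u' \<in> arw; v \<in> arw; v' \<in> arw; s \<in> hom u u'; t \<in> hom v v';
      tgt u = src v\<rbrakk> \<Longrightarrow> hc u u' v v' s t \<in> hom (seq u v) (seq u' v')"
    and inj_c1: "inj c1" and inj_pr: "inj pr"
begin

text \<open>The boundary is stored with the label because one label may occur in several
  \<open>hom u v\<close>, for instance between different words with equal values.\<close>

definition "c2 u v t = pr (c1 u, pr (c1 v, t))"
definition "d1 = inv c1"
definition "s2 y = d1 (fst (inv pr y))"
definition "t2 y = d1 (fst (inv pr (snd (inv pr y))))"
definition "l2 y = snd (inv pr (snd (inv pr y)))"

lemma decode [simp]:
  "d1 (c1 u) = u" "s2 (c2 u v t) = u" "t2 (c2 u v t) = v" "l2 (c2 u v t) = t"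
  using inj_c1 inj_pr by (simp_all add: d1_def s2_def t2_def l2_def c2_def)

lemma c1_eq [simp]: "c1 u = c1 v \<longleftrightarrow> u = v"
  using inj_c1 by (auto dest: injD)

lemma c2_eq [simp]: "c2 u v t = c2 u' v' t' \<longleftrightarrow> u = u' \<and> v = v' \<and> t = t'"
  by (simp add: c2_def inj_eq[OF inj_pr])

definition "tri = {c2 u v t | u v t. u \<in> arw \<and> v \<in> arw \<and> t \<in> hom u v}"

text \<open>For \<open>2 \<le> i\<close> composable cells coincide, so \<open>a\<close> can serve as
  their composite. The function \<open>hc\<close> receives all four boundary 1-cells because in the
  strictification the label of a horizontal composite depends on them.\<close>

definition magma :: "'u omega_magma" where
  "magma = \<lparr>
    cells = (\<lambda>n. if n = 0 then ob else if n = 1 then c1 ` arw else tri),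
    dm = (\<lambda>i y. if i = 0 then src (d1 y) else if i = 1 then c1 (s2 y) else y),
    cd = (\<lambda>i y. if i = 0 then tgt (d1 y) else if i = 1 then c1 (t2 y) else y),
    idc = (\<lambda>i y. if i = 0 then c1 (one y) else if i = 1 then c2 (d1 y) (d1 y) (vid (d1 y)) else y),
    cmp = (\<lambda>i j a b.
      if j = 1 then c1 (seq (d1 a) (d1 b))
      else if i = 0 then c2 (seq (s2 a) (s2 b)) (seq (t2 a) (t2 b))
        (hc (s2 a) (t2 a) (s2 b) (t2 b) (l2 a) (l2 b))
      else if i = 1 then c2 (s2 a) (t2 b) (vc (l2 a) (l2 b)) else a)\<rparr>"

lemma triE:
  assumes "y \<in> tri"
  obtains u v t where "y = c2 u v t" "u \<in> arw" "v \<in> arw" "t \<in> hom u v" "src v = src u" "tgt v = tgt u"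
  using assms hom_src hom_tgt unfolding tri_def by blast

lemma c2_tri [simp]: "c2 u v t \<in> tri \<longleftrightarrow> u \<in> arw \<and> v \<in> arw \<and> t \<in> hom u v"
  by (auto simp: tri_def)

lemma magma_cells:
  "cells magma 0 = ob" "cells magma 1 = c1 ` arw" "2 \<le> n \<Longrightarrow> cells magma n = tri"
  by (simp_all add: magma_def)

lemma magma_dm [simp]:
  "dm magma 0 (c1 u) = src u" "dm magma 1 (c2 u v t) = c1 u" "2 \<le> n \<Longrightarrow> dm magma n y = y"
  "cd magma 0 (c1 u) = tgt u" "cd magma 1 (c2 u v t) = c1 v" "2 \<le> n \<Longrightarrow> cd magma n y = y"
  by (simp_all add: magma_def)

lemma magma_idc [simp]:
  "idc magma 0 x = c1 (one x)" "idc magma 1 (c1 u) = c2 u u (vid u)"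
  "2 \<le> n \<Longrightarrow> idc magma n y = y"
  by (simp_all add: magma_def)

lemma magma_cmp [simp]:
  "cmp magma 0 1 (c1 u) (c1 v) = c1 (seq u v)"
  "2 \<le> n \<Longrightarrow> cmp magma 0 n (c2 u u' s) (c2 v v' t) = c2 (seq u v) (seq u' v') (hc u u' v v' s t)"
  "2 \<le> n \<Longrightarrow> cmp magma 1 n (c2 u u' s) (c2 v v' t) = c2 u v' (vc s t)"
  "2 \<le> m \<Longrightarrow> 2 \<le> n \<Longrightarrow> cmp magma m n a b = a"
  by (simp_all add: magma_def)

lemma magma_it [simp]:
  assumes "2 \<le> n"
  shows "dom_it magma 0 n y = src (s2 y)" "cod_it magma 0 n y = tgt (t2 y)"
    "dom_it magma 1 n y = c1 (s2 y)" "cod_it magma 1 n y = c1 (t2 y)"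
    "2 \<le> m \<Longrightarrow> dom_it magma m n y = y" "2 \<le> m \<Longrightarrow> cod_it magma m n y = y"
    "id_it magma 0 n x = c2 (one x) (one x) (vid (one x))" "id_it magma 1 n (c1 u) = c2 u u (vid u)"
    "2 \<le> m \<Longrightarrow> id_it magma m n y = y"
proof -
  show "dom_it magma 0 n y = src (s2 y)" "cod_it magma 0 n y = tgt (t2 y)"
    "dom_it magma 1 n y = c1 (s2 y)" "cod_it magma 1 n y = c1 (t2 y)"
    using assms by (induction n rule: dec_induct) (simp_all, simp_all add: magma_def)
  show "id_it magma 0 n x = c2 (one x) (one x) (vid (one x))" "id_it magma 1 n (c1 u) = c2 u u (vid u)"
    using assms by (induction n rule: dec_induct) simp_all
  show "dom_it magma m n y = y" "cod_it magma m n y = y" "id_it magma m n y = y" if "2 \<le> m"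
    using that by (induction n) auto
qed

lemma composable_magma:
  "composable magma 0 1 a b \<longleftrightarrow> (\<exists>u v. a = c1 u \<and> b = c1 v \<and> u \<in> arw \<and> v \<in> arw \<and> tgt u = src v)"
  "2 \<le> n \<Longrightarrow> composable magma 0 n a b \<longleftrightarrow> a \<in> tri \<and> b \<in> tri \<and> tgt (t2 a) = src (s2 b)"
  "2 \<le> n \<Longrightarrow> composable magma 1 n a b \<longleftrightarrow> a \<in> tri \<and> b \<in> tri \<and> t2 a = s2 b"
  "2 \<le> m \<Longrightarrow> 2 \<le> n \<Longrightarrow> composable magma m n a b \<longleftrightarrow> m < n \<and> a \<in> tri \<and> a = b"
  by (auto simp: composable_def magma_cells)

lemma nat_cases_012:
  obtains "i = 0" | "i = 1" | "2 \<le> (i :: nat)"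
  by linarith

lemma composable_magmaE:
  assumes "composable magma i j a b"
  obtains (ar) u v where "i = 0" "j = 1" "a = c1 u" "b = c1 v" "u \<in> arw" "v \<in> arw" "tgt u = src v"
  | (h) u u' s v v' t where "i = 0" "2 \<le> j" "a = c2 u u' s" "b = c2 v v' t"
      "u \<in> arw" "u' \<in> arw" "v \<in> arw" "v' \<in> arw" "s \<in> hom u u'" "t \<in> hom v v'"
      "src u' = src u" "tgt u' = tgt u" "src v' = src v" "tgt v' = tgt v" "tgt u = src v"
  | (v) u v w s t where "i = 1" "2 \<le> j" "a = c2 u v s" "b = c2 v w t"
      "u \<in> arw" "v \<in> arw" "w \<in> arw" "s \<in> hom u v" "t \<in> hom v w"
      "src v = src u" "tgt v = tgt u" "src w = src u" "tgt w = tgt u"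
  | (d) "2 \<le> i" "i < j" "a \<in> tri" "b = a"
proof -
  have ij: "i < j" using assms by (simp add: composable_def)
  show ?thesis
  proof (cases j rule: nat_cases_012)
    case 1
    then show ?thesis using ij by simp
  next
    case 2
    with ij have "i = 0" by simp
    then show ?thesis using assms 2 ar by (auto simp: composable_magma)
  next
    case j: 3
    show ?thesis
    proof (cases i rule: nat_cases_012)
      case 1
      then have ab: "a \<in> tri" "b \<in> tri" "tgt (t2 a) = src (s2 b)"
        using assms j by (auto simp: composable_magma)
      from ab(1) obtain u u' s where a: "a = c2 u u' s" "u \<in> arw" "u' \<in> arw" "s \<in> hom u u'"
        "src u' = src u" "tgt u' = tgt u" by (rule triE)
      from ab(2) obtain v v' t where b: "b = c2 v v' t" "v \<in> arw" "v' \<in> arw" "t \<in> hom v v'"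
        "src v' = src v" "tgt v' = tgt v" by (rule triE)
      show ?thesis using h[OF 1 j a(1) b(1)] a b ab(3) by simp
    next
      case 2
      then have ab: "a \<in> tri" "b \<in> tri" "t2 a = s2 b"
        using assms j by (auto simp: composable_magma)
      from ab(1) obtain u u' s where a: "a = c2 u u' s" "u \<in> arw" "u' \<in> arw" "s \<in> hom u u'"
        "src u' = src u" "tgt u' = tgt u" by (rule triE)
      from ab(2) obtain v v' t where b: "b = c2 v v' t" "v \<in> arw" "v' \<in> arw" "t \<in> hom v v'"
        "src v' = src v" "tgt v' = tgt v" by (rule triE)
      have "u' = v" using ab(3) a b by simp
      with b have "b = c2 u' v' t" "t \<in> hom u' v'" "src v' = src u'" "tgt v' = tgt u'" by simp_all
      then show ?thesis
        by - (rule v[OF 2 j a(1) _ a(2,3) b(3) a(4)]; simp add: a(5,6))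
    next
      case 3
      have "i < j \<and> a \<in> tri \<and> a = b"
        using assms composable_magma(4)[OF 3 j] by blast
      then have "i < j" "a \<in> tri" "b = a" by blast+
      then show ?thesis by (rule d[OF 3])
    qed
  qed
qed

lemma magma_cellsE:
  assumes "x \<in> cells magma (Suc i)"
  obtains u where "i = 0" "x = c1 u" "u \<in> arw"
  | u v t where "1 \<le> i" "x = c2 u v t" "u \<in> arw" "v \<in> arw" "t \<in> hom u v" "src v = src u"
    "tgt v = tgt u"
proof (cases "i = 0")
  case True
  then show ?thesis using assms that(1) by (auto simp: magma_cells)
next
  case False
  then have "x \<in> tri" using assms by (simp add: magma_cells)
  then show ?thesis using that(2) False by (elim triE) auto
qed

lemma omega_magma_magma: "omega_magma magma"
proof
  fix x i assume x: "x \<in> cells magma (Suc i)"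
  then show "dm magma i x \<in> cells magma i" "cd magma i x \<in> cells magma i"
    by (cases rule: magma_cellsE; cases i rule: nat_cases_012; simp add: magma_cells)+
next
  fix x i assume x: "x \<in> cells magma (Suc (Suc i))"
  then show "dm magma i (dm magma (Suc i) x) = dm magma i (cd magma (Suc i) x)"
    "cd magma i (dm magma (Suc i) x) = cd magma i (cd magma (Suc i) x)"
    by (cases rule: magma_cellsE; cases "i = 0"; simp)+
next
  fix x i assume x: "x \<in> cells magma i"
  then show "idc magma i x \<in> cells magma (Suc i)" "dm magma i (idc magma i x) = x"
    "cd magma i (idc magma i x) = x"
    by (cases i rule: nat_cases_012; auto simp: magma_cells)+
next
  fix i j a b assume "composable magma i j a b"
  then show "cmp magma i j a b \<in> cells magma j"
    by (cases rule: composable_magmaE) (simp_all add: magma_cells)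
next
  fix i a b assume "composable magma i (Suc i) a b"
  then show "dm magma i (cmp magma i (Suc i) a b) = dm magma i a"
    "cd magma i (cmp magma i (Suc i) a b) = cd magma i b"
    by (cases rule: composable_magmaE; simp)+
next
  fix i j a b assume "i < j" and c: "composable magma i (Suc j) a b"
  from c show "dm magma j (cmp magma i (Suc j) a b) = cmp magma i j (dm magma j a) (dm magma j b)"
    "cd magma j (cmp magma i (Suc j) a b) = cmp magma i j (cd magma j a) (cd magma j b)"
    using \<open>i < j\<close> by (cases rule: composable_magmaE; cases j rule: nat_cases_012; simp)+
qed

lemma skeletal_magma: "skeletal 2 magma"
  unfolding skeletal_def
proof (intro allI impI ballI)
  fix m x assume "2 \<le> m" "x \<in> cells magma (Suc m)"
  then show "\<exists>y\<in>cells magma m. x = idc magma m y"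
    by (cases m rule: nat_cases_012) (auto simp: magma_cells)
qed

text \<open>Composition along dimensions 0 and 1 follows the same formula in all dimensions from 2
  on, and composition along a higher dimension concerns equal cells only. The axioms thus reduce to
  laws for 1-cells and labels.\<close>

lemma strict_omega_category_magma:
  assumes seq_assoc: "\<And>u v w. \<lbrakk>u \<in> arw; v \<in> arw; w \<in> arw; tgt u = src v; tgt v = src w\<rbrakk> \<Longrightarrow>
      seq (seq u v) w = seq u (seq v w)"
    and seq_one: "\<And>u. u \<in> arw \<Longrightarrow> seq (one (src u)) u = u" "\<And>u. u \<in> arw \<Longrightarrow> seq u (one (tgt u)) = u"
    and vc_assoc: "\<And>u v w z s t r. \<lbrakk>u \<in> arw; v \<in> arw; w \<in> arw; z \<in> arw;
        s \<in> hom u v; t \<in> hom v w; r \<in> hom w z\<rbrakk> \<Longrightarrow> vc (vc s t) r = vc s (vc t r)"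
    and vc_vid: "\<And>u v s. \<lbrakk>u \<in> arw; v \<in> arw; s \<in> hom u v\<rbrakk> \<Longrightarrow> vc (vid u) s = s"
      "\<And>u v s. \<lbrakk>u \<in> arw; v \<in> arw; s \<in> hom u v\<rbrakk> \<Longrightarrow> vc s (vid v) = s"
    and hc_assoc: "\<And>u u' v v' w w' s t r. \<lbrakk>u \<in> arw; u' \<in> arw; v \<in> arw; v' \<in> arw; w \<in> arw; w' \<in> arw;
        s \<in> hom u u'; t \<in> hom v v'; r \<in> hom w w'; tgt u = src v; tgt v = src w\<rbrakk> \<Longrightarrow>
      hc (seq u v) (seq u' v') w w' (hc u u' v v' s t) r =
      hc u u' (seq v w) (seq v' w') s (hc v v' w w' t r)"
    and hc_one: "\<And>u u' s. \<lbrakk>u \<in> arw; u' \<in> arw; s \<in> hom u u'\<rbrakk> \<Longrightarrow>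
        hc (one (src u)) (one (src u)) u u' (vid (one (src u))) s = s"
      "\<And>u u' s. \<lbrakk>u \<in> arw; u' \<in> arw; s \<in> hom u u'\<rbrakk> \<Longrightarrow>
        hc u u' (one (tgt u)) (one (tgt u)) s (vid (one (tgt u))) = s"
    and hc_vid: "\<And>u v. \<lbrakk>u \<in> arw; v \<in> arw; tgt u = src v\<rbrakk> \<Longrightarrow> hc u u v v (vid u) (vid v) = vid (seq u v)"
    and hc_vc: "\<And>u u' u'' v v' v'' s s' t t'. \<lbrakk>u \<in> arw; u' \<in> arw; u'' \<in> arw; v \<in> arw; v' \<in> arw; v'' \<in> arw;
        s \<in> hom u u'; s' \<in> hom u' u''; t \<in> hom v v'; t' \<in> hom v' v''; tgt u = src v\<rbrakk> \<Longrightarrow>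
      hc u u'' v v'' (vc s s') (vc t t') = vc (hc u u' v v' s t) (hc u' u'' v' v'' s' t')"
  shows "strict_omega_category magma"
proof -
  interpret omega_magma magma by (rule omega_magma_magma)
  show ?thesis
  proof
    fix i j a b c assume "composable magma i j a b" "composable magma i j b c"
    then show "cmp magma i j (cmp magma i j a b) c = cmp magma i j a (cmp magma i j b c)"
      by (elim composable_magmaE) (auto simp: seq_assoc vc_assoc hc_assoc)
  next
    fix i j k a b c d
    assume "i < j" "j < k" and c: "composable magma j k a b" "composable magma j k c d"
      "composable magma i k a c" "composable magma i k b d"
    from \<open>i < j\<close> \<open>j < k\<close> have k: "2 \<le> k" by simp
    show "cmp magma i k (cmp magma j k a b) (cmp magma j k c d) =
        cmp magma j k (cmp magma i k a c) (cmp magma i k b d)"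
    proof (cases "j = 1")
      case True
      then have "i = 0" using \<open>i < j\<close> by simp
      from c(1) obtain u u' u'' s s' where ab: "a = c2 u u' s" "b = c2 u' u'' s'"
        "u \<in> arw" "u' \<in> arw" "u'' \<in> arw" "s \<in> hom u u'" "s' \<in> hom u' u''"
        by (rule composable_magmaE) (simp_all add: True k)
      from c(2) obtain v v' v'' t t' where cd: "c = c2 v v' t" "d = c2 v' v'' t'"
        "v \<in> arw" "v' \<in> arw" "v'' \<in> arw" "t \<in> hom v v'" "t' \<in> hom v' v''"
        by (rule composable_magmaE) (simp_all add: True k)
      have "tgt u = src v"
        using c(3) hom_tgt ab cd by (simp add: \<open>i = 0\<close> k composable_magma)
      then show ?thesis
        using ab cd by (simp add: \<open>i = 0\<close> True k hc_vc)
    next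
      case False
      then have j: "2 \<le> j" using \<open>i < j\<close> by simp
      then have "a = b" "c = d"
        using c by (auto simp: composable_magma k)
      then show ?thesis
        by (simp add: j k)
    qed
  next
    fix i j a assume ij: "i < j" and a: "a \<in> cells magma j"
    show "cmp magma i j (id_it magma i j (dom_it magma i j a)) a = a"
      "cmp magma i j a (id_it magma i j (cod_it magma i j a)) = a"
    proof (atomize (full), cases "2 \<le> j")
      case True
      then obtain u v t where "a = c2 u v t" "u \<in> arw" "v \<in> arw" "t \<in> hom u v" "src v = src u"
        "tgt v = tgt u"
        using a by (auto simp: magma_cells elim: triE)
      then show "cmp magma i j (id_it magma i j (dom_it magma i j a)) a = a \<and>
          cmp magma i j a (id_it magma i j (cod_it magma i j a)) = a"
        using True ij seq_one[of v] by (cases i rule: nat_cases_012) (simp_all add: seq_one vc_vid hc_one)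
    next
      case False
      then have "i = 0" "j = 1" using ij by auto
      then show "cmp magma i j (id_it magma i j (dom_it magma i j a)) a = a \<and>
          cmp magma i j a (id_it magma i j (cod_it magma i j a)) = a"
        using a by (auto simp: magma_cells seq_one)
    qed
  next
    fix i j a b assume "composable magma i j a b"
    then show "cmp magma i (Suc j) (idc magma j a) (idc magma j b) = idc magma j (cmp magma i j a b)"
      by (cases rule: composable_magmaE) (auto simp: hc_vid)
  qed
qed

end


section \<open>The strictification of a bicategory\<close>

locale encoded_bicategory = bicategory Y
  for Y :: "('a, 'm) bicat_scheme" +
  fixes pr :: "'a \<times> 'a \<Rightarrow> 'a" and ls :: "'a list \<Rightarrow> 'a"
  assumes inj_pr: "inj pr" and inj_ls: "inj ls"
begin

type_synonym (in -) 'b word = "'b \<times> 'b list \<times> 'b"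

text \<open>The end objects are part of a word because the empty list does not determine
  them.\<close>

definition words :: "'a word set" where "words = {(x, us, y). path x us y}"
definition wsrc :: "'a word \<Rightarrow> 'a" where "wsrc u = fst u"
definition wtgt :: "'a word \<Rightarrow> 'a" where "wtgt u = snd (snd u)"
definition wone :: "'a \<Rightarrow> 'a word" where "wone x = (x, [], x)"
definition wseq :: "'a word \<Rightarrow> 'a word \<Rightarrow> 'a word" where
  "wseq u v = (wsrc u, fst (snd u) @ fst (snd v), wtgt v)"
definition val :: "'a word \<Rightarrow> 'a" where "val u = ev (wtgt u) (fst (snd u))"
definition wcode :: "'a word \<Rightarrow> 'a" where "wcode u = pr (wsrc u, pr (ls (fst (snd u)), wtgt u))"

text \<open>The structure isomorphisms of evaluation, seen as a pseudofunctor from words to the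
  bicategory.\<close>

definition \<mu> :: "'a word \<Rightarrow> 'a word \<Rightarrow> 'a" where
  "\<mu> u v = ev_comp (wtgt u) (wtgt v) (fst (snd v)) (fst (snd u))"

lemma inj_wcode: "inj wcode"
  by (rule injI)
    (simp add: wcode_def wsrc_def wtgt_def inj_eq[OF inj_pr] inj_eq[OF inj_ls] prod_eq_iff)

lemma words_simps [simp]:
  assumes "u \<in> words"
  shows "wsrc u \<in> C0" "wtgt u \<in> C0" "val u \<in> C1" "dm0 (val u) = wsrc u" "cd0 (val u) = wtgt u"
  using assms path_ends ev_simps by (auto simp: words_def wsrc_def wtgt_def val_def)

lemma wone_simps [simp]:
  assumes "x \<in> C0"
  shows "wone x \<in> words" "wsrc (wone x) = x" "wtgt (wone x) = x" "val (wone x) = I0 x"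
  using assms by (auto simp: words_def wsrc_def wtgt_def val_def wone_def)

lemma wseq_simps [simp]:
  assumes "u \<in> words" "v \<in> words" "wtgt u = wsrc v"
  shows "wseq u v \<in> words" "wsrc (wseq u v) = wsrc u" "wtgt (wseq u v) = wtgt v"
  using assms by (auto simp: words_def wsrc_def wtgt_def wseq_def intro: path_append)

lemma wseq_assoc: "wseq (wseq u v) w = wseq u (wseq v w)"
  by (simp add: wseq_def wsrc_def wtgt_def)

lemma wseq_wone:
  "u \<in> words \<Longrightarrow> wseq (wone (wsrc u)) u = u" "u \<in> words \<Longrightarrow> wseq u (wone (wtgt u)) = u"
  by (auto simp: wseq_def wone_def wsrc_def wtgt_def words_def)

lemma \<mu>_simps [simp]:
  assumes "u \<in> words" "v \<in> words" "wtgt u = wsrc v"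
  shows "iso (\<mu> u v)" "dm1 (\<mu> u v) = val u \<otimes> val v" "cd1 (\<mu> u v) = val (wseq u v)"
  using assms ev_comp_simps
  by (auto simp: words_def wsrc_def wtgt_def wseq_def \<mu>_def val_def)

lemma \<mu>_one:
  assumes "u \<in> words"
  shows "\<mu> (wone (wsrc u)) u = \<l> (val u)" "\<mu> u (wone (wtgt u)) = \<r> (val u)"
  using assms ev_comp_Nil_right by (auto simp: words_def wsrc_def wtgt_def wone_def \<mu>_def val_def)

lemma \<mu>_assoc:
  assumes "u \<in> words" "v \<in> words" "w \<in> words" "wtgt u = wsrc v" "wtgt v = wsrc w"
  shows "(\<mu> u v \<star> I1 (val w)) \<odot> \<mu> (wseq u v) w =
    \<alpha> (val u) (val v) (val w) \<odot> (I1 (val u) \<star> \<mu> v w) \<odot> \<mu> u (wseq v w)"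
  using assms ev_comp_assoc
  by (auto simp: words_def wsrc_def wtgt_def wseq_def \<mu>_def val_def)

definition whom :: "'a word \<Rightarrow> 'a word \<Rightarrow> 'a set" where
  "whom u v = {a \<in> C2. dm1 a = val u \<and> cd1 a = val v}"

text \<open>Horizontal composition transported along \<mu>, which makes \<mu> natural by
  construction; see \<open>\<mu>_whc\<close>.\<close>

definition whc :: "'a word \<Rightarrow> 'a word \<Rightarrow> 'a word \<Rightarrow> 'a word \<Rightarrow> 'a \<Rightarrow> 'a \<Rightarrow> 'a" where
  "whc u u' v v' s t = inv2 (\<mu> u v) \<odot> (s \<star> t) \<odot> \<mu> u' v'"

lemma whomD:
  assumes "a \<in> whom u v" shows "a \<in> C2" "dm1 a = val u" "cd1 a = val v"
  using assms by (auto simp: whom_def)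

lemma whom_src: "\<lbrakk>u \<in> words; v \<in> words; a \<in> whom u v\<rbrakk> \<Longrightarrow> wsrc v = wsrc u"
  using cell_simps(3)[of a] whomD[of a u v] by simp

lemma whom_tgt: "\<lbrakk>u \<in> words; v \<in> words; a \<in> whom u v\<rbrakk> \<Longrightarrow> wtgt v = wtgt u"
  using cell_simps(4)[of a] whomD[of a u v] by simp

lemma whom_match:
  "\<lbrakk>u \<in> words; u' \<in> words; v \<in> words; v' \<in> words; s \<in> whom u u'; t \<in> whom v v'; wtgt u = wsrc v\<rbrakk> \<Longrightarrow>
    wtgt u' = wsrc v'"
  by (simp add: whom_src whom_tgt)

lemma whc_hom:
  assumes "u \<in> words" "u' \<in> words" "v \<in> words" "v' \<in> words" "s \<in> whom u u'" "t \<in> whom v v'"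
    "wtgt u = wsrc v"
  shows "whc u u' v v' s t \<in> whom (wseq u v) (wseq u' v')"
proof -
  have "wtgt u' = wsrc v'" by (rule whom_match) fact+
  then show ?thesis using assms whomD[OF assms(5)] whomD[OF assms(6)]
    by (simp add: whc_def whom_def)
qed

sublocale st: two_dim C0 words wsrc wtgt wone wseq whom "\<lambda>u. I1 (val u)" v_comp whc wcode pr
proof
  fix u v t assume "u \<in> words" "v \<in> words" "t \<in> whom u v"
  then show "wsrc v = wsrc u" "wtgt v = wtgt u"
    using whom_src whom_tgt by blast+
next
  fix u v w s t assume "s \<in> whom u v" "t \<in> whom v w"
  then show "s \<odot> t \<in> whom u w" by (auto simp: whom_def)
qed (simp_all add: whc_hom inj_wcode inj_pr, simp_all add: whom_def)

lemma \<mu>_whc: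
  assumes "u \<in> words" "u' \<in> words" "v \<in> words" "v' \<in> words" "s \<in> whom u u'" "t \<in> whom v v'"
    "wtgt u = wsrc v"
  shows "\<mu> u v \<odot> whc u u' v v' s t = (s \<star> t) \<odot> \<mu> u' v'"
proof -
  have "wtgt u' = wsrc v'" by (rule whom_match) fact+
  then show ?thesis using assms whomD[OF assms(5)] whomD[OF assms(6)]
    by (simp add: whc_def)
qed

text \<open>Both sides are precomposed with an invertible 2-cell from the bracketed product of the
  three values to the value of the concatenated word. Naturality of \<mu> moves it across the two
  composites, \<open>\<mu>_assoc\<close> is applied at the domain and the codomain words, and
  naturality of \<alpha> connects the two bracketings.\<close>

lemma whc_assoc:
  assumes u: "u \<in> words" "u' \<in> words" and v: "v \<in> words" "v' \<in> words" and w: "w \<in> words" "w' \<in> words"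
    and s: "s \<in> whom u u'" and t: "t \<in> whom v v'" and r: "r \<in> whom w w'"
    and uv: "wtgt u = wsrc v" and vw: "wtgt v = wsrc w"
  shows "whc (wseq u v) (wseq u' v') w w' (whc u u' v v' s t) r =
    whc u u' (wseq v w) (wseq v' w') s (whc v v' w w' t r)"
proof -
  note p = u v w uv vw whomD[OF s] whomD[OF t] whomD[OF r]
  have uv': "wtgt u' = wsrc v'" by (rule whom_match) fact+
  have vw': "wtgt v' = wsrc w'" by (rule whom_match) fact+
  have st: "whc u u' v v' s t \<in> whom (wseq u v) (wseq u' v')"
    using whc_hom u v s t uv by blast
  have tr: "whc v v' w w' t r \<in> whom (wseq v w) (wseq v' w')"
    using whc_hom v w t r vw by blast
  have L: "whc (wseq u v) (wseq u' v') w w' (whc u u' v v' s t) r \<in>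
      whom (wseq (wseq u v) w) (wseq (wseq u' v') w')"
    by (rule whc_hom) (use st r p uv' vw' in simp_all)
  have R: "whc u u' (wseq v w) (wseq v' w') s (whc v v' w w' t r) \<in>
      whom (wseq u (wseq v w)) (wseq u' (wseq v' w'))"
    by (rule whc_hom) (use tr s p uv' vw' in simp_all)
  note p = p uv' vw' whomD[OF st] whomD[OF tr] whomD[OF L] whomD[OF R]
  let ?L = "whc (wseq u v) (wseq u' v') w w' (whc u u' v v' s t) r"
  let ?R = "whc u u' (wseq v w) (wseq v' w') s (whc v v' w w' t r)"
  let ?A = "\<alpha> (val u) (val v) (val w)"
  let ?A' = "\<alpha> (val u') (val v') (val w')"
  let ?D = "(I1 (val u) \<star> \<mu> v w) \<odot> \<mu> u (wseq v w)"
  let ?D' = "(I1 (val u') \<star> \<mu> v' w') \<odot> \<mu> u' (wseq v' w')"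
  have "?A \<odot> ?D \<odot> ?L = ((\<mu> u v \<star> I1 (val w)) \<odot> \<mu> (wseq u v) w) \<odot> ?L"
    using p \<mu>_assoc[of u v w] by (simp add: wseq_assoc)
  also have "\<dots> = (\<mu> u v \<star> I1 (val w)) \<odot> \<mu> (wseq u v) w \<odot> ?L"
    using p by (simp add: wseq_assoc)
  also have "\<mu> (wseq u v) w \<odot> ?L = (whc u u' v v' s t \<star> r) \<odot> \<mu> (wseq u' v') w'"
    by (rule \<mu>_whc) (use p st r in simp_all)
  also have "(\<mu> u v \<star> I1 (val w)) \<odot> (whc u u' v v' s t \<star> r) \<odot> \<mu> (wseq u' v') w' =
      ((\<mu> u v \<odot> whc u u' v v' s t) \<star> (I1 (val w) \<odot> r)) \<odot> \<mu> (wseq u' v') w'"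
    using p by (simp add: interchange del: v_unit)
  also have "\<mu> u v \<odot> whc u u' v v' s t = (s \<star> t) \<odot> \<mu> u' v'"
    by (rule \<mu>_whc) (use p s t in simp_all)
  \<comment> \<open>The identity is moved to the other side of \<open>r\<close>, so that interchange
    can split off \<open>\<mu> u' v'\<close> whiskered by the value of \<open>w'\<close>.\<close>
  also have "(((s \<star> t) \<odot> \<mu> u' v') \<star> (I1 (val w) \<odot> r)) \<odot> \<mu> (wseq u' v') w' =
      (((s \<star> t) \<odot> \<mu> u' v') \<star> (r \<odot> I1 (val w'))) \<odot> \<mu> (wseq u' v') w'"
    using p by simp
  also have "\<dots> = ((s \<star> t) \<star> r) \<odot> (\<mu> u' v' \<star> I1 (val w')) \<odot> \<mu> (wseq u' v') w'"
    using p by (simp add: interchange del: v_unit)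
  also have "\<dots> = ((s \<star> t) \<star> r) \<odot> ?A' \<odot> ?D'"
    using p by (simp add: \<mu>_assoc)
  also have "\<dots> = (((s \<star> t) \<star> r) \<odot> ?A') \<odot> ?D'"
    using p by simp
  also have "\<dots> = (?A \<odot> (s \<star> t \<star> r)) \<odot> ?D'"
    using p assoc_nat[of s t r] by simp
  also have "\<dots> = ?A \<odot> ((s \<odot> I1 (val u')) \<star> ((t \<star> r) \<odot> \<mu> v' w')) \<odot> \<mu> u' (wseq v' w')"
    using p by (simp add: interchange del: v_unit)
  also have "(t \<star> r) \<odot> \<mu> v' w' = \<mu> v w \<odot> whc v v' w w' t r"
    by (rule \<mu>_whc[symmetric]) (use p t r in simp_all)
  also have "?A \<odot> ((s \<odot> I1 (val u')) \<star> (\<mu> v w \<odot> whc v v' w w' t r)) \<odot> \<mu> u' (wseq v' w') =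
     ?A \<odot> ((I1 (val u) \<odot> s) \<star> (\<mu> v w \<odot> whc v v' w w' t r)) \<odot> \<mu> u' (wseq v' w')"
    using p by simp
  also have "\<dots> = ?A \<odot> (I1 (val u) \<star> \<mu> v w) \<odot> (s \<star> whc v v' w w' t r) \<odot> \<mu> u' (wseq v' w')"
    using p by (simp add: interchange del: v_unit)
  also have "(s \<star> whc v v' w w' t r) \<odot> \<mu> u' (wseq v' w') = \<mu> u (wseq v w) \<odot> ?R"
    by (rule \<mu>_whc[symmetric]) (use p s tr in simp_all)
  finally have "(?A \<odot> ?D) \<odot> ?L = (?A \<odot> ?D) \<odot> ?R"
    using p by (simp add: wseq_assoc)
  then show ?thesis
    by (rule cancel_left[rotated -1]) (use p in \<open>simp_all add: wseq_assoc\<close>)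
qed

text \<open>With an empty word \<mu> is a unitor, so the unit laws are naturality of the unitors. In
  the interchange law the inner \<open>\<mu> u' v'\<close> cancels against its inverse.\<close>

lemma strict_omega_category_strictification: "strict_omega_category st.magma"
proof (rule st.strict_omega_category_magma)
  fix u u' s assume p: "u \<in> words" "u' \<in> words" "s \<in> whom u u'"
  note q = p(1,2) whomD[OF p(3)]
  have t: "wsrc u' = wsrc u" "wtgt u' = wtgt u" using p whom_src whom_tgt by auto
  show "whc (wone (wsrc u)) (wone (wsrc u)) u u' (I1 (val (wone (wsrc u)))) s = s"
    using q t lunitor_nat[of s] \<mu>_one(1)[of u] \<mu>_one(1)[of u'] by (simp add: whc_def)
  show "whc u u' (wone (wtgt u)) (wone (wtgt u)) s (I1 (val (wone (wtgt u)))) = s"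
    using q t runitor_nat[of s] \<mu>_one(2)[of u] \<mu>_one(2)[of u'] by (simp add: whc_def)
next
  fix u v assume "u \<in> words" "v \<in> words" "wtgt u = wsrc v"
  then show "whc u u v v (I1 (val u)) (I1 (val v)) = I1 (val (wseq u v))"
    by (simp add: whc_def)
next
  fix u u' u'' v v' v'' s s' t t'
  assume p: "u \<in> words" "u' \<in> words" "u'' \<in> words" "v \<in> words" "v' \<in> words" "v'' \<in> words"
    "wtgt u = wsrc v" and s: "s \<in> whom u u'" "s' \<in> whom u' u''"
    and t: "t \<in> whom v v'" "t' \<in> whom v' v''"
  have "wtgt u' = wsrc v'" "wtgt u'' = wsrc v''"
    using p s t by (simp_all add: whom_src whom_tgt)
  note p = p this whomD[OF s(1)] whomD[OF s(2)] whomD[OF t(1)] whomD[OF t(2)]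
  show "whc u u'' v v'' (s \<odot> s') (t \<odot> t') = whc u u' v v' s t \<odot> whc u' u'' v' v'' s' t'"
    using p by (simp add: whc_def interchange)
qed (simp_all add: wseq_assoc wseq_wone whc_assoc whom_def)


end


section \<open>Coherent isomorphisms to words\<close>

text \<open>The class \<open>J\<close> is kept abstract so that the construction of marks uses
  nothing but its closure properties. It must contain the coherence data and be closed under
  composition, because the marks of composite 1-cells are built from these.\<close>

locale coherent_class = encoded_bicategory Y pr ls
  for Y :: "('a, 'm) bicat_scheme" and pr :: "'a \<times> 'a \<Rightarrow> 'a" and ls :: "'a list \<Rightarrow> 'a" +
  fixes J :: "'a set"
  assumes J_iso [simp]: "c \<in> J \<Longrightarrow> iso c"
    and J_I1 [simp]: "f \<in> C1 \<Longrightarrow> I1 f \<in> J"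
    and J_v [simp]: "\<lbrakk>c \<in> J; d \<in> J; cd1 c = dm1 d\<rbrakk> \<Longrightarrow> c \<odot> d \<in> J"
    and J_h [simp]: "\<lbrakk>c \<in> J; d \<in> J; cd0 (dm1 c) = dm0 (dm1 d)\<rbrakk> \<Longrightarrow> c \<star> d \<in> J"
    and J_inv2 [simp]: "c \<in> J \<Longrightarrow> inv2 c \<in> J"
    and J_assoc [simp]: "\<lbrakk>f \<in> C1; g \<in> C1; h \<in> C1; cd0 f = dm0 g; cd0 g = dm0 h\<rbrakk> \<Longrightarrow> \<alpha> f g h \<in> J"
    and J_lunitor [simp]: "f \<in> C1 \<Longrightarrow> \<l> f \<in> J"
    and J_runitor [simp]: "f \<in> C1 \<Longrightarrow> \<r> f \<in> J"
begin

lemma ev_comp_J: "path x us y \<Longrightarrow> path y vs z \<Longrightarrow> ev_comp y z vs us \<in> J"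
proof (induction us arbitrary: x)
  case Nil
  then show ?case using ev_simps by simp
next
  case (Cons f us)
  then have f: "f \<in> C1" "path (cd0 f) us y" by auto
  show ?case
    using f Cons.IH[OF f(2) Cons.prems(2)] ev_simps[OF f(2)] ev_simps[OF Cons.prems(2)]
      ev_comp_simps[OF f(2) Cons.prems(2)] by simp
qed

lemma \<mu>_J [simp]: "\<lbrakk>u \<in> words; v \<in> words; wtgt u = wsrc v\<rbrakk> \<Longrightarrow> \<mu> u v \<in> J"
  using ev_comp_J by (auto simp: words_def wsrc_def wtgt_def \<mu>_def)

text \<open>
  The 1-cells of the bicategory \<open>marked\<close> are 1-cells \<open>p\<close> of \<open>Y\<close> together with a word \<open>u\<close> and an
  isomorphism \<open>p \<rightarrow> val u\<close> in \<open>J\<close>; as \<open>p\<close> is the domain of the isomorphism, it is not recorded.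
\<close>

definition marks :: "('a word \<times> 'a) set" where
  "marks = {(u, c). u \<in> words \<and> c \<in> J \<and> cd1 c = val u}"
definition msrc :: "'a word \<times> 'a \<Rightarrow> 'a" where "msrc e = wsrc (fst e)"
definition mtgt :: "'a word \<times> 'a \<Rightarrow> 'a" where "mtgt e = wtgt (fst e)"
definition und :: "'a word \<times> 'a \<Rightarrow> 'a" where "und e = dm1 (snd e)"
definition mone :: "'a \<Rightarrow> 'a word \<times> 'a" where "mone x = (wone x, I1 (I0 x))"
definition mseq :: "'a word \<times> 'a \<Rightarrow> 'a word \<times> 'a \<Rightarrow> 'a word \<times> 'a" where
  "mseq e f = (wseq (fst e) (fst f), (snd e \<star> snd f) \<odot> \<mu> (fst e) (fst f))"
text \<open>The condition involves underlying 1-cells only, so for fixed marks a 2-cell is the same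
  as its label. The axioms of the marked bicategory thereby reduce to those of \<open>Y\<close>,
  with marks carried along on the boundary.\<close>

definition mhom :: "'a word \<times> 'a \<Rightarrow> 'a word \<times> 'a \<Rightarrow> 'a set" where
  "mhom e f = {a \<in> C2. dm1 a = und e \<and> cd1 a = und f}"
definition mcode :: "'a word \<times> 'a \<Rightarrow> 'a" where "mcode e = pr (wcode (fst e), snd e)"

lemma inj_mcode: "inj mcode"
  by (rule injI) (simp add: mcode_def inj_eq[OF inj_pr] inj_eq[OF inj_wcode] prod_eq_iff)

lemma marksD:
  assumes "e \<in> marks"
  shows "fst e \<in> words" "snd e \<in> J" "snd e \<in> C2" "iso (snd e)" "cd1 (snd e) = val (fst e)"
    "dm0 (dm1 (snd e)) = wsrc (fst e)" "cd0 (dm1 (snd e)) = wtgt (fst e)"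
proof -
  show "fst e \<in> words" "snd e \<in> J" "cd1 (snd e) = val (fst e)"
    using assms by (auto simp: marks_def)
  moreover from this show "iso (snd e)" "snd e \<in> C2" by simp_all
  ultimately show "dm0 (dm1 (snd e)) = wsrc (fst e)" "cd0 (dm1 (snd e)) = wtgt (fst e)"
    using cell_simps(3,4)[of "snd e"] by simp_all
qed

lemma und_simps [simp]:
  assumes "e \<in> marks"
  shows "und e \<in> C1" "dm0 (und e) = msrc e" "cd0 (und e) = mtgt e" "msrc e \<in> C0" "mtgt e \<in> C0"
  using marksD[OF assms] by (simp_all add: und_def msrc_def mtgt_def)

lemma mone_simps [simp]:
  assumes "x \<in> C0"
  shows "mone x \<in> marks" "und (mone x) = I0 x" "msrc (mone x) = x" "mtgt (mone x) = x"
  using assms by (simp_all add: mone_def marks_def und_def msrc_def mtgt_def)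

lemma mseq_simps [simp]:
  assumes "e \<in> marks" "f \<in> marks" "mtgt e = msrc f"
  shows "mseq e f \<in> marks" "und (mseq e f) = und e \<otimes> und f" "msrc (mseq e f) = msrc e"
    "mtgt (mseq e f) = mtgt f"
  using marksD[OF assms(1)] marksD[OF assms(2)] assms(3)
  by (simp_all add: mseq_def marks_def und_def msrc_def mtgt_def)

lemma mhomD:
  assumes "a \<in> mhom e f" shows "a \<in> C2" "dm1 a = und e" "cd1 a = und f"
  using assms by (auto simp: mhom_def)

lemma mhom_ends:
  assumes "e \<in> marks" "f \<in> marks" "a \<in> mhom e f" shows "msrc f = msrc e" "mtgt f = mtgt e"
  using cell_simps(3,4)[OF mhomD(1)[OF assms(3)]] mhomD[OF assms(3)] assms(1,2) by simp_all

sublocale mk: two_dim C0 marks msrc mtgt mone mseq mhom "\<lambda>e. I1 (und e)" v_comp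
  "\<lambda>e e' f f'. h_comp" mcode pr
proof
  fix e f a assume "e \<in> marks" "f \<in> marks" "a \<in> mhom e f"
  then show "msrc f = msrc e" "mtgt f = mtgt e" by (rule mhom_ends)+
next
  fix e e' f f' s t
  assume p: "e \<in> marks" "e' \<in> marks" "f \<in> marks" "f' \<in> marks" "s \<in> mhom e e'" "t \<in> mhom f f'"
    "mtgt e = msrc f"
  then have "mtgt e' = msrc f'" using mhom_ends by metis
  then show "s \<star> t \<in> mhom (mseq e f) (mseq e' f')"
    using p(1-4,7) mhomD[OF p(5)] mhomD[OF p(6)] by (simp add: mhom_def)
qed (simp_all add: inj_mcode inj_pr, simp_all add: mhom_def)

definition marked :: "'a bicat" where
  "marked = \<lparr>cells = cells mk.magma, dm = dm mk.magma, cd = cd mk.magma, idc = idc mk.magma,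
    cmp = cmp mk.magma,
    associator = (\<lambda>e f g. mk.c2 (mseq (mseq (mk.d1 e) (mk.d1 f)) (mk.d1 g))
      (mseq (mk.d1 e) (mseq (mk.d1 f) (mk.d1 g))) (\<alpha> (und (mk.d1 e)) (und (mk.d1 f)) (und (mk.d1 g)))),
    lunitor = (\<lambda>e. mk.c2 (mseq (mone (msrc (mk.d1 e))) (mk.d1 e)) (mk.d1 e) (\<l> (und (mk.d1 e)))),
    runitor = (\<lambda>e. mk.c2 (mseq (mk.d1 e) (mone (mtgt (mk.d1 e)))) (mk.d1 e) (\<r> (und (mk.d1 e))))\<rparr>"

lemma sel_marked [simp]:
  "cells marked = cells mk.magma" "dm marked = dm mk.magma" "cd marked = cd mk.magma"
  "idc marked = idc mk.magma" "cmp marked = cmp mk.magma"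
  by (simp_all add: marked_def)

lemma composable_marked [simp]: "composable marked = composable mk.magma"
  by (intro ext composable_cong) simp_all

lemma coherence_marked [simp]:
  "associator marked (mcode e) (mcode f) (mcode g) =
    mk.c2 (mseq (mseq e f) g) (mseq e (mseq f g)) (\<alpha> (und e) (und f) (und g))"
  "lunitor marked (mcode e) = mk.c2 (mseq (mone (msrc e)) e) e (\<l> (und e))"
  "runitor marked (mcode e) = mk.c2 (mseq e (mone (mtgt e))) e (\<r> (und e))"
  by (simp_all add: marked_def)

lemma marked_composable_01:
  assumes "composable marked 0 1 f g"
  obtains e d where "f = mcode e" "g = mcode d" "e \<in> marks" "d \<in> marks" "mtgt e = msrc d"
  using assms by (auto simp: mk.composable_magma)

lemma marked_cells_1:
  assumes "f \<in> cells marked 1" obtains e where "f = mcode e" "e \<in> marks"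
  using assms by (auto simp: mk.magma_cells)

lemma marked_cells_2:
  assumes "a \<in> cells marked 2"
  obtains e f t where "a = mk.c2 e f t" "e \<in> marks" "f \<in> marks" "t \<in> C2" "dm1 t = und e" "cd1 t = und f"
    "msrc f = msrc e" "mtgt f = mtgt e"
proof -
  have "a \<in> mk.tri" using assms by (simp add: mk.magma_cells)
  then obtain e f t where "a = mk.c2 e f t" "e \<in> marks" "f \<in> marks" "t \<in> mhom e f"
    "msrc f = msrc e" "mtgt f = mtgt e" by (rule mk.triE)
  then show ?thesis using that mhomD by blast
qed

lemma marked_composable_12:
  assumes "composable marked 1 2 a b"
  obtains e f g s t where "a = mk.c2 e f s" "b = mk.c2 f g t" "e \<in> marks" "f \<in> marks" "g \<in> marks"
    "s \<in> C2" "dm1 s = und e" "cd1 s = und f" "t \<in> C2" "dm1 t = und f" "cd1 t = und g"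
    "msrc f = msrc e" "mtgt f = mtgt e" "msrc g = msrc e" "mtgt g = mtgt e"
proof -
  have ab: "a \<in> cells marked 2" "b \<in> cells marked 2" "mk.t2 a = mk.s2 b"
    using assms by (simp_all add: mk.composable_magma mk.magma_cells)
  obtain e f s where a: "a = mk.c2 e f s" "e \<in> marks" "f \<in> marks" "s \<in> C2" "dm1 s = und e"
    "cd1 s = und f" "msrc f = msrc e" "mtgt f = mtgt e" using ab(1) by (rule marked_cells_2)
  obtain f' g t where b: "b = mk.c2 f' g t" "f' \<in> marks" "g \<in> marks" "t \<in> C2" "dm1 t = und f'"
    "cd1 t = und g" "msrc g = msrc f'" "mtgt g = mtgt f'" using ab(2) by (rule marked_cells_2)
  have "f' = f" using ab(3) a b by simp
  then show ?thesis using that[of e f s g t] a b by simp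
qed

lemma marked_composable_02:
  assumes "composable marked 0 2 a b"
  obtains e e' f f' s t where "a = mk.c2 e e' s" "b = mk.c2 f f' t"
    "e \<in> marks" "e' \<in> marks" "f \<in> marks" "f' \<in> marks"
    "s \<in> C2" "dm1 s = und e" "cd1 s = und e'" "t \<in> C2" "dm1 t = und f" "cd1 t = und f'"
    "msrc e' = msrc e" "mtgt e' = mtgt e" "msrc f' = msrc f" "mtgt f' = mtgt f" "mtgt e = msrc f"
proof -
  have ab: "a \<in> cells marked 2" "b \<in> cells marked 2" "mtgt (mk.t2 a) = msrc (mk.s2 b)"
    using assms by (simp_all add: mk.composable_magma mk.magma_cells)
  obtain e f s where a: "a = mk.c2 e f s" "e \<in> marks" "f \<in> marks" "s \<in> C2" "dm1 s = und e"
    "cd1 s = und f" "msrc f = msrc e" "mtgt f = mtgt e" using ab(1) by (rule marked_cells_2)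
  obtain f' g t where b: "b = mk.c2 f' g t" "f' \<in> marks" "g \<in> marks" "t \<in> C2" "dm1 t = und f'"
    "cd1 t = und g" "msrc g = msrc f'" "mtgt g = mtgt f'" using ab(2) by (rule marked_cells_2)
  show ?thesis using that[of e f s f' g t] ab(3) a b by simp
qed

lemma marked_c2 [simp]: "mk.c2 e f t \<in> cells mk.magma 2 \<longleftrightarrow>
    e \<in> marks \<and> f \<in> marks \<and> t \<in> C2 \<and> dm1 t = und e \<and> cd1 t = und f"
  by (auto simp: mk.magma_cells mhom_def)

lemma marked_iso:
  assumes "iso t" "e \<in> marks" "f \<in> marks" "dm1 t = und e" "cd1 t = und f"
  shows "\<exists>d. inverse_2cells marked (mk.c2 e f t) d"
  using assms by (intro exI[of _ "mk.c2 f e (inv2 t)"]) (simp add: inverse_2cells_def)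

lemma bicategory_marked: "bicategory marked"
proof -
  interpret omega_magma marked
    by (rule omega_magma_cong[OF mk.omega_magma_magma]) simp_all
  show ?thesis
  proof
    show "skeletal 2 marked"
      using mk.skeletal_magma by (simp add: skeletal_def)
  next
    fix a b c assume "composable marked 1 2 a b" "composable marked 1 2 b c"
    then show "cmp marked 1 2 (cmp marked 1 2 a b) c = cmp marked 1 2 a (cmp marked 1 2 b c)"
      by (elim marked_composable_12) auto
  next
    fix a assume "a \<in> cells marked 2"
    then show "cmp marked 1 2 (idc marked 1 (dm marked 1 a)) a = a"
      "cmp marked 1 2 a (idc marked 1 (cd marked 1 a)) = a"
      by (elim marked_cells_2; simp)+
  next
    fix a b c d
    assume "composable marked 1 2 a b" "composable marked 1 2 c d" and ac: "composable marked 0 2 a c"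
    then show "cmp marked 0 2 (cmp marked 1 2 a b) (cmp marked 1 2 c d) =
        cmp marked 1 2 (cmp marked 0 2 a c) (cmp marked 0 2 b d)"
      by (elim marked_composable_12 marked_composable_02) (auto simp: interchange)
  next
    fix f g assume "composable marked 0 1 f g"
    then show "cmp marked 0 2 (idc marked 1 f) (idc marked 1 g) = idc marked 1 (cmp marked 0 1 f g)"
      by (elim marked_composable_01) simp
  next
    fix f g h assume "composable marked 0 1 f g" "composable marked 0 1 g h"
    then show "associator marked f g h \<in> cells marked 2"
      "dm marked 1 (associator marked f g h) = cmp marked 0 1 (cmp marked 0 1 f g) h"
      "cd marked 1 (associator marked f g h) = cmp marked 0 1 f (cmp marked 0 1 g h)"
      "\<exists>d. inverse_2cells marked (associator marked f g h) d"
      by (elim marked_composable_01; auto intro!: marked_iso)+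
  next
    fix a b c assume ab: "composable marked 0 2 a b" and bc: "composable marked 0 2 b c"
    from ab obtain e e' f f' s t where ef: "a = mk.c2 e e' s" "b = mk.c2 f f' t"
      "e \<in> marks" "e' \<in> marks" "f \<in> marks" "f' \<in> marks"
      "s \<in> C2" "dm1 s = und e" "cd1 s = und e'" "t \<in> C2" "dm1 t = und f" "cd1 t = und f'"
      "msrc e' = msrc e" "mtgt e' = mtgt e" "msrc f' = msrc f" "mtgt f' = mtgt f" "mtgt e = msrc f"
      by (rule marked_composable_02)
    from bc obtain k k' g g' q r where g: "b = mk.c2 k k' q" "c = mk.c2 g g' r"
      "g \<in> marks" "g' \<in> marks" "r \<in> C2" "dm1 r = und g" "cd1 r = und g'"
      "msrc g' = msrc g" "mtgt g' = mtgt g" "mtgt k = msrc g"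
      by (rule marked_composable_02)
    \<comment> \<open>The cell \<open>b\<close> has been decomposed twice; injectivity of the code
      identifies \<open>k\<close> with \<open>f\<close>.\<close>
    have "mtgt f = msrc g" using ef(2) g(1,10) by simp
    then show "cmp marked 1 2 (cmp marked 0 2 (cmp marked 0 2 a b) c)
        (associator marked (cd marked 1 a) (cd marked 1 b) (cd marked 1 c)) =
      cmp marked 1 2 (associator marked (dm marked 1 a) (dm marked 1 b) (dm marked 1 c))
        (cmp marked 0 2 a (cmp marked 0 2 b c))"
      unfolding ef(1,2) g(2) using ef g assoc_nat[of s t r] by simp
  next
    fix f assume "f \<in> cells marked 1"
    then show "lunitor marked f \<in> cells marked 2"
      "dm marked 1 (lunitor marked f) = cmp marked 0 1 (idc marked 0 (dm marked 0 f)) f"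
      "cd marked 1 (lunitor marked f) = f" "\<exists>d. inverse_2cells marked (lunitor marked f) d"
      "runitor marked f \<in> cells marked 2"
      "dm marked 1 (runitor marked f) = cmp marked 0 1 f (idc marked 0 (cd marked 0 f))"
      "cd marked 1 (runitor marked f) = f" "\<exists>d. inverse_2cells marked (runitor marked f) d"
      by (elim marked_cells_1; auto intro!: marked_iso)+
  next
    fix a assume "a \<in> cells marked 2"
    then obtain e f t where a: "a = mk.c2 e f t" "e \<in> marks" "f \<in> marks" "t \<in> C2" "dm1 t = und e"
      "cd1 t = und f" "msrc f = msrc e" "mtgt f = mtgt e" by (rule marked_cells_2)
    show "cmp marked 1 2 (cmp marked 0 2 (id_it marked 0 2 (dom_it marked 0 2 a)) a)
        (lunitor marked (cd marked 1 a)) = cmp marked 1 2 (lunitor marked (dm marked 1 a)) a"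
      unfolding a(1) using a(2-) lunitor_nat[of t] by simp
    show "cmp marked 1 2 (cmp marked 0 2 a (id_it marked 0 2 (cod_it marked 0 2 a)))
        (runitor marked (cd marked 1 a)) = cmp marked 1 2 (runitor marked (dm marked 1 a)) a"
      unfolding a(1) using a(2-) runitor_nat[of t] by simp
  next
    fix f g h k
    assume fg: "composable marked 0 1 f g" and gh: "composable marked 0 1 g h"
      and hk: "composable marked 0 1 h k"
    obtain e1 e2 where e: "f = mcode e1" "g = mcode e2" "e1 \<in> marks" "e2 \<in> marks" "mtgt e1 = msrc e2"
      using fg by (rule marked_composable_01)
    obtain e2' e3 where e': "g = mcode e2'" "h = mcode e3" "e3 \<in> marks" "mtgt e2' = msrc e3"
      using gh by (rule marked_composable_01)
    obtain e3' e4 where e'': "h = mcode e3'" "k = mcode e4" "e4 \<in> marks" "mtgt e3' = msrc e4"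
      using hk by (rule marked_composable_01)
    have "mtgt e2 = msrc e3" "mtgt e3 = msrc e4" using e e' e'' by simp_all
    then show "cmp marked 1 2 (associator marked (cmp marked 0 1 f g) h k)
        (associator marked f g (cmp marked 0 1 h k)) =
      cmp marked 1 2 (cmp marked 1 2 (cmp marked 0 2 (associator marked f g h) (idc marked 1 k))
        (associator marked f (cmp marked 0 1 g h) k))
        (cmp marked 0 2 (idc marked 1 f) (associator marked g h k))"
      unfolding e(1,2) e'(2) e''(2)
      using e(3-) e'(3) e''(3) pentagon'[of "und e1" "und e2" "und e3" "und e4"] by simp
  next
    fix f g assume "composable marked 0 1 f g"
    then obtain e1 e2 where e: "f = mcode e1" "g = mcode e2" "e1 \<in> marks" "e2 \<in> marks"
      "mtgt e1 = msrc e2" by (rule marked_composable_01)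
    show "cmp marked 1 2 (associator marked f (idc marked 0 (cd marked 0 f)) g)
        (cmp marked 0 2 (idc marked 1 f) (lunitor marked g)) =
      cmp marked 0 2 (runitor marked f) (idc marked 1 g)"
      unfolding e(1,2) using e(3-) triangle'[of "und e1" "und e2"] by simp
  qed
qed

end


section \<open>Forgetting marks, and the strict map from marked 1-cells to words\<close>

context coherent_class
begin

definition forget :: "nat \<Rightarrow> 'a \<Rightarrow> 'a" where
  "forget = extend2 marked Y
    (\<lambda>i y. if i = 0 then y else if i = 1 then und (mk.d1 y) else mk.l2 y)"

lemma forget_simps [simp]:
  "forget 0 x = x" "forget 1 (mcode e) = und e" "forget 2 (mk.c2 e f t) = t"
  by (simp_all add: forget_def extend2_low)

lemma strong_homomorphism_forget: "strong_homomorphism marked Y forget"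
  unfolding forget_def
proof (rule strong_homomorphism_extend2[OF bicategory_marked bicategory_axioms])
  let ?F = "\<lambda>i y. if i = 0 then y else if i = 1 then und (mk.d1 y) else mk.l2 y"
  {
    fix f g h assume fg: "composable marked 0 1 f g" and gh: "composable marked 0 1 g h"
    obtain e1 e2 where e: "f = mcode e1" "g = mcode e2" using fg by (rule marked_composable_01)
    obtain e2' e3 where e': "h = mcode e3" using gh by (rule marked_composable_01)
    show "?F (2::nat) (associator marked f g h) = \<alpha> (?F (1::nat) f) (?F (1::nat) g) (?F (1::nat) h)"
      unfolding e e' by simp
  next
    fix a b assume "composable marked 0 2 a b"
    then show "?F (2::nat) (cmp marked 0 2 a b) = ?F (2::nat) a \<star> ?F (2::nat) b"
      by (elim marked_composable_02) simp
  next
    fix a b assume "composable marked 1 2 a b"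
    then show "?F (2::nat) (cmp marked 1 2 a b) = ?F (2::nat) a \<odot> ?F (2::nat) b"
      by (elim marked_composable_12) simp
  next
    fix a b assume "composable marked 0 1 a b"
    then show "?F (1::nat) (cmp marked 0 1 a b) = ?F (1::nat) a \<otimes> ?F (1::nat) b"
      by (elim marked_composable_01) simp
  next
    fix x assume "x \<in> cells marked 2"
    then show "?F (2::nat) x \<in> C2" "?F (1::nat) (dm marked 1 x) = dm1 (?F (2::nat) x)"
      "?F (1::nat) (cd marked 1 x) = cd1 (?F (2::nat) x)"
      by (elim marked_cells_2; simp)+
  next
    fix x assume "x \<in> cells marked 1"
    then show "?F (1::nat) x \<in> C1" "?F (0::nat) (dm marked 0 x) = dm0 (?F (1::nat) x)"
      "?F (0::nat) (cd marked 0 x) = cd0 (?F (1::nat) x)"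
      "?F (2::nat) (idc marked 1 x) = I1 (?F (1::nat) x)"
      "?F (2::nat) (lunitor marked x) = \<l> (?F (1::nat) x)"
      "?F (2::nat) (runitor marked x) = \<r> (?F (1::nat) x)"
      by (elim marked_cells_1; simp)+
  }
qed (simp_all add: mk.magma_cells)

definition to_word :: "nat \<Rightarrow> 'a \<Rightarrow> 'a" where
  "to_word = extend2 marked (bicat_of_strict st.magma)
    (\<lambda>i y. if i = 0 then y else if i = 1 then wcode (fst (mk.d1 y))
      else st.c2 (fst (mk.s2 y)) (fst (mk.t2 y)) (inv2 (snd (mk.s2 y)) \<odot> mk.l2 y \<odot> snd (mk.t2 y)))"

lemma to_word_simps [simp]:
  "to_word 0 x = x" "to_word 1 (mcode e) = wcode (fst e)"
  "to_word 2 (mk.c2 e f t) = st.c2 (fst e) (fst f) (inv2 (snd e) \<odot> t \<odot> snd f)"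
  by (simp_all add: to_word_def extend2_low)

lemma bicategory_strictification: "bicategory (bicat_of_strict st.magma)"
  using bicategory_bicat_of_strict strict_omega_category_strictification st.skeletal_magma .

lemma conj_whom:
  assumes "e \<in> marks" "f \<in> marks" "t \<in> C2" "dm1 t = und e" "cd1 t = und f"
  shows "inv2 (snd e) \<odot> t \<odot> snd f \<in> whom (fst e) (fst f)"
  using marksD[OF assms(1)] marksD[OF assms(2)] assms(3-) by (simp add: whom_def und_def)

text \<open>The factor \<mu> in \<open>mseq\<close> is there for this: it is the same \<mu> that
  occurs in \<open>whc\<close>, and interchange distributes the remaining conjugation over the two
  factors.\<close>

lemma conj_hcomp:
  assumes e: "e \<in> marks" "e' \<in> marks" and f: "f \<in> marks" "f' \<in> marks"
    and s: "s \<in> C2" "dm1 s = und e" "cd1 s = und e'" and t: "t \<in> C2" "dm1 t = und f" "cd1 t = und f'"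
    and p: "mtgt e = msrc f" "mtgt e' = msrc f'"
  shows "inv2 (snd (mseq e f)) \<odot> (s \<star> t) \<odot> snd (mseq e' f') =
    whc (fst e) (fst e') (fst f) (fst f') (inv2 (snd e) \<odot> s \<odot> snd e') (inv2 (snd f) \<odot> t \<odot> snd f')"
  using marksD[OF e(1)] marksD[OF e(2)] marksD[OF f(1)] marksD[OF f(2)] s t p
  by (simp add: mseq_def whc_def und_def msrc_def mtgt_def inv2_v inv2_h interchange)

text \<open>Naturality of \<alpha> at the three marks, combined with \<open>\<mu>_assoc\<close>. As
  a result, conjugation by marks turns the associator of \<open>marked\<close> into the identity of
  a word.\<close>

lemma mseq_assoc_coherence:
  assumes e: "e \<in> marks" and f: "f \<in> marks" and g: "g \<in> marks"
    and p: "mtgt e = msrc f" "mtgt f = msrc g"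
  shows "\<alpha> (und e) (und f) (und g) \<odot> snd (mseq e (mseq f g)) = snd (mseq (mseq e f) g)"
proof -
  note q = marksD[OF e] marksD[OF f] marksD[OF g] p[unfolded msrc_def mtgt_def]
  let ?u = "fst e" and ?v = "fst f" and ?w = "fst g" and ?c = "snd e" and ?d = "snd f" and ?k = "snd g"
  have "\<alpha> (dm1 ?c) (dm1 ?d) (dm1 ?k) \<odot> (?c \<star> ((?d \<star> ?k) \<odot> \<mu> ?v ?w)) \<odot> \<mu> ?u (wseq ?v ?w) =
      \<alpha> (dm1 ?c) (dm1 ?d) (dm1 ?k) \<odot> ((?c \<odot> I1 (val ?u)) \<star> ((?d \<star> ?k) \<odot> \<mu> ?v ?w)) \<odot> \<mu> ?u (wseq ?v ?w)"
    using q by simp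
  also have "\<dots> = (\<alpha> (dm1 ?c) (dm1 ?d) (dm1 ?k) \<odot> (?c \<star> ?d \<star> ?k)) \<odot>
      (I1 (val ?u) \<star> \<mu> ?v ?w) \<odot> \<mu> ?u (wseq ?v ?w)"
    using q by (simp add: interchange del: v_unit)
  also have "\<dots> = (((?c \<star> ?d) \<star> ?k) \<odot> \<alpha> (val ?u) (val ?v) (val ?w)) \<odot>
      (I1 (val ?u) \<star> \<mu> ?v ?w) \<odot> \<mu> ?u (wseq ?v ?w)"
    using q assoc_nat[of ?c ?d ?k] by simp
  also have "\<dots> = ((?c \<star> ?d) \<star> ?k) \<odot> (\<mu> ?u ?v \<star> I1 (val ?w)) \<odot> \<mu> (wseq ?u ?v) ?w"
    using q \<mu>_assoc[of ?u ?v ?w] by (simp add: wseq_assoc)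
  also have "\<dots> = (((?c \<star> ?d) \<odot> \<mu> ?u ?v) \<star> (?k \<odot> I1 (val ?w))) \<odot> \<mu> (wseq ?u ?v) ?w"
    using q by (simp add: interchange wseq_assoc del: v_unit)
  also have "\<dots> = (((?c \<star> ?d) \<odot> \<mu> ?u ?v) \<star> ?k) \<odot> \<mu> (wseq ?u ?v) ?w"
    using q by simp
  finally show ?thesis
    by (simp add: mseq_def und_def)
qed

text \<open>The analogue for unitors: naturality at \<open>snd e\<close>, together with the fact
  that \<mu> with an empty word is a unitor.\<close>

lemma mseq_mone_coherence:
  assumes e: "e \<in> marks"
  shows "\<l> (und e) \<odot> snd e = snd (mseq (mone (msrc e)) e)"
    "\<r> (und e) \<odot> snd e = snd (mseq e (mone (mtgt e)))"
  using marksD[OF e] lunitor_nat[of "snd e"] runitor_nat[of "snd e"] \<mu>_one[of "fst e"]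
  by (simp_all add: mseq_def mone_def und_def msrc_def mtgt_def)

lemma fst_mark_simps [simp]:
  "fst (mseq e f) = wseq (fst e) (fst f)" "fst (mone x) = wone x"
  by (simp_all add: mseq_def mone_def)

lemma strong_homomorphism_to_word: "strong_homomorphism marked (bicat_of_strict st.magma) to_word"
  unfolding to_word_def
proof (rule strong_homomorphism_extend2[OF bicategory_marked bicategory_strictification])
  have unit: "I1 (und e) \<odot> snd e = snd e" if "e \<in> marks" for e
    using marksD[OF that] by (simp add: und_def)
  let ?F = "\<lambda>i y. if i = 0 then y else if i = 1 then wcode (fst (mk.d1 y))
      else st.c2 (fst (mk.s2 y)) (fst (mk.t2 y)) (inv2 (snd (mk.s2 y)) \<odot> mk.l2 y \<odot> snd (mk.t2 y))"
  {
    fix x assume "x \<in> cells marked 0"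
    then show "?F (0::nat) x \<in> cells (bicat_of_strict st.magma) 0"
      by (simp add: mk.magma_cells st.magma_cells)
  next
    fix x assume "x \<in> cells marked 1"
    then show "?F (1::nat) x \<in> cells (bicat_of_strict st.magma) 1"
      by (elim marked_cells_1) (simp add: st.magma_cells marksD)
  next
    fix x assume "x \<in> cells marked 2"
    then show "?F (2::nat) x \<in> cells (bicat_of_strict st.magma) 2"
      by (elim marked_cells_2) (simp add: st.magma_cells marksD conj_whom)
  next
    fix x assume "x \<in> cells marked 1"
    then show "?F (0::nat) (dm marked 0 x) = dm (bicat_of_strict st.magma) 0 (?F (1::nat) x)"
      "?F (0::nat) (cd marked 0 x) = cd (bicat_of_strict st.magma) 0 (?F (1::nat) x)"
      by (elim marked_cells_1; simp add: msrc_def mtgt_def)+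
  next
    fix x assume "x \<in> cells marked 2"
    then show "?F (1::nat) (dm marked 1 x) = dm (bicat_of_strict st.magma) 1 (?F (2::nat) x)"
      "?F (1::nat) (cd marked 1 x) = cd (bicat_of_strict st.magma) 1 (?F (2::nat) x)"
      by (elim marked_cells_2; simp)+
  next
    fix x assume "x \<in> cells marked 0"
    then show "?F (1::nat) (idc marked 0 x) = idc (bicat_of_strict st.magma) 0 (?F (0::nat) x)"
      by simp
  next
    fix x assume "x \<in> cells marked 1"
    then show "?F (2::nat) (idc marked 1 x) = idc (bicat_of_strict st.magma) 1 (?F (1::nat) x)"
      by (elim marked_cells_1) (simp add: unit marksD)
  next
    fix a b assume "composable marked 0 1 a b"
    then show "?F (1::nat) (cmp marked 0 1 a b) =
        cmp (bicat_of_strict st.magma) 0 1 (?F (1::nat) a) (?F (1::nat) b)"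
      by (elim marked_composable_01) simp
  next
    fix a b assume "composable marked 0 2 a b"
    then show "?F (2::nat) (cmp marked 0 2 a b) =
        cmp (bicat_of_strict st.magma) 0 2 (?F (2::nat) a) (?F (2::nat) b)"
      by (elim marked_composable_02) (simp add: conj_hcomp)
  next
    fix a b assume "composable marked 1 2 a b"
    then obtain e f g s t where ab: "a = mk.c2 e f s" "b = mk.c2 f g t"
      and q: "e \<in> marks" "f \<in> marks" "g \<in> marks" "s \<in> C2" "dm1 s = und e" "cd1 s = und f" "t \<in> C2"
        "dm1 t = und f" "cd1 t = und g"
      by (rule marked_composable_12)
    show "?F (2::nat) (cmp marked 1 2 a b) =
        cmp (bicat_of_strict st.magma) 1 2 (?F (2::nat) a) (?F (2::nat) b)"
      unfolding ab using q[unfolded und_def] marksD[OF q(1)] marksD[OF q(2)] marksD[OF q(3)] by simp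
  next
    fix f g h assume fg: "composable marked 0 1 f g" and gh: "composable marked 0 1 g h"
    obtain e1 e2 where e: "f = mcode e1" "g = mcode e2" "e1 \<in> marks" "e2 \<in> marks" "mtgt e1 = msrc e2"
      using fg by (rule marked_composable_01)
    obtain e2' e3 where e': "g = mcode e2'" "h = mcode e3" "e3 \<in> marks" "mtgt e2' = msrc e3"
      using gh by (rule marked_composable_01)
    have "mtgt e2 = msrc e3" using e e' by simp
    then show "?F (2::nat) (associator marked f g h) =
        associator (bicat_of_strict st.magma) (?F (1::nat) f) (?F (1::nat) g) (?F (1::nat) h)"
      unfolding e(1,2) e'(2) using e(3-) e'(3) mseq_assoc_coherence[of e1 e2 e3]
      by (simp add: marksD wseq_assoc)
  next
    fix f assume "f \<in> cells marked 1"
    then obtain e where e: "f = mcode e" "e \<in> marks" by (rule marked_cells_1)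
    have w: "wseq (wone (msrc e)) (fst e) = fst e" "wseq (fst e) (wone (mtgt e)) = fst e"
      using wseq_wone[of "fst e"] marksD[OF e(2)] by (simp_all add: msrc_def mtgt_def)
    show "?F (2::nat) (lunitor marked f) = lunitor (bicat_of_strict st.magma) (?F (1::nat) f)"
      unfolding e(1) using e(2) mseq_mone_coherence[OF e(2)] by (simp add: marksD w)
    show "?F (2::nat) (runitor marked f) = runitor (bicat_of_strict st.magma) (?F (1::nat) f)"
      unfolding e(1) using e(2) mseq_mone_coherence[OF e(2)] by (simp add: marksD w)
  }
qed

text \<open>Conjugation by invertible 2-cells is injective.\<close>

lemma to_word_faithful:
  assumes "e \<in> marks" "f \<in> marks" "s \<in> C2" "dm1 s = und e" "cd1 s = und f"
    "t \<in> C2" "dm1 t = und e" "cd1 t = und f"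
    and "to_word 2 (mk.c2 e f s) = to_word 2 (mk.c2 e f t)"
  shows "s = t"
proof (rule cancel_right[of "snd f"])
  note q = marksD[OF assms(1)] marksD[OF assms(2)]
  show "s \<odot> snd f = t \<odot> snd f"
    by (rule cancel_left[of "inv2 (snd e)"]) (use assms q in \<open>simp_all add: und_def\<close>)
qed (use assms marksD[OF assms(2)] in \<open>simp_all add: und_def\<close>)

end

section \<open>Lifting the generators to the marked bicategory\<close>

text \<open>
  In the lift of \<open>\<rho>\<close> to \<open>marked\<close>, the word of an identity 1-cell has to be empty, because the lift
  preserves identities.
\<close>

locale coherent_class_map = coherent_class Y pr ls J + \<rho>: omega_graph_morphism G Y \<rho>
  for Y :: "('a, 'm) bicat_scheme" and pr :: "'a \<times> 'a \<Rightarrow> 'a" and ls :: "'a list \<Rightarrow> 'a"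
    and J :: "'a set" and G :: "('g, 'n) omega_graph_scheme" and \<rho> :: "nat \<Rightarrow> 'g \<Rightarrow> 'a" +
  assumes skeletal_G: "skeletal 2 G"
begin

text \<open>A one-letter word has the value \<open>f \<otimes> I0 (cd0 f)\<close>, so the inverse
  right unitor is the isomorphism from \<open>f\<close> to it.\<close>

definition mark_of :: "'g \<Rightarrow> 'a word \<times> 'a" where
  "mark_of x = (let f = \<rho> 1 x in
    if x = idc G 0 (dm G 0 x) then mone (dm0 f) else ((dm0 f, [f], cd0 f), inv2 (\<r> f)))"

definition lift :: "nat \<Rightarrow> 'g \<Rightarrow> 'a" where
  "lift = extend2 G marked
    (\<lambda>i x. if i = 0 then \<rho> 0 x else if i = 1 then mcode (mark_of x)
      else mk.c2 (mark_of (dm G 1 x)) (mark_of (cd G 1 x)) (\<rho> 2 x))"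

lemma \<rho>_simps [simp]:
  "x \<in> cells G 0 \<Longrightarrow> \<rho> 0 x \<in> C0" "x \<in> cells G 1 \<Longrightarrow> \<rho> 1 x \<in> C1" "x \<in> cells G 2 \<Longrightarrow> \<rho> 2 x \<in> C2"
  "x \<in> cells G 1 \<Longrightarrow> dm0 (\<rho> 1 x) = \<rho> 0 (dm G 0 x)" "x \<in> cells G 1 \<Longrightarrow> cd0 (\<rho> 1 x) = \<rho> 0 (cd G 0 x)"
  "x \<in> cells G 2 \<Longrightarrow> dm1 (\<rho> 2 x) = \<rho> 1 (dm G 1 x)" "x \<in> cells G 2 \<Longrightarrow> cd1 (\<rho> 2 x) = \<rho> 1 (cd G 1 x)"
  "x \<in> cells G 0 \<Longrightarrow> \<rho> 1 (idc G 0 x) = I0 (\<rho> 0 x)" "x \<in> cells G 1 \<Longrightarrow> \<rho> 2 (idc G 1 x) = I1 (\<rho> 1 x)"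
  using \<rho>.map_cells \<rho>.map_dm[of x 0] \<rho>.map_cd[of x 0] \<rho>.map_dm[of x 1] \<rho>.map_cd[of x 1]
    \<rho>.map_idc[of x 0] \<rho>.map_idc[of x 1] by simp_all

lemma G_simps [simp]:
  "x \<in> cells G 1 \<Longrightarrow> dm G 0 x \<in> cells G 0" "x \<in> cells G 1 \<Longrightarrow> cd G 0 x \<in> cells G 0"
  "x \<in> cells G 2 \<Longrightarrow> dm G 1 x \<in> cells G 1" "x \<in> cells G 2 \<Longrightarrow> cd G 1 x \<in> cells G 1"
  "x \<in> cells G 0 \<Longrightarrow> idc G 0 x \<in> cells G 1" "x \<in> cells G 1 \<Longrightarrow> idc G 1 x \<in> cells G 2"
  "x \<in> cells G 0 \<Longrightarrow> dm G 0 (idc G 0 x) = x" "x \<in> cells G 1 \<Longrightarrow> dm G 1 (idc G 1 x) = x"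
  "x \<in> cells G 0 \<Longrightarrow> cd G 0 (idc G 0 x) = x" "x \<in> cells G 1 \<Longrightarrow> cd G 1 (idc G 1 x) = x"
  using \<rho>.dom.dm_cells[of x 0] \<rho>.dom.cd_cells[of x 0] \<rho>.dom.dm_cells[of x 1] \<rho>.dom.cd_cells[of x 1]
    \<rho>.dom.idc_cells[of x 0] \<rho>.dom.idc_cells[of x 1] \<rho>.dom.dm_idc \<rho>.dom.cd_idc by simp_all

lemma mark_of_simps [simp]:
  assumes x: "x \<in> cells G 1"
  shows "mark_of x \<in> marks" "und (mark_of x) = \<rho> 1 x"
    "msrc (mark_of x) = \<rho> 0 (dm G 0 x)" "mtgt (mark_of x) = \<rho> 0 (cd G 0 x)"
proof -
  have "mark_of x \<in> marks \<and> und (mark_of x) = \<rho> 1 x"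
  proof (cases "x = idc G 0 (dm G 0 x)")
    case True
    then have "\<rho> 1 x = I0 (\<rho> 0 (dm G 0 x))"
      using x \<rho>_simps(8)[of "dm G 0 x"] by simp
    then show ?thesis
      using x True by (simp add: mark_of_def Let_def)
  next
    case False
    then show ?thesis
      using x by (simp add: mark_of_def Let_def marks_def words_def und_def val_def wtgt_def)
  qed
  then show m: "mark_of x \<in> marks" "und (mark_of x) = \<rho> 1 x" by simp_all
  show "msrc (mark_of x) = \<rho> 0 (dm G 0 x)" "mtgt (mark_of x) = \<rho> 0 (cd G 0 x)"
    using und_simps(2,3)[OF m(1)] m(2) x by simp_all
qed

lemma mark_of_idc [simp]: "x \<in> cells G 0 \<Longrightarrow> mark_of (idc G 0 x) = mone (\<rho> 0 x)"
  by (simp add: mark_of_def Let_def)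

lemma lift_simps [simp]:
  "lift 0 x = \<rho> 0 x" "lift 1 x = mcode (mark_of x)"
  "lift 2 x = mk.c2 (mark_of (dm G 1 x)) (mark_of (cd G 1 x)) (\<rho> 2 x)"
  by (simp_all add: lift_def extend2_low)

lemma omega_graph_morphism_lift: "omega_graph_morphism G marked lift"
proof -
  interpret P: bicategory marked by (rule bicategory_marked)
  have le2: "i \<le> 2 \<longleftrightarrow> i = 0 \<or> i = 1 \<or> i = 2" for i :: nat by auto
  show ?thesis
    unfolding lift_def
  proof (rule omega_graph_morphism_extend2)
    show "omega_graph G" "omega_graph marked" "skeletal 2 G"
      using \<rho>.dom.omega_graph_axioms P.omega_graph_axioms skeletal_G .
  qed (auto simp: le2 less_2_cases mk.magma_cells mhom_def)
qed

lemma forget_lift: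
  assumes "x \<in> cells G i" shows "forget i (lift i x) = \<rho> i x"
  using assms
proof (induction i arbitrary: x)
  case 0
  then show ?case by simp
next
  case (Suc n)
  interpret F: strong_homomorphism marked Y forget by (rule strong_homomorphism_forget)
  interpret L: omega_graph_morphism G marked lift by (rule omega_graph_morphism_lift)
  consider "n = 0" | "n = 1" | "2 \<le> n" by linarith
  then show ?case
  proof cases
    case 3
    then obtain y where y: "y \<in> cells G n" "x = idc G n y"
      using skeletal_G Suc.prems by (auto simp: skeletal_def)
    then show ?thesis
      using Suc.IH[OF y(1)] L.map_cells[OF y(1)]
      by (simp add: L.map_idc F.map_idc \<rho>.map_idc del: sel_marked)
  qed (use Suc.prems in simp_all)
qed

end


section \<open>Coherence for the free bicategory\<close>

lemma omega_graph_morphism_graph_of_bicat: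
  "omega_graph_morphism G (graph_of_bicat B) F \<longleftrightarrow> omega_graph_morphism G B F"
  by (auto elim!: omega_graph_morphism_cong)

lemma omega_graph_morphism_graph_of_magma:
  "omega_graph_morphism G (graph_of_magma M) F \<longleftrightarrow> omega_graph_morphism G M F"
  by (auto elim!: omega_graph_morphism_cong)

lemma omega_graph_morphism_bicat_of_strict:
  "omega_graph_morphism G (bicat_of_strict M) F \<longleftrightarrow> omega_graph_morphism G M F"
  by (auto elim!: omega_graph_morphism_cong)

text \<open>Both maps are transposes of their common restriction along \<rho>.\<close>

lemma free_bicategory_unique:
  fixes B Z :: "'u bicat"
  assumes "free_bicategory G B \<rho>" "strong_homomorphism B Z H" "strong_homomorphism B Z H'"
    and "\<And>i x. x \<in> cells G i \<Longrightarrow> H i (\<rho> i x) = H' i (\<rho> i x)" and "x \<in> cells B i"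
  shows "H i x = H' i x"
proof -
  interpret H: strong_homomorphism B Z H by fact
  have "omega_graph_morphism G (graph_of_bicat Z) (\<lambda>i x. H i (\<rho> i x))"
    using assms(1) omega_graph_morphism_comp[OF _ H.omega_graph_morphism_axioms, of G \<rho>]
    by (simp add: free_bicategory_def omega_graph_morphism_graph_of_bicat)
  moreover have "extends G \<rho> (\<lambda>i x. H i (\<rho> i x)) H" "extends G \<rho> (\<lambda>i x. H i (\<rho> i x)) H'"
    using assms(4) by (simp_all add: extends_def)
  ultimately obtain K where "\<And>H'. strong_homomorphism B Z H' \<Longrightarrow> extends G \<rho> (\<lambda>i x. H i (\<rho> i x)) H' \<Longrightarrow>
      \<forall>i. \<forall>x\<in>cells B i. H' i x = K i x"
    using assms(1) H.cod.bicategory_axioms unfolding free_bicategory_def by blast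
  then show ?thesis
    using assms(2,3,5) \<open>extends G \<rho> _ H\<close> \<open>extends G \<rho> _ H'\<close> by metis
qed

locale free_comparison = bicategory B
  for B :: "'u bicat" +
  fixes G :: "'g omega_graph" and \<rho> :: "nat \<Rightarrow> 'g \<Rightarrow> 'u"
    and S :: "'u omega_magma" and \<eta> :: "nat \<Rightarrow> 'g \<Rightarrow> 'u" and \<kappa> :: "nat \<Rightarrow> 'u \<Rightarrow> 'u"
    and pr :: "'u \<times> 'u \<Rightarrow> 'u" and ls :: "'u list \<Rightarrow> 'u"
  assumes free_B: "free_bicategory G B \<rho>" and free_S: "free_strict_omega_category G S \<eta>"
    and skeletal_G: "skeletal 2 G"
    and \<kappa>_hom: "strong_homomorphism B (bicat_of_strict S) \<kappa>" and \<kappa>_\<rho>: "extends G \<rho> \<eta> \<kappa>"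
    and inj_pr: "inj pr" and inj_ls: "inj ls"
begin

notation ar_comp (infixr \<open>\<otimes>\<close> 75)
notation h_comp (infixr \<open>\<star>\<close> 70)
notation v_comp (infixr \<open>\<odot>\<close> 65)

sublocale S: strict_omega_category S
  using free_S by (simp add: free_strict_omega_category_def)

sublocale \<kappa>: strong_homomorphism B "bicat_of_strict S" \<kappa>
  by (rule \<kappa>_hom)

lemma \<kappa>_simps:
  "f \<in> C1 \<Longrightarrow> \<kappa> 1 f \<in> cells S 1" "a \<in> C2 \<Longrightarrow> \<kappa> 2 a \<in> cells S 2"
  "a \<in> C2 \<Longrightarrow> dm S 1 (\<kappa> 2 a) = \<kappa> 1 (dm1 a)" "a \<in> C2 \<Longrightarrow> cd S 1 (\<kappa> 2 a) = \<kappa> 1 (cd1 a)"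
  "f \<in> C1 \<Longrightarrow> dm S 0 (\<kappa> 1 f) = \<kappa> 0 (dm0 f)" "f \<in> C1 \<Longrightarrow> cd S 0 (\<kappa> 1 f) = \<kappa> 0 (cd0 f)"
  "f \<in> C1 \<Longrightarrow> \<kappa> 2 (I1 f) = idc S 1 (\<kappa> 1 f)"
  "f \<in> C1 \<Longrightarrow> dm S 1 (idc S 1 (\<kappa> 1 f)) = \<kappa> 1 f" "f \<in> C1 \<Longrightarrow> cd S 1 (idc S 1 (\<kappa> 1 f)) = \<kappa> 1 f"
  using \<kappa>.map_cells[of f 1] \<kappa>.map_cells[of a 2] \<kappa>.map_dm[of a 1] \<kappa>.map_cd[of a 1]
    \<kappa>.map_dm[of f 0] \<kappa>.map_cd[of f 0] \<kappa>.map_idc[of f 1]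
    S.dm_idc[of "\<kappa> 1 f" 1] S.cd_idc[of "\<kappa> 1 f" 1] by simp_all

lemma \<kappa>_ar: "\<lbrakk>f \<in> C1; g \<in> C1; cd0 f = dm0 g\<rbrakk> \<Longrightarrow> \<kappa> 1 (f \<otimes> g) = cmp S 0 1 (\<kappa> 1 f) (\<kappa> 1 g)"
  using \<kappa>.map_cmp[of 0 1 f g] by (simp add: composable_low)

lemma \<kappa>_v: "\<lbrakk>a \<in> C2; b \<in> C2; cd1 a = dm1 b\<rbrakk> \<Longrightarrow> \<kappa> 2 (a \<odot> b) = cmp S 1 2 (\<kappa> 2 a) (\<kappa> 2 b)"
  using \<kappa>.map_cmp[of 1 2 a b] by (simp add: composable_low)

lemma \<kappa>_h: "\<lbrakk>a \<in> C2; b \<in> C2; cd0 (dm1 a) = dm0 (dm1 b)\<rbrakk> \<Longrightarrow> \<kappa> 2 (a \<star> b) = cmp S 0 2 (\<kappa> 2 a) (\<kappa> 2 b)"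
  using \<kappa>.map_cmp[of 0 2 a b] by (simp add: composable_low)

text \<open>The instance of \<open>J\<close>. Since marks are taken from it, every 2-cell composed
  of marks and their inverses is sent to an identity by \<kappa>.\<close>

definition "collapsed = {c. iso c \<and> \<kappa> 2 c = idc S 1 (\<kappa> 1 (dm1 c))}"

lemma collapsed_cd: "c \<in> collapsed \<Longrightarrow> \<kappa> 1 (cd1 c) = \<kappa> 1 (dm1 c)"
  using \<kappa>_simps(4)[of c] \<kappa>_simps(9)[of "dm1 c"] by (simp add: collapsed_def)

lemma inverse_collapsed:
  assumes "iso c" "\<kappa> 2 c = idc S 1 (\<kappa> 1 (dm1 c))"
  shows "inv2 c \<in> collapsed"
proof -
  have c: "c \<in> collapsed" using assms by (simp add: collapsed_def)
  \<comment> \<open>As \<open>\<kappa> 2 c\<close> is an identity it may be inserted in front;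
    functoriality then produces the image of \<open>c \<odot> inv2 c\<close>.\<close>
  have "\<kappa> 2 (inv2 c) = cmp S 1 2 (\<kappa> 2 c) (\<kappa> 2 (inv2 c))"
    using S.cmp_id_left[of 1 2 "\<kappa> 2 (inv2 c)"] assms collapsed_cd[OF c] by (simp add: \<kappa>_simps)
  also have "\<dots> = \<kappa> 2 (c \<odot> inv2 c)"
    using assms(1) by (simp add: \<kappa>_v del: inv2_simps(4))
  also have "\<dots> = idc S 1 (\<kappa> 1 (cd1 c))"
    using assms(1) collapsed_cd[OF c] by (simp add: \<kappa>_simps)
  finally show ?thesis
    using assms(1) by (simp add: collapsed_def)
qed

text \<open>Coherence cells are collapsed because \<kappa> preserves them strictly and those of
  \<open>bicat_of_strict S\<close> are identities; closure under composition is functoriality of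
  \<kappa>.\<close>

sublocale coherent_class B pr ls collapsed
proof
  fix c d assume c: "c \<in> collapsed" and d: "d \<in> collapsed" and cd: "cd1 c = dm1 d"
  have "\<kappa> 1 (dm1 d) = \<kappa> 1 (dm1 c)" using collapsed_cd[OF c] cd by simp
  then show "c \<odot> d \<in> collapsed"
    using c d cd S.idc_cmp_12[of "\<kappa> 1 (dm1 c)"] by (simp add: collapsed_def \<kappa>_v \<kappa>_simps)
next
  fix c d assume c: "c \<in> collapsed" and d: "d \<in> collapsed" and cd: "cd0 (dm1 c) = dm0 (dm1 d)"
  then show "c \<star> d \<in> collapsed"
    using S.idc_cmp_01[of "\<kappa> 1 (dm1 c)" "\<kappa> 1 (dm1 d)"]
    by (simp add: collapsed_def \<kappa>_h \<kappa>_ar \<kappa>_simps)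
next
  fix f g h assume fgh: "f \<in> C1" "g \<in> C1" "h \<in> C1" "cd0 f = dm0 g" "cd0 g = dm0 h"
  then show "\<alpha> f g h \<in> collapsed"
    using \<kappa>.map_associator[of f g h] by (simp add: collapsed_def composable_low \<kappa>_ar)
next
  fix f assume f: "f \<in> C1"
  then have "\<kappa> 1 (dm1 (\<l> f)) = \<kappa> 1 f" "\<kappa> 1 (dm1 (\<r> f)) = \<kappa> 1 f"
    using S.cmp_id_left[of 0 1 "\<kappa> 1 f"] S.cmp_id_right[of 0 1 "\<kappa> 1 f"]
      \<kappa>.map_idc[of "dm0 f" 0] \<kappa>.map_idc[of "cd0 f" 0]
    by (simp_all add: \<kappa>_ar \<kappa>_simps)
  then show "\<l> f \<in> collapsed" "\<r> f \<in> collapsed"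
    using f \<kappa>.map_lunitor[of f] \<kappa>.map_runitor[of f] by (simp_all add: collapsed_def)
next
  show "inv2 c \<in> collapsed" if "c \<in> collapsed" for c
    using that inverse_collapsed[of c] by (simp add: collapsed_def)
qed (simp_all add: inj_pr inj_ls, simp_all add: collapsed_def \<kappa>_simps)

sublocale coherent_class_map B pr ls collapsed G \<rho>
proof -
  interpret \<rho>: omega_graph_morphism G B \<rho>
    using free_B by (simp add: free_bicategory_def omega_graph_morphism_graph_of_bicat)
  show "coherent_class_map B pr ls collapsed G \<rho>"
    by unfold_locales (rule skeletal_G)
qed

text \<open>The lift followed by \<open>forget\<close> fixes the generators, so by uniqueness it is
  the identity. This supplies a mark for every 1-cell and takes the place of an induction over
  1-cells.\<close>

lemma section_exists:
  obtains H where "strong_homomorphism B marked H" "extends G \<rho> lift H"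
    "\<And>i x. x \<in> cells B i \<Longrightarrow> forget i (H i x) = x"
proof -
  have "omega_graph_morphism G (graph_of_bicat marked) lift"
    using omega_graph_morphism_lift by (simp add: omega_graph_morphism_graph_of_bicat)
  then obtain H where H: "strong_homomorphism B marked H" "extends G \<rho> lift H"
    using free_B bicategory_marked unfolding free_bicategory_def by blast
  have "forget i (H i x) = x" if "x \<in> cells B i" for i x
  proof (rule free_bicategory_unique[OF free_B _ _ _ that])
    show "strong_homomorphism B B (\<lambda>i x. forget i (H i x))"
      using strong_homomorphism_comp[OF H(1) strong_homomorphism_forget] .
    show "strong_homomorphism B B (\<lambda>i x. x)"
      by (rule strong_homomorphism_id) unfold_locales
    show "forget i (H i (\<rho> i x)) = \<rho> i x" if "x \<in> cells G i" for i x
      using H(2) forget_lift[OF that] that by (simp add: extends_def)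
  qed
  then show ?thesis using that H by blast
qed

lemma \<kappa>_determines_word:
  assumes H: "strong_homomorphism B marked H"
  obtains K where "\<And>i x. x \<in> cells B i \<Longrightarrow> K i (\<kappa> i x) = to_word i (H i x)"
proof -
  have QH: "strong_homomorphism B (bicat_of_strict st.magma) (\<lambda>i x. to_word i (H i x))"
    using strong_homomorphism_comp[OF H strong_homomorphism_to_word] .
  interpret QH: strong_homomorphism B "bicat_of_strict st.magma" "\<lambda>i x. to_word i (H i x)"
    by (rule QH)
  have "omega_graph_morphism G (graph_of_magma st.magma) (\<lambda>i x. to_word i (H i (\<rho> i x)))"
    using omega_graph_morphism_comp[OF \<rho>.omega_graph_morphism_axioms QH.omega_graph_morphism_axioms]
    by (simp add: omega_graph_morphism_graph_of_magma omega_graph_morphism_bicat_of_strict)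
  then obtain K where K: "omega_magma_morphism S st.magma K"
    "extends G \<eta> (\<lambda>i x. to_word i (H i (\<rho> i x))) K"
    using free_S strict_omega_category_strictification
    unfolding free_strict_omega_category_def by blast
  \<comment> \<open>The comparison with \<open>to_word\<close> uses uniqueness for strong
    homomorphisms, so \<open>K\<close> has to be read as one; this relies on \<open>S\<close> being
    2-skeletal.\<close>
  have K': "strong_homomorphism (bicat_of_strict S) (bicat_of_strict st.magma) K"
    by (rule strong_homomorphism_bicat_of_strict[OF K(1) S.strict_omega_category_axioms
          strict_omega_category_strictification
          free_strict_omega_category_skeletal[OF free_S skeletal_G] st.skeletal_magma])
  have "K i (\<kappa> i x) = to_word i (H i x)" if "x \<in> cells B i" for i x
    by (rule free_bicategory_unique[OF free_B strong_homomorphism_comp[OF \<kappa>_hom K'] QH _ that])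
      (use K(2) \<kappa>_\<rho> in \<open>simp add: extends_def\<close>)
  then show ?thesis using that by blast
qed

lemma \<kappa>_coherence:
  shows \<kappa>_inj_0: "\<lbrakk>x \<in> C0; y \<in> C0; \<kappa> 0 x = \<kappa> 0 y\<rbrakk> \<Longrightarrow> x = y"
    and \<kappa>_connected: "\<lbrakk>p \<in> C1; q \<in> C1; \<kappa> 1 p = \<kappa> 1 q\<rbrakk> \<Longrightarrow>
      \<exists>c\<in>C2. dm1 c = p \<and> cd1 c = q \<and> \<kappa> 2 c = idc S 1 (\<kappa> 1 p)"
    and \<kappa>_faithful: "\<lbrakk>s \<in> C2; t \<in> C2; dm1 s = dm1 t; cd1 s = cd1 t; \<kappa> 2 s = \<kappa> 2 t\<rbrakk> \<Longrightarrow> s = t"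
proof -
  obtain H where H: "strong_homomorphism B marked H"
    and sec: "\<And>i x. x \<in> cells B i \<Longrightarrow> forget i (H i x) = x"
    using section_exists by metis
  interpret H: strong_homomorphism B marked H by (rule H)
  obtain K where K: "\<And>i x. x \<in> cells B i \<Longrightarrow> K i (\<kappa> i x) = to_word i (H i x)"
    using \<kappa>_determines_word[OF H] by blast
  \<comment> \<open>Through \<open>K\<close>, the image of a cell among words depends on its image
    under \<kappa> only. The three claims read off what this image retains: the object, the word,
    and the conjugated 2-cell.\<close>
  have word: "to_word i (H i x) = to_word i (H i y)"
    if "x \<in> cells B i" "y \<in> cells B i" "\<kappa> i x = \<kappa> i y" for i x y
    using K that by metis
  show "x = y" if "x \<in> C0" "y \<in> C0" "\<kappa> 0 x = \<kappa> 0 y" for x y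
    using word[OF that] sec[OF that(1)] sec[OF that(2)] by simp
  have mark: "\<exists>e\<in>marks. H 1 p = mcode e \<and> und e = p" if p: "p \<in> C1" for p
  proof -
    obtain e where e: "H 1 p = mcode e" "e \<in> marks"
      by (rule marked_cells_1[OF H.map_cells[OF p]])
    then show ?thesis using sec[OF p] by auto
  qed
  show "\<exists>c\<in>C2. dm1 c = p \<and> cd1 c = q \<and> \<kappa> 2 c = idc S 1 (\<kappa> 1 p)"
    if p: "p \<in> C1" and q: "q \<in> C1" and pq: "\<kappa> 1 p = \<kappa> 1 q" for p q
  proof -
    obtain e f where e: "e \<in> marks" "H 1 p = mcode e" "und e = p"
      and f: "f \<in> marks" "H 1 q = mcode f" "und f = q"
      using mark p q by metis
    have "fst e = fst f"
      using word[OF p q pq] e f inj_wcode by (simp add: inj_eq)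
    \<comment> \<open>Both marks end at the value of the same word, so they can be composed to a
      2-cell from \<open>p\<close> to \<open>q\<close>, which lies in \<open>collapsed\<close> by
      its closure properties.\<close>
    then have "snd e \<odot> inv2 (snd f) \<in> collapsed" "dm1 (snd e \<odot> inv2 (snd f)) = p"
      "cd1 (snd e \<odot> inv2 (snd f)) = q"
      using marksD[OF e(1)] marksD[OF f(1)] e(3) f(3) by (simp_all add: und_def)
    then show ?thesis
      unfolding collapsed_def by (metis (mono_tags, lifting) iso_cell mem_Collect_eq)
  qed
  show "s = t"
    if s: "s \<in> C2" and t: "t \<in> C2" and st: "dm1 s = dm1 t" "cd1 s = cd1 t" "\<kappa> 2 s = \<kappa> 2 t" for s t
  proof -
    have image: "\<exists>e f. H 2 a = mk.c2 e f a \<and> e \<in> marks \<and> f \<in> marks \<and> dm1 a = und e \<and> cd1 a = und f \<and>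
        H 1 (dm1 a) = mcode e \<and> H 1 (cd1 a) = mcode f" if a: "a \<in> C2" for a
    proof -
      obtain e f b where b: "H 2 a = mk.c2 e f b" "e \<in> marks" "f \<in> marks" "dm1 b = und e" "cd1 b = und f"
        by (rule marked_cells_2[OF H.map_cells[OF a]])
      \<comment> \<open>The label is recovered by \<open>forget\<close>, which undoes
        \<open>H\<close>.\<close>
      have "b = a" using sec[OF a] b(1) by simp
      moreover have "H 1 (dm1 a) = mcode e" "H 1 (cd1 a) = mcode f"
        using H.map_dm[of a 1] H.map_cd[of a 1] a b(1) by simp_all
      ultimately show ?thesis using b by blast
    qed
    obtain e f where e: "H 2 s = mk.c2 e f s" "e \<in> marks" "f \<in> marks" "dm1 s = und e" "cd1 s = und f"
      "H 1 (dm1 s) = mcode e" "H 1 (cd1 s) = mcode f"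
      using image[OF s] by blast
    obtain e' f' where e': "H 2 t = mk.c2 e' f' t" "H 1 (dm1 t) = mcode e'" "H 1 (cd1 t) = mcode f'"
      using image[OF t] by blast
    \<comment> \<open>The marks at the ends are the images of the boundary 1-cells, hence equal for
      parallel 2-cells.\<close>
    have ef: "e' = e" "f' = f" using e e' st by simp_all
    then have "to_word 2 (mk.c2 e f s) = to_word 2 (mk.c2 e f t)"
      using word[OF s t st(3)] e(1) e'(1) by simp
    then show ?thesis
      using to_word_faithful[of e f s t] e st s t by simp
  qed
qed

end

section \<open>The diagram of a bicategory\<close>

text \<open>
  Below dimension 1 and above it, \<open>\<kappa>\<close> is injective on parallel cells, so only the diagonal is possible
  there. In dimension 1, faithfulness of \<open>\<kappa>\<close> makes the bridge-cell between two given 1-cells unique.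
\<close>

definition coherence_bridge ::
  "'b bicat \<Rightarrow> 'c omega_magma \<Rightarrow> (nat \<Rightarrow> 'b \<Rightarrow> 'c) \<Rightarrow> nat \<Rightarrow> ('b \<times> 'b \<times> 'b) set"
  where "coherence_bridge B S \<kappa> i = (if i = 1
    then {(p, q, c). c \<in> cells B 2 \<and> dm B 1 c = p \<and> cd B 1 c = q \<and> \<kappa> 2 c = idc S 1 (\<kappa> 1 p)}
    else diagonal_bridge B i)"

context free_comparison
begin

abbreviation "R \<equiv> coherence_bridge B S \<kappa>"

lemma bridge_1: "(p, q, c) \<in> R 1 \<longleftrightarrow> c \<in> C2 \<and> dm1 c = p \<and> cd1 c = q \<and> \<kappa> 2 c = idc S 1 (\<kappa> 1 p)"
  by (simp add: coherence_bridge_def)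

lemma bridge_other: "i \<noteq> 1 \<Longrightarrow> (a, b, c) \<in> R i \<longleftrightarrow> a \<in> cells B i \<and> b = a \<and> c = idc B i a"
  by (auto simp: coherence_bridge_def diagonal_bridge_def)

lemma bridge_1_\<kappa>:
  assumes "(p, q, c) \<in> R 1" shows "\<kappa> 1 p = \<kappa> 1 q"
  using assms \<kappa>_simps(4)[of c] \<kappa>_simps(9)[of p] by (auto simp: bridge_1)

lemma bridge_relation_coherence: "bridge_relation B R"
proof
  fix i
  show "R i \<subseteq> cells B i \<times> cells B i \<times> cells B (Suc i)"
    by (cases "i = 1") (auto simp: bridge_1 bridge_other idc_cells)
next
  fix a b c i assume "(a, b, c) \<in> R i"
  then show "parallel B i a b" "dm B i c = a" "cd B i c = b"
    by (cases "i = 1"; auto simp: bridge_1 bridge_other parallel_def dm_idc cd_idc)+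
next
  fix a i assume "a \<in> cells B i"
  then show "(a, a, idc B i a) \<in> R i"
    by (cases "i = 1") (auto simp: bridge_1 bridge_other \<kappa>_simps)
next
  fix a b c d i assume "(a, b, c) \<in> R i" "(a, b, d) \<in> R i"
  then show "c = d"
    by (cases "i = 1") (auto simp: bridge_1 bridge_other intro: \<kappa>_faithful)
qed

lemma \<kappa>_eq_other:
  assumes "parallel B i a b" "i \<noteq> 1" "\<kappa> i a = \<kappa> i b"
  shows "a = b"
proof -
  have ab: "a \<in> cells B i" "b \<in> cells B i"
    and par: "\<And>j. i = Suc j \<Longrightarrow> dm B j a = dm B j b \<and> cd B j a = cd B j b"
    using assms(1) by (auto simp: parallel_def)
  consider "i = 0" | "i = 2" | j where "i = Suc j" "2 \<le> j"
    using assms(2) by (cases i) fastforce+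
  then show ?thesis
  proof cases
    case 1
    then show ?thesis using \<kappa>_inj_0 ab assms(3) by simp
  next
    case 2
    then show ?thesis using \<kappa>_faithful ab assms(3) par[of 1] by simp
  next
    \<comment> \<open>Here parallelism alone suffices: both cells are the identity of their common
      domain.\<close>
    case 3
    then show ?thesis using ab par[of j] skeletal_idc_dm[OF two_skeletal 3(2)] by metis
  qed
qed

lemma categorical_penon_morphism_coherence:
  "categorical_penon_morphism (magma_of_bicat B) R S (diagonal_bridge S) \<kappa>"
proof -
  interpret M: omega_magma "magma_of_bicat B"
    by (rule omega_magma_magma_of_bicat) unfold_locales
  interpret R: bridge_relation B R by (rule bridge_relation_coherence)
  interpret MR: bridge_relation "magma_of_bicat B" R
    by unfold_locales
      (use R.bridge_cells R.bridge_parallel R.bridge_dm R.bridge_cd R.bridge_refl R.bridge_unique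
        in \<open>auto simp: parallel_def\<close>)
  interpret D: bridge_relation S "diagonal_bridge S"
    by unfold_locales
      (auto simp: diagonal_bridge_def parallel_def S.idc_cells S.dm_idc S.cd_idc)
  have eq: "\<kappa> i a = \<kappa> i b \<and> \<kappa> (Suc i) c = idc S i (\<kappa> i a)" if "(a, b, c) \<in> R i" for a b c i
    using that bridge_1_\<kappa>[of a b c] by (cases "i = 1") (auto simp: bridge_1 bridge_other \<kappa>.map_idc)
  interpret K: omega_magma_morphism "magma_of_bicat B" S \<kappa>
    by (rule omega_magma_morphism_cong[OF \<kappa>.omega_magma_morphism_axioms]) simp_all
  show ?thesis
  proof
    fix a b c i assume abc: "(a, b, c) \<in> R i"
    then show "\<kappa> i a = \<kappa> i b" "\<kappa> (Suc i) c = idc S i (\<kappa> i a)"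
      using eq by blast+
    moreover have "\<kappa> i a \<in> cells S i"
      using R.bridge_cells abc K.map_cells by fastforce
    ultimately show "(\<kappa> i a, \<kappa> i b, \<kappa> (Suc i) c) \<in> diagonal_bridge S i"
      by (simp add: diagonal_bridge_def)
  next
    fix i a b assume "parallel (magma_of_bicat B) i a b" and k: "\<kappa> i a = \<kappa> i b"
    then have par: "parallel B i a b" by (simp add: parallel_def)
    show "\<exists>c. (a, b, c) \<in> R i"
    proof (cases "i = 1")
      case True
      then show ?thesis using \<kappa>_connected[of a b] par k by (auto simp: parallel_def bridge_1)
    next
      case False
      then show ?thesis using \<kappa>_eq_other[OF par False k] par by (auto simp: bridge_other parallel_def)
    qed
  qed simp
qed

text \<open>A collapsed 2-cell and its inverse are both bridge-cells, and the strict map \<Lambda>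
  carries inverse pairs to inverse pairs.\<close>

lemma bridge_image_isoI:
  assumes W: "bridge W = R" "lam W = \<Lambda>" and \<Lambda>: "strong_homomorphism B Y \<Lambda>"
    and c: "c \<in> collapsed" "dm1 c = p" "cd1 c = q" "\<Lambda> 2 c = e"
  shows "bridge_image_iso Y W p q e"
proof -
  interpret \<Lambda>: strong_homomorphism B Y \<Lambda> by fact
  have iso: "iso c" "inv2 c \<in> collapsed" using c(1) by simp_all
  have "(p, q, c) \<in> R 1" "(q, p, inv2 c) \<in> R 1"
    using c(1) iso(2) unfolding bridge_1 collapsed_def c(2,3)[symmetric] by simp_all
  moreover have "inverse_2cells Y e (\<Lambda> 2 (inv2 c))"
    using iso(1) c(4) \<Lambda>.map_cells[of c 2] \<Lambda>.map_cells[of "inv2 c" 2]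
      \<Lambda>.map_dm[of c 1] \<Lambda>.map_cd[of c 1] \<Lambda>.map_dm[of "inv2 c" 1] \<Lambda>.map_cd[of "inv2 c" 1]
      \<Lambda>.map_cmp[of 1 2 c "inv2 c"] \<Lambda>.map_cmp[of 1 2 "inv2 c" c] \<Lambda>.map_idc[of "dm1 c" 1]
      \<Lambda>.map_idc[of "cd1 c" 1]
    by (simp add: inverse_2cells_def composable_low)
  ultimately show ?thesis
    unfolding bridge_image_iso_def W using c(4) by blast
qed

end

lemma transpose_hom:
  fixes B Z :: "'u bicat"
  assumes "free_bicategory G B \<rho>" "bicategory Z" "omega_graph_morphism G (graph_of_bicat Z) F"
  shows "strong_homomorphism B Z (transpose G B \<rho> Z F)" "extends G \<rho> F (transpose G B \<rho> Z F)"
proof -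
  have "\<exists>H. strong_homomorphism B Z H \<and> extends G \<rho> F H"
    using assms unfolding free_bicategory_def by blast
  then have "strong_homomorphism B Z (transpose G B \<rho> Z F) \<and> extends G \<rho> F (transpose G B \<rho> Z F)"
    unfolding transpose_def by (rule someI_ex)
  then show "strong_homomorphism B Z (transpose G B \<rho> Z F)" "extends G \<rho> F (transpose G B \<rho> Z F)"
    by auto
qed

theorem theorem20:
  fixes Y FB :: "'u bicat"
    and FS :: "'u omega_magma"
    and \<rho> \<eta> :: "nat \<Rightarrow> 'u \<Rightarrow> 'u"
  assumes "infinite (UNIV :: 'u set)"
    and "bicategory Y"
    and "free_bicategory (graph_of_bicat Y) FB \<rho>"
    and "free_strict_omega_category (graph_of_bicat Y) FS \<eta>"
  shows "\<exists>R. weak_2_category (bicat_diagram Y FB \<rho> FS \<eta> R) \<and>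
             coherence_from_bridges Y (bicat_diagram Y FB \<rho> FS \<eta> R)"
proof -
  let ?G = "graph_of_bicat Y"
  interpret Y: bicategory Y by fact
  have skel: "skeletal 2 ?G" using Y.two_skeletal by simp
  obtain pr :: "'u \<times> 'u \<Rightarrow> 'u" where pr: "inj pr" using infinite_inj_pair[OF assms(1)] .
  obtain ls :: "'u list \<Rightarrow> 'u" where ls: "inj ls" using infinite_inj_list[OF assms(1)] .
  have S: "strict_omega_category FS" and \<eta>: "omega_graph_morphism ?G (bicat_of_strict FS) \<eta>"
    using assms(4)
    by (simp_all add: free_strict_omega_category_def omega_graph_morphism_graph_of_magma
        omega_graph_morphism_bicat_of_strict)
  define \<kappa> where "\<kappa> = transpose ?G FB \<rho> (bicat_of_strict FS) \<eta>"
  define \<Lambda> where "\<Lambda> = transpose ?G FB \<rho> Y (\<lambda>i x. x)"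
  \<comment> \<open>The transpose needs a bicategory as its target, which for \<open>FS\<close>
    rests on its being 2-skeletal.\<close>
  have \<kappa>: "strong_homomorphism FB (bicat_of_strict FS) \<kappa>" "extends ?G \<rho> \<eta> \<kappa>"
    unfolding \<kappa>_def
    using transpose_hom[OF assms(3)
        bicategory_bicat_of_strict[OF S free_strict_omega_category_skeletal[OF assms(4) skel]]] \<eta>
    by (simp_all add: omega_graph_morphism_graph_of_bicat)
  have "omega_graph_morphism Y Y (\<lambda>i x. x)"
    by unfold_locales simp_all
  then have id: "omega_graph_morphism ?G ?G (\<lambda>i x. x)"
    by (rule omega_graph_morphism_cong) simp_all
  note \<Lambda> = transpose_hom[OF assms(3,2) id, folded \<Lambda>_def]
  interpret \<Lambda>: strong_homomorphism FB Y \<Lambda> by (rule \<Lambda>)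
  interpret C: free_comparison FB ?G \<rho> FS \<eta> \<kappa> pr ls
    by (intro free_comparison.intro free_comparison_axioms.intro)
      (fact \<Lambda>.dom.bicategory_axioms assms(3,4) skel \<kappa> pr ls)+
  let ?W = "bicat_diagram Y FB \<rho> FS \<eta> C.R"
  have W: "und ?W = magma_of_bicat Y" "mid ?W = magma_of_bicat FB" "str ?W = FS" "lam ?W = \<Lambda>"
    "rho ?W = \<rho>" "bridge ?W = C.R" "kap ?W = \<kappa>"
    by (simp_all add: bicat_diagram_def \<kappa>_def \<Lambda>_def)
  have \<Lambda>\<rho>: "\<Lambda> i (\<rho> i x) = x" if "x \<in> cells Y i" for i x
    using \<Lambda>(2) that by (simp add: extends_def)
  interpret K: categorical_penon_morphism "magma_of_bicat FB" C.R FS "diagonal_bridge FS" \<kappa>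
    by (rule C.categorical_penon_morphism_coherence)
  have "weak_omega_category ?W"
    unfolding weak_omega_category_def W
  proof (intro conjI)
    show "omega_magma_morphism (magma_of_bicat FB) (magma_of_bicat Y) \<Lambda>"
      by (rule omega_magma_morphism_cong[OF \<Lambda>.omega_magma_morphism_axioms]) simp_all
    show "omega_graph_morphism (magma_of_bicat Y) (magma_of_bicat FB) \<rho>"
      by (rule omega_graph_morphism_cong[OF C.\<rho>.omega_graph_morphism_axioms]) simp_all
    show "omega_magma (magma_of_bicat Y)"
      using omega_magma_magma_of_bicat assms(2) .
  qed (use \<Lambda>\<rho> S K.dom.bridge_relation_axioms K.categorical_penon_morphism_axioms
      K.dom.omega_magma_axioms in simp_all)
  then have "weak_2_category ?W"
    using Y.two_skeletal by (simp add: weak_2_category_def W)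
  moreover have "coherence_from_bridges Y ?W"
    unfolding coherence_from_bridges_def W(2,5)
  proof (intro conjI allI impI ballI)
    \<comment> \<open>The bridge-cell is the associator of \<open>FB\<close> at the three
      generators; it is collapsed. As \<Lambda> is strict and \<Lambda> after \<rho> is the
      identity, its image is the associator of \<open>Y\<close>. The unitors are treated in the same
      way.\<close>
    fix f g h assume fgh: "composable Y 0 1 f g \<and> composable Y 0 1 g h"
    then have p: "f \<in> cells Y 1" "g \<in> cells Y 1" "h \<in> cells Y 1" "cd Y 0 f = dm Y 0 g" "cd Y 0 g = dm Y 0 h"
      by (simp_all add: composable_low)
    then show "bridge_image_iso Y ?W
       (cmp (magma_of_bicat FB) 0 1 (cmp (magma_of_bicat FB) 0 1 (\<rho> 1 f) (\<rho> 1 g)) (\<rho> 1 h))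
       (cmp (magma_of_bicat FB) 0 1 (\<rho> 1 f) (cmp (magma_of_bicat FB) 0 1 (\<rho> 1 g) (\<rho> 1 h)))
       (associator Y f g h)"
      using \<Lambda>.map_associator[of "\<rho> 1 f" "\<rho> 1 g" "\<rho> 1 h"]
      by (intro C.bridge_image_isoI[OF W(6,4) \<Lambda>(1), of "associator FB (\<rho> 1 f) (\<rho> 1 g) (\<rho> 1 h)"])
        (simp_all add: composable_low \<Lambda>\<rho>)
  next
    fix f assume f: "f \<in> cells Y 1"
    then show "bridge_image_iso Y ?W (cmp (magma_of_bicat FB) 0 1
        (idc (magma_of_bicat FB) 0 (dm (magma_of_bicat FB) 0 (\<rho> 1 f))) (\<rho> 1 f)) (\<rho> 1 f) (lunitor Y f)"
      using \<Lambda>.map_lunitor[of "\<rho> 1 f"]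
      by (intro C.bridge_image_isoI[OF W(6,4) \<Lambda>(1), of "lunitor FB (\<rho> 1 f)"]) (simp_all add: \<Lambda>\<rho>)
    show "bridge_image_iso Y ?W (cmp (magma_of_bicat FB) 0 1 (\<rho> 1 f)
        (idc (magma_of_bicat FB) 0 (cd (magma_of_bicat FB) 0 (\<rho> 1 f)))) (\<rho> 1 f) (runitor Y f)"
      using f \<Lambda>.map_runitor[of "\<rho> 1 f"]
      by (intro C.bridge_image_isoI[OF W(6,4) \<Lambda>(1), of "runitor FB (\<rho> 1 f)"]) (simp_all add: \<Lambda>\<rho>)
  qed
  ultimately show ?thesis by blast
qed

end
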